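(* Let $\mathcal{D}=\mathcal{D}^1\times\mathcal{D}^2$ be any product dyadic grid in $\mathbb{R}^n\times\mathbb{R}^m$, let $1<p<\infty$, and let $W$ be a $d\times d$-matrix valued weight on $\mathbb{R}^n\times\mathbb{R}^m$. Define the modified dyadic strong Christ–Goldberg maximal function $$\widetilde M_{\mathcal{D},W}f(x):=\sup_{R\in\mathcal{D}}\Big(\frac1{|R|}\int_R|\mathcal{W}_Rf(y)|\,dy\Big)\mathbf{1}_R(x),\qquad x\in\mathbb{R}^{n+m},\ f\in L^1_{\mathrm{loc}}(\mathbb{R}^{n+m};\mathbb{C}^d),$$ where $\mathcal{W}_R$ is the reducing operator of $W$ over $R$ corresponding to the exponent $p$. Then $$\|\widetilde M_{\mathcal{D},W}\|_{L^p(W)\to L^p}\lesssim_{p,d,n,m}[W]_{A_p,\mathcal{D}}^{\frac{p+1}{p(p-1)}}.$$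
   Context: $x\lesssim_{a,b}y$ means $x\le cy$ with a finite constant $c$ depending only on $a,b$; an estimate with infinite right-hand side is vacuous. $p'=p/(p-1)$. A dyadic grid in $\mathbb{R}$ is a collection $\bigcup_{k\in\mathbb{Z}}\mathcal{D}_k$ of left-closed right-open intervals, where each $\mathcal{D}_k$ partitions $\mathbb{R}$ into intervals of length $2^{-k}$ and each interval of $\mathcal{D}_k$ is the union of exactly two intervals of $\mathcal{D}_{k+1}$. A dyadic grid in $\mathbb{R}^n$ is the family of cubes $I_1\times\dots\times I_n$ with $I_i$ in the $i$-th of $n$ given dyadic grids in $\mathbb{R}$, all of the same length. A product dyadic grid $\mathcal{D}=\mathcal{D}^1\times\mathcal{D}^2$ in $\mathbb{R}^n\times\mathbb{R}^m$ is the family of rectangles $R_1\times R_2$, $R_i\in\mathcal{D}^i$. A $d\times d$-matrix valued weight is a locally integrable $M_d(\mathbb{C})$-valued function, positive definite a.e. $\|f\|_{L^p(W)}:=(\int|W^{1/p}f|^p)^{1/p}$. $[W]_{A_p,\mathcal{D}}:=\sup_{R\in\mathcal{D}}\frac1{|R|}\int_R\big(\frac1{|R|}\int_R|W(x)^{1/p}W(y)^{-1/p}|^{p'}dy\big)^{p/p'}dx$. Reducing operator: a positive definite matrix $\mathcal{W}_E$ with $\big(\frac1{|E|}\int_E|W^{1/p}e|^p\big)^{1/p}\le|\mathcal{W}_Ee|\le\sqrt d\big(\frac1{|E|}\int_E|W^{1/p}e|^p\big)^{1/p}$ for all $e\in\mathbb{C}^d$ (such matrices exist; any fixed choice is allowed).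 *)

theory Defs
  imports "HOL-Analysis.Analysis"
begin

section \<open>Extended nonnegative reals, averages and norms\<close>

(* Only used with exponents a > 0, so that \<infinity> powr a = \<infinity> and 0 powr a = 0. *)
definition ennreal_powr :: "ennreal \<Rightarrow> real \<Rightarrow> ennreal" where
  "ennreal_powr x a = (if x = \<infinity> then \<infinity> else ennreal (enn2real x powr a))"

definition nn_average :: "'a::euclidean_space set \<Rightarrow> ('a \<Rightarrow> ennreal) \<Rightarrow> ennreal" where
  "nn_average E g = (\<integral>\<^sup>+x\<in>E. g x \<partial>lebesgue) / emeasure lebesgue E"

definition Lp_norm :: "real \<Rightarrow> ('a::euclidean_space \<Rightarrow> ennreal) \<Rightarrow> ennreal" where
  "Lp_norm p g = ennreal_powr (\<integral>\<^sup>+x. ennreal_powr (g x) p \<partial>lebesgue) (1 / p)"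

definition locally_integrable :: "('a::euclidean_space \<Rightarrow> 'b::euclidean_space) \<Rightarrow> bool" where
  "locally_integrable f \<longleftrightarrow> (\<forall>K. compact K \<longrightarrow> f absolutely_integrable_on K)"

definition conj_exponent :: "real \<Rightarrow> real" where
  "conj_exponent p = p / (p - 1)"

section \<open>Matrices\<close>

definition conj_transpose :: "complex^'d^'d \<Rightarrow> complex^'d^'d" where
  "conj_transpose A = (\<chi> i j. cnj (A $ j $ i))"

definition positive_definite :: "complex^'d^'d \<Rightarrow> bool" where
  "positive_definite A \<longleftrightarrow> conj_transpose A = A \<and>
     (\<forall>v. v \<noteq> 0 \<longrightarrow> 0 < Re (\<Sum>i\<in>UNIV. cnj (v $ i) * (A *v v) $ i))"

definition unitary_matrix :: "complex^'d^'d \<Rightarrow> bool" where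
  "unitary_matrix U \<longleftrightarrow> conj_transpose U ** U = mat 1 \<and> U ** conj_transpose U = mat 1"

definition real_diag :: "('d \<Rightarrow> real) \<Rightarrow> complex^'d^'d" where
  "real_diag l = (\<chi> i j. if i = j then complex_of_real (l i) else 0)"

(* Spectral functional calculus for a positive definite matrix A.  The result does not depend
   on the chosen diagonalisation; it is unspecified when A is not positive definite. *)
definition matrix_powr :: "complex^'d^'d \<Rightarrow> real \<Rightarrow> complex^'d^'d" where
  "matrix_powr A s = (THE B. \<exists>U l. unitary_matrix U \<and> (\<forall>i. 0 < l i) \<and>
     A = U ** real_diag l ** conj_transpose U \<and>
     B = U ** real_diag (\<lambda>i. l i powr s) ** conj_transpose U)"

(* Operator norm with respect to the Euclidean norm; the library's norm on complex^'d^'d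
   is the Frobenius norm. *)
definition matrix_opnorm :: "complex^'d^'d \<Rightarrow> real" where
  "matrix_opnorm A = onorm ((*v) A)"

section \<open>Dyadic grids\<close>

(* G k is the generation consisting of intervals of length 2^(-k). *)
definition dyadic_grid_line :: "(int \<Rightarrow> real set set) \<Rightarrow> bool" where
  "dyadic_grid_line G \<longleftrightarrow>
     (\<forall>k. partition_on UNIV (G k)) \<and>
     (\<forall>k. \<forall>I\<in>G k. \<exists>a. I = {a..<a + 2 powi (- k)}) \<and>
     (\<forall>k. \<forall>I\<in>G k. \<exists>J\<in>G (k + 1). \<exists>J'\<in>G (k + 1). J \<noteq> J' \<and> I = J \<union> J')"

definition dyadic_grid :: "(real^'n) set set \<Rightarrow> bool" where
  "dyadic_grid \<D> \<longleftrightarrow> (\<exists>G. (\<forall>i. dyadic_grid_line (G i)) \<and>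
     \<D> = {Q. \<exists>k I. (\<forall>i. I i \<in> G i k) \<and> Q = {x. \<forall>i. x $ i \<in> I i}})"

definition product_grid ::
  "(real^'n) set set \<Rightarrow> (real^'m) set set \<Rightarrow> ((real^'n) \<times> (real^'m)) set set" where
  "product_grid \<D>1 \<D>2 = {R1 \<times> R2 | R1 R2. R1 \<in> \<D>1 \<and> R2 \<in> \<D>2}"

section \<open>Matrix weights\<close>

definition matrix_weight :: "('a::euclidean_space \<Rightarrow> complex^'d^'d) \<Rightarrow> bool" where
  "matrix_weight W \<longleftrightarrow> locally_integrable W \<and> (AE x in lebesgue. positive_definite (W x))"

definition weighted_Lp_norm ::
  "real \<Rightarrow> ('a::euclidean_space \<Rightarrow> complex^'d^'d) \<Rightarrow> ('a \<Rightarrow> complex^'d) \<Rightarrow> ennreal" where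
  "weighted_Lp_norm p W f = Lp_norm p (\<lambda>x. ennreal (norm (matrix_powr (W x) (1 / p) *v f x)))"

definition weighted_Lp_space ::
  "real \<Rightarrow> ('a::euclidean_space \<Rightarrow> complex^'d^'d) \<Rightarrow> ('a \<Rightarrow> complex^'d) set" where
  "weighted_Lp_space p W =
     {f. f \<in> borel_measurable lebesgue \<and> weighted_Lp_norm p W f < \<infinity>}"

definition Ap_char ::
  "real \<Rightarrow> 'a::euclidean_space set set \<Rightarrow> ('a \<Rightarrow> complex^'d^'d) \<Rightarrow> ennreal" where
  "Ap_char p \<D> W = (SUP R\<in>\<D>. nn_average R (\<lambda>x.
     ennreal_powr
       (nn_average R (\<lambda>y. ennreal
          (matrix_opnorm (matrix_powr (W x) (1 / p) ** matrix_powr (W y) (- 1 / p))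
             powr conj_exponent p)))
       (p / conj_exponent p)))"

definition reducing_operator ::
  "real \<Rightarrow> ('a::euclidean_space \<Rightarrow> complex^'d^'d) \<Rightarrow> 'a set \<Rightarrow> complex^'d^'d \<Rightarrow> bool" where
  "reducing_operator p W E A \<longleftrightarrow> positive_definite A \<and>
     (\<forall>e. let N = ennreal_powr
                    (nn_average E (\<lambda>x. ennreal (norm (matrix_powr (W x) (1 / p) *v e) powr p)))
                    (1 / p)
          in N \<le> ennreal (norm (A *v e)) \<and>
             ennreal (norm (A *v e)) \<le> ennreal (sqrt (real CARD('d))) * N)"

section \<open>The maximal function\<close>

(* Values in [0, \<infinity>]; the family WR assigns a matrix (a reducing operator of the weight)
   to each rectangle of the grid. *)
definition modified_CG_maximal ::
  "'a::euclidean_space set set \<Rightarrow> ('a set \<Rightarrow> complex^'d^'d) \<Rightarrow>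
     ('a \<Rightarrow> complex^'d) \<Rightarrow> 'a \<Rightarrow> ennreal" where
  "modified_CG_maximal \<D> WR f x =
     (SUP R\<in>\<D>. nn_average R (\<lambda>y. ennreal (norm (WR R *v f y))) * indicator R x)"

(* The norm of T from L^p(W) to L^p; it is \<infinity> if T is unbounded. *)
definition weighted_op_norm ::
  "real \<Rightarrow> ('a::euclidean_space \<Rightarrow> complex^'d^'d) \<Rightarrow>
     (('a \<Rightarrow> complex^'d) \<Rightarrow> 'a \<Rightarrow> ennreal) \<Rightarrow> ennreal" where
  "weighted_op_norm p W T =
     Inf {c. \<forall>f\<in>weighted_Lp_space p W. Lp_norm p (T f) \<le> c * weighted_Lp_norm p W f}"

end

theory Submission
  imports Defs
begin

text \<open>
  Write \<open>P = W\<^sup>1\<^sup>/\<^sup>p\<close>, \<open>Q = P\<^sup>-\<^sup>1\<close>, \<open>A\<close> for the \<open>A\<^sub>p\<close> characteristic and \<open>p' = p/(p-1)\<close>. For a rectangle \<open>R\<close>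
  with reducing matrix \<open>B\<close>, the pointwise bound
  \<open>|B f| \<le> \<Sum>\<^sub>b |Q B b| |P f|\<close> over an orthonormal basis and Hoelder's inequality with exponents
  \<open>s' = p' (1 + \<epsilon>)\<close> and \<open>s < p\<close> reduce the average of \<open>|B f|\<close> to two quantities.

  The first is the average of \<open>|Q B b|\<close> to the power \<open>s'\<close>. The scalar weight \<open>w = |Q e|\<close> to the power \<open>p'\<close>
  satisfies \<open>avg w \<le> K (avg \<surd>w)\<^sup>2\<close> on every rectangle, with \<open>K\<close> the \<open>1/(p-1)\<close>-th power of \<open>A\<close>
  (\<open>N_sqrt_bound\<close>). Such a condition yields a reverse Hoelder inequality with an exponent gain
  \<open>\<epsilon>\<close> proportional to \<open>1/K\<close> and an absolute constant (\<open>reverse_Holder\<close>), and it passes to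
  averages in one of the two variables, so that the one-parameter inequality can be applied in one
  variable after the other (\<open>reverse_Holder_rect\<close>). Hence the \<open>s'\<close>-mean may be replaced by the
  \<open>p'\<close>-mean, which duality bounds by a constant times \<open>A\<close> to the power \<open>1/p\<close> (\<open>N_reducing\<close>).

  The second is the strong dyadic maximal function of \<open>|P f|\<^sup>s\<close>, to be estimated in \<open>L\<^sup>q\<close>, \<open>q = p/s\<close>.
  Two applications of Doob's inequality bound the \<open>q\<close>-th power of its norm by a constant times
  \<open>1/(q-1)\<^sup>2\<close>, and \<open>q - 1\<close> is comparable to \<open>\<epsilon>\<close>, hence to \<open>1/K\<close> (\<open>strong_maximal_bound\<close>).

  Together, the \<open>p\<close>-th power of the operator norm is at most a constant times \<open>A K\<^sup>2\<close>, that is, \<open>A\<close> to the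
  power \<open>1 + 2/(p-1) = (p+1)/(p-1)\<close>.

  The one-parameter theory is developed for abstract nested grids of cells, where Doob's
  inequality and the reverse Hoelder inequality are both obtained by telescoping along the running
  maximum of the conditional averages.
\<close>

section \<open>Powers and Hoelder's inequality in the extended half-line\<close>

lemma ennreal_powr_ennreal [simp]: "0 \<le> r \<Longrightarrow> ennreal_powr (ennreal r) a = ennreal (r powr a)"
  by (simp add: ennreal_powr_def)

lemma ennreal_powr_top [simp]: "ennreal_powr top a = top"
  by (simp add: ennreal_powr_def)

lemma ennreal_powr_0 [simp]: "ennreal_powr 0 a = 0"
  by (simp add: ennreal_powr_def)

lemma ennreal_powr_1 [simp]: "ennreal_powr x 1 = x"
  by (cases x) auto

lemma ennreal_powr_one [simp]: "ennreal_powr 1 a = 1"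
  using ennreal_powr_ennreal[of 1 a] by simp

lemma ennreal_powr_mono: "0 \<le> a \<Longrightarrow> x \<le> y \<Longrightarrow> ennreal_powr x a \<le> ennreal_powr y a"
  by (cases x; cases y) (auto intro!: ennreal_leI powr_mono2 simp: top_unique)

lemma ennreal_powr_powr: "ennreal_powr (ennreal_powr x a) b = ennreal_powr x (a * b)"
  by (cases x) (auto simp: powr_powr)

lemma ennreal_powr_mult:
  assumes "0 < a" shows "ennreal_powr (x * y) a = ennreal_powr x a * ennreal_powr y a"
proof (cases x; cases y)
  fix r s :: real assume "0 \<le> r" "0 \<le> s" "x = ennreal r" "y = ennreal s"
  thus ?thesis by (simp add: powr_mult flip: ennreal_mult)
next
  fix r :: real assume "0 \<le> r" "x = ennreal r" "y = top"
  thus ?thesis by (cases "r = 0") (auto simp: ennreal_mult_top)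
next
  fix r :: real assume "0 \<le> r" "x = top" "y = ennreal r"
  thus ?thesis by (cases "r = 0") (auto simp: ennreal_top_mult)
qed auto

lemma ennreal_powr_add: "ennreal_powr x a * ennreal_powr x b = ennreal_powr x (a + b)"
  by (cases x) (auto simp: powr_add simp flip: ennreal_mult)

lemma ennreal_powr_eq_0_iff [simp]: "ennreal_powr x a = 0 \<longleftrightarrow> x = 0"
  by (cases x) auto

lemma ennreal_powr_eq_top_iff [simp]: "ennreal_powr x a = top \<longleftrightarrow> x = top"
  by (cases x) auto

lemma ennreal_powr_less_top [simp]: "ennreal_powr x a < top \<longleftrightarrow> x < top"
  by (metis ennreal_powr_eq_top_iff less_top)

lemma ennreal_powr_le_iff: "0 < a \<Longrightarrow> ennreal_powr x a \<le> y \<longleftrightarrow> x \<le> ennreal_powr y (1 / a)"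
  using ennreal_powr_mono[of a x "ennreal_powr y (1/a)"] ennreal_powr_mono[of "1/a" "ennreal_powr x a" y]
  by (auto simp: ennreal_powr_powr)

lemma ennreal_powr_SUP:
  assumes "0 < a" shows "ennreal_powr (SUP i\<in>I. f i) a = (SUP i\<in>I. ennreal_powr (f i) a)"
proof (rule antisym)
  show "ennreal_powr (SUP i\<in>I. f i) a \<le> (SUP i\<in>I. ennreal_powr (f i) a)"
    unfolding ennreal_powr_le_iff[OF assms] SUP_le_iff
    by (auto simp flip: ennreal_powr_le_iff[OF assms] intro: SUP_upper)
qed (auto intro!: SUP_least ennreal_powr_mono SUP_upper simp: assms less_imp_le)

lemma measurable_ennreal_powr [measurable (raw)]:
  assumes [measurable]: "f \<in> borel_measurable M"
  shows "(\<lambda>x. ennreal_powr (f x) a) \<in> borel_measurable M"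
  unfolding ennreal_powr_def by measurable

lemma ennreal_Young:
  fixes x y :: ennreal
  assumes "1 < p" "1 < q" "1 / p + 1 / q = 1"
  shows "x * y \<le> ennreal (1/q) * ennreal_powr x q + ennreal (1/p) * ennreal_powr y p"
proof (cases "x = top \<or> y = top")
  case True thus ?thesis using assms by (auto simp: ennreal_mult_top)
next
  case False
  then obtain r s where rs: "x = ennreal r" "y = ennreal s" "0 \<le> r" "0 \<le> s"
    by (metis ennreal_cases)
  have "r * s \<le> r powr q / q + s powr p / p"
    using Youngs_inequality[of q p r s] assms rs by (simp add: add.commute)
  thus ?thesis using rs assms by (simp flip: ennreal_mult ennreal_plus add: ennreal_leI)
qed

text \<open>Young's inequality, integrated after both factors have been normalised. If one of the
  two norms vanishes, so does the left-hand side; if one is infinite and the other is not zero, the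
  right-hand side is infinite.\<close>
lemma nn_integral_Holder:
  assumes [measurable]: "f \<in> borel_measurable M" "g \<in> borel_measurable M"
    and pq: "1 < p" "1 < q" "1 / p + 1 / q = 1"
  shows "(\<integral>\<^sup>+x. f x * g x \<partial>M) \<le>
    ennreal_powr (\<integral>\<^sup>+x. ennreal_powr (f x) q \<partial>M) (1/q) * ennreal_powr (\<integral>\<^sup>+x. ennreal_powr (g x) p \<partial>M) (1/p)"
    (is "?L \<le> ennreal_powr ?A _ * ennreal_powr ?B _")
proof -
  consider "?A = 0" | "?B = 0" | "?A = top" "?B \<noteq> 0" | "?B = top" "?A \<noteq> 0"
    | "?A \<noteq> 0" "?B \<noteq> 0" "?A \<noteq> top" "?B \<noteq> top" by blast
  thus ?thesis
  proof cases
    case 1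
    hence "AE x in M. f x = 0" by (simp add: nn_integral_0_iff_AE)
    hence "?L = (\<integral>\<^sup>+x. 0 \<partial>M)" by (intro nn_integral_cong_AE) auto
    thus ?thesis by simp
  next
    case 2
    hence "AE x in M. g x = 0" by (simp add: nn_integral_0_iff_AE)
    hence "?L = (\<integral>\<^sup>+x. 0 \<partial>M)" by (intro nn_integral_cong_AE) auto
    thus ?thesis by simp
  next
    case 3 thus ?thesis by (simp add: ennreal_top_mult)
  next
    case 4 thus ?thesis by (simp add: ennreal_mult_top)
  next
    case 5
    then obtain A B where AB: "?A = ennreal A" "?B = ennreal B" "0 < A" "0 < B"
      by (metis ennreal_cases ennreal_0 less_eq_real_def)
    define a b where "a = A powr (1/q)" and "b = B powr (1/p)"
    have ab: "0 < a" "0 < b" using AB by (auto simp: a_def b_def)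
    have ai: "(1 / a) powr q = 1 / A" "(1 / b) powr p = 1 / B"
      using AB pq by (auto simp: a_def b_def powr_divide powr_powr)
    have "f x * g x \<le> ennreal (a * b) * (ennreal (1/q * (1/A)) * ennreal_powr (f x) q + ennreal (1/p * (1/B)) * ennreal_powr (g x) p)" for x
    proof -
      have "f x * g x = ennreal (a * b) * ((ennreal (1/a) * f x) * (ennreal (1/b) * g x))"
      proof -
        have "ennreal (a * b) * (ennreal (1/a) * ennreal (1/b)) = 1"
          using ab by (simp flip: ennreal_mult)
        thus ?thesis by (metis mult.assoc mult.left_commute mult_1)
      qed
      also have "\<dots> \<le> ennreal (a * b) * (ennreal (1/q) * ennreal_powr (ennreal (1/a) * f x) q + ennreal (1/p) * ennreal_powr (ennreal (1/b) * g x) p)"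
        by (intro mult_left_mono ennreal_Young pq) auto
      also have "\<dots> = ennreal (a * b) * (ennreal (1/q * (1/A)) * ennreal_powr (f x) q + ennreal (1/p * (1/B)) * ennreal_powr (g x) p)"
        using ab AB pq by (simp add: ennreal_powr_mult ai ennreal_mult mult.assoc del: times_divide_eq_right times_divide_eq_left)
      finally show ?thesis .
    qed
    hence "?L \<le> (\<integral>\<^sup>+x. ennreal (a * b) * (ennreal (1/q * (1/A)) * ennreal_powr (f x) q + ennreal (1/p * (1/B)) * ennreal_powr (g x) p) \<partial>M)"
      by (intro nn_integral_mono) auto
    also have "\<dots> = ennreal (a * b) * (ennreal (1/q * (1/A)) * ?A + ennreal (1/p * (1/B)) * ?B)"
      by (simp add: nn_integral_cmult nn_integral_add del: times_divide_eq_right times_divide_eq_left)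
    also have "\<dots> = ennreal (a * b) * ennreal (1/q + 1/p)"
      using AB pq unfolding AB by (simp flip: ennreal_mult ennreal_plus)
    also have "\<dots> = ennreal_powr ?A (1/q) * ennreal_powr ?B (1/p)"
      using AB pq unfolding AB by (simp add: a_def b_def ennreal_mult add.commute)
    finally show ?thesis .
  qed
qed

section \<open>Averages over a set of positive finite measure\<close>

lemma nn_average_eq:
  "nn_average E g = (\<integral>\<^sup>+x. g x * indicator E x \<partial>lborel) / emeasure lebesgue E"
  by (simp add: nn_average_def nn_integral_completion)

locale finite_cell =
  fixes E :: "'a::euclidean_space set"
  assumes sets_E [measurable]: "E \<in> sets borel"
    and pos: "0 < emeasure lborel E" and fin: "emeasure lborel E < top"
begin

abbreviation "mu \<equiv> emeasure lborel E"

lemma nn_average_lborel: "nn_average E g = (\<integral>\<^sup>+x. g x * indicator E x \<partial>lborel) / mu"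
  using sets_E by (simp add: nn_average_eq)

lemma mu_ne: "mu \<noteq> 0" "mu \<noteq> top" using pos fin by auto

lemma average_times: "nn_average E g * mu = (\<integral>\<^sup>+x. g x * indicator E x \<partial>lborel)"
  unfolding nn_average_lborel using mu_ne
  by (metis ennreal_divide_times ennreal_mult_divide_eq ennreal_times_divide mult.commute mult.right_neutral ennreal_divide_self less_top)

lemma average_const [simp]: "nn_average E (\<lambda>_. c) = c"
  unfolding nn_average_lborel using mu_ne sets_E
  by (simp add: nn_integral_cmult_indicator ennreal_mult_divide_eq)

lemma average_mono: "(\<And>x. x \<in> E \<Longrightarrow> f x \<le> g x) \<Longrightarrow> nn_average E f \<le> nn_average E g"
  unfolding nn_average_lborel
  by (intro divide_right_mono_ennreal nn_integral_mono) (auto simp: indicator_def)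

lemma average_mono_AE: "AE x in lborel. x \<in> E \<longrightarrow> f x \<le> g x \<Longrightarrow> nn_average E f \<le> nn_average E g"
  unfolding nn_average_lborel
  by (intro divide_right_mono_ennreal nn_integral_mono_AE) (auto simp: indicator_def)

lemma average_cong: "(\<And>x. x \<in> E \<Longrightarrow> f x = g x) \<Longrightarrow> nn_average E f = nn_average E g"
  by (intro antisym average_mono) auto

lemma average_cmult: "f \<in> borel_measurable borel \<Longrightarrow> nn_average E (\<lambda>x. c * f x) = c * nn_average E f"
  unfolding nn_average_lborel by (simp add: nn_integral_cmult mult.assoc ennreal_times_divide)

lemma average_add: "f \<in> borel_measurable borel \<Longrightarrow> g \<in> borel_measurable borel \<Longrightarrow>
   nn_average E (\<lambda>x. f x + g x) = nn_average E f + nn_average E g"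
  unfolding nn_average_lborel by (simp add: nn_integral_add distrib_right add_divide_distrib_ennreal)

lemma average_sum: "finite I \<Longrightarrow> (\<And>i. i \<in> I \<Longrightarrow> f i \<in> borel_measurable borel) \<Longrightarrow>
   nn_average E (\<lambda>x. \<Sum>i\<in>I. f i x) = (\<Sum>i\<in>I. nn_average E (f i))"
  by (induction I rule: finite_induct) (auto simp: average_add)

text \<open>Hoelder's inequality is homogeneous with respect to the measure because the exponents
  are conjugate; so it survives the division by the measure of the cell.\<close>
lemma average_Holder:
  assumes [measurable]: "f \<in> borel_measurable borel" "g \<in> borel_measurable borel"
    and pq: "1 < p" "1 < q" "1 / p + 1 / q = 1"
  shows "nn_average E (\<lambda>x. f x * g x) \<le>
    ennreal_powr (nn_average E (\<lambda>x. ennreal_powr (f x) q)) (1/q) *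
    ennreal_powr (nn_average E (\<lambda>x. ennreal_powr (g x) p)) (1/p)"
proof -
  have i: "ennreal_powr (h x * indicator E x) r = ennreal_powr (h x) r * indicator E x" for r h x
    by (auto simp: indicator_def)
  have "(\<integral>\<^sup>+x. f x * g x * indicator E x \<partial>lborel) = (\<integral>\<^sup>+x. (f x * indicator E x) * (g x * indicator E x) \<partial>lborel)"
    by (intro nn_integral_cong) (auto simp: indicator_def)
  also have "\<dots> \<le> ennreal_powr (\<integral>\<^sup>+x. ennreal_powr (f x) q * indicator E x \<partial>lborel) (1/q) *
     ennreal_powr (\<integral>\<^sup>+x. ennreal_powr (g x) p * indicator E x \<partial>lborel) (1/p)"
    using nn_integral_Holder[of "\<lambda>x. f x * indicator E x" lborel "\<lambda>x. g x * indicator E x" p q] pq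
    by (simp add: i)
  also have "\<dots> = ennreal_powr (nn_average E (\<lambda>x. ennreal_powr (f x) q)) (1/q) *
    ennreal_powr (nn_average E (\<lambda>x. ennreal_powr (g x) p)) (1/p) * (ennreal_powr mu (1/q) * ennreal_powr mu (1/p))"
    unfolding average_times[symmetric] using pq by (simp add: ennreal_powr_mult mult_ac)
  also have "ennreal_powr mu (1/q) * ennreal_powr mu (1/p) = mu"
    using pq by (simp add: ennreal_powr_add add.commute)
  finally show ?thesis
    unfolding nn_average_lborel[of "\<lambda>x. f x * g x"]
    using mu_ne by (metis divide_right_mono_ennreal ennreal_mult_divide_eq)
qed

lemma average_Jensen:
  assumes [measurable]: "f \<in> borel_measurable borel" and q: "1 \<le> q"
  shows "ennreal_powr (nn_average E f) q \<le> nn_average E (\<lambda>x. ennreal_powr (f x) q)"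
proof (cases "q = 1")
  case False
  hence "1 < q" using q by simp
  define p where "p = q / (q - 1)"
  have p: "1 < p" "1 / p + 1 / q = 1" using \<open>1 < q\<close> by (auto simp: p_def field_simps)
  have "nn_average E f \<le> ennreal_powr (nn_average E (\<lambda>x. ennreal_powr (f x) q)) (1/q)"
    using average_Holder[of f "\<lambda>_. 1" p q] p \<open>1 < q\<close> by simp
  thus ?thesis using \<open>1 < q\<close> by (subst ennreal_powr_le_iff) auto
qed simp

lemma average_Jensen_concave:
  assumes [measurable]: "f \<in> borel_measurable borel" and q: "0 < q" "q \<le> 1"
  shows "nn_average E (\<lambda>x. ennreal_powr (f x) q) \<le> ennreal_powr (nn_average E f) q"
  using average_Jensen[of "\<lambda>x. ennreal_powr (f x) q" "1/q"] q
  by (simp add: ennreal_powr_powr ennreal_powr_le_iff)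

end

section \<open>Running maxima of real sequences\<close>

primrec running_max :: "(nat \<Rightarrow> real) \<Rightarrow> nat \<Rightarrow> real" where
  "running_max e 0 = e 0"
| "running_max e (Suc n) = max (running_max e n) (e (Suc n))"

lemma running_max_ge: "k \<le> n \<Longrightarrow> e k \<le> running_max e n"
  by (induction n) (auto simp: le_Suc_eq intro: max.coboundedI1)

lemma running_max_nonneg: "0 \<le> e 0 \<Longrightarrow> 0 \<le> running_max e n"
  using running_max_ge[of 0 n e] by simp

lemma running_max_cong: "(\<And>k. k \<le> n \<Longrightarrow> e k = e' k) \<Longrightarrow> running_max e n = running_max e' n"
  by (induction n) auto

lemma running_max_attained: "\<exists>k\<le>n. running_max e n = e k"
  by (induction n) (auto simp: max_def le_Suc_eq)

lemma running_max_le_square: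
  assumes "\<And>k. k \<le> n \<Longrightarrow> e k \<le> K * (g k)\<^sup>2" "\<And>k. 0 \<le> g k" "0 \<le> K"
  shows "running_max e n \<le> K * (running_max g n)\<^sup>2"
proof -
  obtain k where k: "k \<le> n" "running_max e n = e k" using running_max_attained by blast
  have "K * (g k)\<^sup>2 \<le> K * (running_max g n)\<^sup>2"
    using assms k running_max_ge by (intro mult_left_mono power_mono) auto
  thus ?thesis using assms(1)[of k] k by simp
qed

text \<open>The pathwise form of Doob's inequality. In the only interesting case \<open>b = c >
  a\<close>, the difference \<open>b\<^sup>p - a\<^sup>p\<close> is \<open>p/(p-1)\<close> times the
  integral of \<open>t\<close> against \<open>d(t powr (p-1))\<close> from \<open>a\<close> to
  \<open>b\<close>, where \<open>t \<le> b\<close>. The proof is Young's inequality for \<open>a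
  powr (p-1)\<close> and \<open>c\<close>.\<close>
lemma Doob_increment:
  fixes a c p :: real
  assumes "0 \<le> a" "0 \<le> c" "1 < p" and b: "b = max a c"
  shows "b powr p \<le> a powr p + p / (p - 1) * ((b powr (p - 1) - a powr (p - 1)) * c)"
proof (cases "c \<le> a")
  case False
  hence bc: "b = c" "0 < c" using b assms by auto
  define q where "q = p / (p - 1)"
  have q: "1 < q" "1 / q + 1 / p = 1" "(p - 1) * q = p" "q / p = q - 1"
    using assms by (auto simp: q_def field_simps)
  have "a powr (p - 1) * c \<le> a powr p / q + c powr p / p"
    using Youngs_inequality[of q p "a powr (p - 1)" c] assms q by (simp add: powr_powr)
  hence "q * (a powr (p - 1) * c) \<le> q * (a powr p / q + c powr p / p)"
    using q by (intro mult_left_mono) auto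
  also have "\<dots> = a powr p + (q / p) * c powr p" using q by (simp add: field_simps)
  finally have *: "q * (a powr (p - 1) * c) \<le> a powr p + (q - 1) * c powr p" using q by simp
  have "c powr (p - 1) * c = c powr p" using bc by (simp add: powr_mult_base mult.commute)
  hence "q * ((c powr (p - 1) - a powr (p - 1)) * c) = q * c powr p - q * (a powr (p - 1) * c)"
    by (simp only: left_diff_distrib right_diff_distrib)
  with * bc have "b powr p \<le> a powr p + q * ((b powr (p - 1) - a powr (p - 1)) * c)"
    by (simp add: left_diff_distrib)
  thus ?thesis by (simp only: q_def)
qed (use b in auto)

text \<open>The doubling bound \<open>b \<le> D a\<close> trades the factor \<open>b\<close> for
  \<open>D a\<close>, and concavity of \<open>t powr \<epsilon>\<close> bounds the difference by its
  tangent at \<open>a\<close>. The small factor \<open>\<epsilon>\<close> comes from the slope of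
  that tangent; it is what makes the absorption in the reverse Hoelder inequality possible.\<close>
lemma doubling_increment:
  fixes a b D :: real
  assumes "0 \<le> a" "a \<le> b" "b \<le> D * a" "0 < \<epsilon>" "\<epsilon> \<le> 1"
  shows "(b powr \<epsilon> - a powr \<epsilon>) * b \<le> \<epsilon> * D * (b powr (1 + \<epsilon>) - a powr (1 + \<epsilon>))"
proof (cases "a = 0")
  case False
  hence a: "0 < a" "0 < b" using assms by auto
  have D: "0 \<le> D" using assms a by (smt (verit) mult_neg_pos)
  have "b powr \<epsilon> * a powr (1 - \<epsilon>) \<le> \<epsilon> * b + (1 - \<epsilon>) * a"
    using Youngs_inequality_0[of \<epsilon> "1 - \<epsilon>" b a] assms a by simp
  moreover have "a powr \<epsilon> * a powr (1 - \<epsilon>) = a" using a by (simp flip: powr_add)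
  ultimately have "(b powr \<epsilon> - a powr \<epsilon>) * a powr (1 - \<epsilon>) \<le> \<epsilon> * (b - a)"
    by (simp add: algebra_simps)
  hence "(b powr \<epsilon> - a powr \<epsilon>) * a powr (1 - \<epsilon>) * a powr \<epsilon> \<le> \<epsilon> * (b - a) * a powr \<epsilon>"
    by (intro mult_right_mono) auto
  hence 1: "(b powr \<epsilon> - a powr \<epsilon>) * a \<le> \<epsilon> * ((b - a) * a powr \<epsilon>)"
    using a by (simp add: mult.assoc flip: powr_add)
  have mono: "a powr \<epsilon> \<le> b powr \<epsilon>" using assms by (intro powr_mono2) auto
  have "(b - a) * a powr \<epsilon> \<le> b * b powr \<epsilon> - a * a powr \<epsilon>"
    using mono a mult_left_mono[OF mono, of b] by (simp add: algebra_simps)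
  also have "\<dots> = b powr (1 + \<epsilon>) - a powr (1 + \<epsilon>)" using a by (simp add: powr_add)
  finally have 2: "(b - a) * a powr \<epsilon> \<le> b powr (1 + \<epsilon>) - a powr (1 + \<epsilon>)" .
  have "(b powr \<epsilon> - a powr \<epsilon>) * b \<le> (b powr \<epsilon> - a powr \<epsilon>) * (D * a)"
    using mono assms by (intro mult_left_mono) auto
  also have "\<dots> \<le> D * (\<epsilon> * ((b - a) * a powr \<epsilon>))" using mult_left_mono[OF 1 D] by (simp add: ac_simps)
  also have "\<dots> \<le> D * (\<epsilon> * (b powr (1 + \<epsilon>) - a powr (1 + \<epsilon>)))"
    using 2 D assms by (intro mult_left_mono) auto
  finally show ?thesis by (simp add: ac_simps)
qed (use assms in auto)

lemma ennreal_absorb_half: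
  fixes X :: ennreal
  assumes "X \<le> ennreal (1/2) * X + Y" "X < top"
  shows "X \<le> 2 * Y"
proof (cases Y)
  case (real y)
  obtain x where x: "X = ennreal x" "0 \<le> x" using assms(2) by (cases X) auto
  have "ennreal (1/2) * ennreal x + ennreal y = ennreal (x / 2 + y)"
    using x real ennreal_mult[of "1/2" x] by (simp add: ennreal_plus)
  hence "ennreal x \<le> ennreal (x / 2 + y)"
    using assms(1) real x by simp
  hence "x \<le> x / 2 + y" using x real by (subst (asm) ennreal_le_iff) auto
  hence "ennreal x \<le> ennreal (2 * y)" by (intro ennreal_leI) auto
  thus ?thesis using x real by (simp add: ennreal_mult)
qed (auto simp: ennreal_mult_top)

section \<open>Nested grids, conditional averages and Doob's inequality\<close>

locale cell_grid =
  fixes cell :: "int \<Rightarrow> 'a::euclidean_space \<Rightarrow> 'a set"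
  assumes countable_cells: "countable (range (cell k))"
    and sets_cell [measurable]: "cell k x \<in> sets borel"
    and cell_pos: "0 < emeasure lborel (cell k x)"
    and cell_fin: "emeasure lborel (cell k x) < top"
    and cell_self: "x \<in> cell k x"
    and cell_eq: "y \<in> cell k x \<Longrightarrow> cell k y = cell k x"
    and cell_step: "cell (k + 1) x \<subseteq> cell k x"
begin

sublocale cl: finite_cell "cell k x" for k x
  by unfold_locales (auto simp: cell_pos cell_fin)

text \<open>The conditional expectation given the cells of generation \<open>k\<close>.\<close>
definition E :: "int \<Rightarrow> ('a \<Rightarrow> ennreal) \<Rightarrow> 'a \<Rightarrow> ennreal" where
  "E k f x = nn_average (cell k x) f"

lemma cell_mono: "k \<le> l \<Longrightarrow> cell l x \<subseteq> cell k x"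
  by (induction l rule: int_ge_induct) (use cell_step in blast)+

lemma cell_eq_mono: "k \<le> l \<Longrightarrow> y \<in> cell l x \<Longrightarrow> cell k y = cell k x"
  using cell_mono cell_eq by blast

lemma cell_iff: "y \<in> cell k x \<longleftrightarrow> cell k y = cell k x"
  using cell_eq cell_self by metis

lemma E_const: "k \<le> l \<Longrightarrow> y \<in> cell l x \<Longrightarrow> E k f y = E k f x"
  unfolding E_def using cell_eq_mono by metis

lemma measurable_cellwise_const:
  assumes "\<And>x y. y \<in> cell k x \<Longrightarrow> g y = g x"
  shows "g \<in> borel_measurable borel"
proof (rule measurableI)
  fix A :: "'b set"
  have "g -` A \<inter> space borel = \<Union> {C \<in> range (cell k). \<exists>x\<in>C. g x \<in> A}"
  proof (intro equalityI subsetI)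
    fix x assume "x \<in> g -` A \<inter> space borel"
    thus "x \<in> \<Union> {C \<in> range (cell k). \<exists>x\<in>C. g x \<in> A}"
      using cell_self[of x k] by blast
  next
    fix x assume "x \<in> \<Union> {C \<in> range (cell k). \<exists>x\<in>C. g x \<in> A}"
    then obtain z y where "x \<in> cell k z" "y \<in> cell k z" "g y \<in> A" by blast
    thus "x \<in> g -` A \<inter> space borel" using assms[of x z] assms[of y z] by simp
  qed
  also have "\<dots> \<in> sets borel"
    by (intro sets.countable_Union countable_subset[OF _ countable_cells[of k]]) auto
  finally show "g -` A \<inter> space borel \<in> sets borel" .
qed auto

lemma measurable_E [measurable]: "E k f \<in> borel_measurable borel"
  by (rule measurable_cellwise_const[of k]) (auto intro: E_const)

lemma nn_integral_cells:
  assumes [measurable]: "h \<in> borel_measurable borel"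
  shows "(\<integral>\<^sup>+x. h x \<partial>lborel) = (\<integral>\<^sup>+C. (\<integral>\<^sup>+x. h x * indicator C x \<partial>lborel) \<partial>count_space (range (cell k)))"
proof -
  have "(\<integral>\<^sup>+C. h x * indicator C x \<partial>count_space (range (cell k))) = h x" for x
  proof -
    have "(\<integral>\<^sup>+C. h x * indicator C x \<partial>count_space (range (cell k))) = (\<Sum>C\<in>{cell k x}. h x * indicator C x)"
    proof (rule nn_integral_count_space')
      fix C assume "C \<in> range (cell k)" "C \<notin> {cell k x}"
      thus "h x * indicator C x = 0" using cell_eq by (auto simp: indicator_def)
    qed auto
    thus ?thesis using cell_self by simp
  qed
  hence "(\<integral>\<^sup>+x. h x \<partial>lborel) = (\<integral>\<^sup>+x. (\<integral>\<^sup>+C. h x * indicator C x \<partial>count_space (range (cell k))) \<partial>lborel)"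
    by simp
  also have "\<dots> = (\<integral>\<^sup>+C. (\<integral>\<^sup>+x. h x * indicator C x \<partial>lborel) \<partial>count_space (range (cell k)))"
    by (rule nn_integral_count_space_nn_integral) (auto simp: countable_cells)
  finally show ?thesis .
qed

text \<open>The defining property of a conditional expectation; the martingale arguments below all
  go through it.\<close>
lemma nn_integral_cellwise_const_mult:
  assumes [measurable]: "f \<in> borel_measurable borel"
    and g: "\<And>x y. y \<in> cell k x \<Longrightarrow> g y = (g x :: ennreal)"
  shows "(\<integral>\<^sup>+x. g x * f x \<partial>lborel) = (\<integral>\<^sup>+x. g x * E k f x \<partial>lborel)"
proof -
  have [measurable]: "g \<in> borel_measurable borel" by (rule measurable_cellwise_const) (rule g)
  have "(\<integral>\<^sup>+x. g x * f x * indicator C x \<partial>lborel) = (\<integral>\<^sup>+x. g x * E k f x * indicator C x \<partial>lborel)"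
    if C: "C \<in> range (cell k)" for C
  proof -
    obtain z where z: "C = cell k z" using C by auto
    have "(\<integral>\<^sup>+x. g x * f x * indicator C x \<partial>lborel) = (\<integral>\<^sup>+x. g z * (f x * indicator (cell k z) x) \<partial>lborel)"
      using g z by (intro nn_integral_cong) (auto simp: indicator_def)
    also have "\<dots> = g z * (E k f z * emeasure lborel (cell k z))"
      by (simp add: nn_integral_cmult E_def cl.average_times)
    also have "\<dots> = (\<integral>\<^sup>+x. (g z * E k f z) * indicator (cell k z) x \<partial>lborel)"
      by (subst nn_integral_cmult_indicator) (auto simp: mult.assoc)
    also have "\<dots> = (\<integral>\<^sup>+x. g x * E k f x * indicator C x \<partial>lborel)"
    proof (intro nn_integral_cong)
      fix x show "(g z * E k f z) * indicator (cell k z) x = g x * E k f x * indicator C x"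
        using g[of x z] E_const[of k k x z f] z by (auto simp: indicator_def)
    qed
    finally show ?thesis .
  qed
  hence "(\<integral>\<^sup>+C. (\<integral>\<^sup>+x. g x * f x * indicator C x \<partial>lborel) \<partial>count_space (range (cell k))) =
      (\<integral>\<^sup>+C. (\<integral>\<^sup>+x. g x * E k f x * indicator C x \<partial>lborel) \<partial>count_space (range (cell k)))"
    by (rule nn_integral_cong) simp
  thus ?thesis by (simp add: nn_integral_cells[of _ k])
qed

lemma nn_integral_E: "f \<in> borel_measurable borel \<Longrightarrow> (\<integral>\<^sup>+x. E k f x \<partial>lborel) = (\<integral>\<^sup>+x. f x \<partial>lborel)"
  using nn_integral_cellwise_const_mult[of f k "\<lambda>_. 1"] by simp

lemma average_E:
  assumes [measurable]: "f \<in> borel_measurable borel" and "k \<le> l"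
  shows "nn_average (cell k x) (E l f) = nn_average (cell k x) f"
proof -
  have *: "y \<in> cell l z \<Longrightarrow> (indicator (cell k x) y :: ennreal) = indicator (cell k x) z" for y z
    using cell_eq_mono[OF assms(2), of y z] by (simp add: indicator_def cell_iff)
  show ?thesis
    using nn_integral_cellwise_const_mult[of f l "indicator (cell k x)"] * assms
    by (simp add: cl.nn_average_lborel mult.commute)
qed

lemma E_tower: "f \<in> borel_measurable borel \<Longrightarrow> k \<le> l \<Longrightarrow> E k (E l f) = E k f"
  by (auto simp: fun_eq_iff E_def[of k] average_E)

lemma E_Jensen:
  "f \<in> borel_measurable borel \<Longrightarrow> 1 \<le> q \<Longrightarrow> ennreal_powr (E k f x) q \<le> E k (\<lambda>y. ennreal_powr (f y) q) x"
  unfolding E_def by (rule cl.average_Jensen)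

text \<open>Real-valued, so that increments of powers can be formed. The value is \<open>0\<close>
  where the conditional average is infinite.\<close>
definition martingale :: "int \<Rightarrow> ('a \<Rightarrow> ennreal) \<Rightarrow> 'a \<Rightarrow> nat \<Rightarrow> real" where
  "martingale a f x k = enn2real (E (a + int k) f x)"

definition maximal :: "int \<Rightarrow> ('a \<Rightarrow> ennreal) \<Rightarrow> nat \<Rightarrow> 'a \<Rightarrow> real" where
  "maximal a f n x = running_max (martingale a f x) n"

lemma martingale_nonneg [simp]: "0 \<le> martingale a f x k"
  by (simp add: martingale_def)

lemma maximal_nonneg [simp]: "0 \<le> maximal a f n x"
  by (simp add: maximal_def running_max_nonneg)

lemma maximal_Suc: "maximal a f (Suc n) x = max (maximal a f n x) (martingale a f x (Suc n))"
  by (simp add: maximal_def)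

lemma maximal_ge: "k \<le> n \<Longrightarrow> martingale a f x k \<le> maximal a f n x"
  by (simp add: maximal_def running_max_ge)

lemma martingale_const: "k \<le> n \<Longrightarrow> y \<in> cell (a + int n) x \<Longrightarrow> martingale a f y k = martingale a f x k"
  unfolding martingale_def using E_const[of "a + int k" "a + int n" y x f] by auto

lemma maximal_const: "m \<le> n \<Longrightarrow> y \<in> cell (a + int n) x \<Longrightarrow> maximal a f m y = maximal a f m x"
  unfolding maximal_def by (rule running_max_cong) (metis martingale_const order_trans)

lemma measurable_maximal [measurable]: "maximal a f n \<in> borel_measurable borel"
  by (rule measurable_cellwise_const[of "a + int n"]) (auto intro: maximal_const)

lemma measurable_martingale [measurable]: "(\<lambda>x. martingale a f x k) \<in> borel_measurable borel"
  unfolding martingale_def by measurable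

lemma ennreal_martingale: "E (a + int k) f x < top \<Longrightarrow> ennreal (martingale a f x k) = E (a + int k) f x"
  by (simp add: martingale_def less_top)

text \<open>The increment of a power of the running maximum from step \<open>n\<close> to step
  \<open>n + 1\<close> is constant on cells of generation \<open>a + n + 1\<close>. Hence
  \<open>f\<close> may be replaced by its conditional average of that generation when it is
  integrated against the increment.\<close>
lemma nn_integral_increment:
  assumes [measurable]: "f \<in> borel_measurable borel"
    and fin: "\<And>x. E (a + int (Suc n)) f x < top" and "0 \<le> s"
  shows "(\<integral>\<^sup>+x. ennreal (maximal a f (Suc n) x powr s) * f x \<partial>lborel) =
    (\<integral>\<^sup>+x. ennreal (maximal a f n x powr s) * f x \<partial>lborel) +
    (\<integral>\<^sup>+x. ennreal ((maximal a f (Suc n) x powr s - maximal a f n x powr s) * martingale a f x (Suc n)) \<partial>lborel)"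
proof -
  let ?h = "\<lambda>x. maximal a f (Suc n) x powr s - maximal a f n x powr s"
  have h: "0 \<le> ?h x" for x
    using assms(3) by (auto simp: maximal_Suc intro!: powr_mono2)
  have "(\<integral>\<^sup>+x. ennreal (?h x * martingale a f x (Suc n)) \<partial>lborel) = (\<integral>\<^sup>+x. ennreal (?h x) * E (a + int (Suc n)) f x \<partial>lborel)"
    using h ennreal_martingale[OF fin] by (intro nn_integral_cong) (simp add: ennreal_mult)
  also have "\<dots> = (\<integral>\<^sup>+x. ennreal (?h x) * f x \<partial>lborel)"
  proof (rule nn_integral_cellwise_const_mult[symmetric])
    fix x y assume "y \<in> cell (a + int (Suc n)) x"
    thus "ennreal (?h y) = ennreal (?h x)" using maximal_const[of _ "Suc n" y a x f] by simp
  qed simp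
  finally have eq: "(\<integral>\<^sup>+x. ennreal (?h x * martingale a f x (Suc n)) \<partial>lborel) = (\<integral>\<^sup>+x. ennreal (?h x) * f x \<partial>lborel)" .
  have "ennreal (maximal a f (Suc n) x powr s) * f x = ennreal (maximal a f n x powr s) * f x + ennreal (?h x) * f x" for x
    using h[of x] by (simp flip: distrib_right ennreal_plus)
  thus ?thesis unfolding eq by (simp add: nn_integral_add)
qed

lemma E_finite_of_power_integrable:
  assumes [measurable]: "f \<in> borel_measurable borel" and p: "1 < p"
    and f: "(\<integral>\<^sup>+x. ennreal_powr (f x) p \<partial>lborel) \<noteq> top"
  shows "E k f x < top"
proof -
  have "E k (\<lambda>y. ennreal_powr (f y) p) x * emeasure lborel (cell k x) \<le> (\<integral>\<^sup>+x. ennreal_powr (f x) p \<partial>lborel)"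
    unfolding E_def cl.average_times by (intro nn_integral_mono) (auto simp: indicator_def)
  hence "E k (\<lambda>y. ennreal_powr (f y) p) x \<noteq> top"
    using f cl.mu_ne[of k x] by (auto simp: ennreal_top_mult top_unique)
  thus ?thesis using E_Jensen[of f p k x] p by (auto simp: less_top[symmetric] top_unique)
qed

text \<open>Summing the pathwise inequality gives \<open>\<integral> m\<^sup>p \<le> p/(p-1)
  \<integral> m powr (p-1) f\<close> for the maximum \<open>m\<close>, and Young's inequality lets
  half of the left-hand side be absorbed. The absorption is legitimate because
  \<open>m\<^sup>p\<close> is dominated by the sum of the \<open>p\<close>-th powers of finitely
  many conditional averages. The order \<open>1/(p-1)\<close> of the constant as \<open>p
  \<rightarrow> 1\<close> determines the exponent of the final estimate.\<close>
lemma Doob_finite: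
  assumes [measurable]: "f \<in> borel_measurable borel" and p: "1 < p"
  shows "(\<integral>\<^sup>+x. ennreal (maximal a f n x powr p) \<partial>lborel) \<le> ennreal (2 powr p / (p - 1)) * (\<integral>\<^sup>+x. ennreal_powr (f x) p \<partial>lborel)"
    (is "_ \<le> _ * ?F")
proof (cases "?F = top")
  case True thus ?thesis using p by (simp add: ennreal_mult_top)
next
  case False
  let ?X = "\<lambda>n. \<integral>\<^sup>+x. ennreal (maximal a f n x powr p) \<partial>lborel"
  let ?Y = "\<lambda>n. \<integral>\<^sup>+x. ennreal (maximal a f n x powr (p - 1)) * f x \<partial>lborel"
  define q where "q = p / (p - 1)"
  have q: "1 < q" "1 / p + 1 / q = 1" "(p - 1) * q = p" "q / p = 1 / (p - 1)"
    using p by (auto simp: q_def field_simps)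
  have fin: "E k f x < top" for k x by (rule E_finite_of_power_integrable[OF _ p False]) simp
  have eint: "(\<integral>\<^sup>+x. ennreal (martingale a f x k powr p) \<partial>lborel) \<le> ?F" for k
  proof -
    have "(\<integral>\<^sup>+x. ennreal (martingale a f x k powr p) \<partial>lborel) = (\<integral>\<^sup>+x. ennreal_powr (E (a + int k) f x) p \<partial>lborel)"
      by (simp flip: ennreal_martingale[OF fin])
    also have "\<dots> \<le> (\<integral>\<^sup>+x. E (a + int k) (\<lambda>y. ennreal_powr (f y) p) x \<partial>lborel)"
      using p by (intro nn_integral_mono E_Jensen) auto
    finally show ?thesis by (simp add: nn_integral_E)
  qed
  have Xfin: "?X n < top"
  proof (induction n)
    case 0 thus ?case using eint[of 0] False by (simp add: maximal_def less_top[symmetric] top_unique) (metis top_unique)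
  next
    case (Suc n)
    have "?X (Suc n) \<le>
      (\<integral>\<^sup>+x. ennreal (maximal a f n x powr p) + ennreal (martingale a f x (Suc n) powr p) \<partial>lborel)"
      by (intro nn_integral_mono) (auto simp: maximal_Suc max_def)
    also have "\<dots> < top" using Suc eint[of "Suc n"] False by (simp add: nn_integral_add less_top[symmetric]) (metis top_unique)
    finally show ?case .
  qed
  have step: "?X n \<le> ennreal q * ?Y n"
  proof (induction n)
    case 0
    have "?X 0 = (\<integral>\<^sup>+x. ennreal (maximal a f 0 x powr (p - 1)) * E (a + int 0) f x \<partial>lborel)"
    proof (intro nn_integral_cong)
      fix x
      have "maximal a f 0 x powr p = maximal a f 0 x powr (p - 1) * martingale a f x 0"
        using powr_mult_base[of "martingale a f x 0" "p - 1"] by (simp add: maximal_def mult.commute)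
      thus "ennreal (maximal a f 0 x powr p) = ennreal (maximal a f 0 x powr (p - 1)) * E (a + int 0) f x"
        by (simp only: ennreal_martingale[OF fin, symmetric] ennreal_mult'[OF powr_ge_zero])
    qed
    also have "\<dots> = ?Y 0"
    proof (rule nn_integral_cellwise_const_mult[symmetric])
      fix x y assume "y \<in> cell (a + int 0) x"
      thus "ennreal (maximal a f 0 y powr (p - 1)) = ennreal (maximal a f 0 x powr (p - 1))"
        using maximal_const[of 0 0 y a x f] by simp
    qed simp
    also have "\<dots> \<le> ennreal q * ?Y 0"
      using q mult_right_mono[of 1 "ennreal q" "?Y 0"]
      by simp
    finally show ?case .
  next
    case (Suc n)
    let ?h = "\<lambda>x. (maximal a f (Suc n) x powr (p - 1) - maximal a f n x powr (p - 1)) * martingale a f x (Suc n)"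
    have h: "0 \<le> ?h x" for x
      using p by (auto simp: maximal_Suc intro!: powr_mono2 mult_nonneg_nonneg)
    have "?X (Suc n) \<le> (\<integral>\<^sup>+x. ennreal (maximal a f n x powr p) + ennreal q * ennreal (?h x) \<partial>lborel)"
    proof (intro nn_integral_mono)
      fix x
      have "maximal a f (Suc n) x powr p \<le> maximal a f n x powr p + q * ?h x"
        unfolding q_def using p by (intro Doob_increment) (auto simp: maximal_Suc)
      hence "ennreal (maximal a f (Suc n) x powr p) \<le> ennreal (maximal a f n x powr p + q * ?h x)"
        by (rule ennreal_leI)
      also have "\<dots> = ennreal (maximal a f n x powr p) + ennreal q * ennreal (?h x)"
        using h[of x] q by (simp add: ennreal_plus ennreal_mult)
      finally show "ennreal (maximal a f (Suc n) x powr p) \<le> ennreal (maximal a f n x powr p) + ennreal q * ennreal (?h x)" .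
    qed
    also have "\<dots> = ?X n + ennreal q * (\<integral>\<^sup>+x. ennreal (?h x) \<partial>lborel)"
      by (simp add: nn_integral_add nn_integral_cmult)
    also have "\<dots> \<le> ennreal q * ?Y n + ennreal q * (\<integral>\<^sup>+x. ennreal (?h x) \<partial>lborel)"
      by (intro add_right_mono Suc)
    also have "\<dots> = ennreal q * ?Y (Suc n)"
      using p by (subst nn_integral_increment) (auto simp: fin distrib_left)
    finally show ?case .
  qed
  \<comment> \<open>Scaling by \<open>c\<close> makes the coefficient of the maximum in Young's inequality equal to \<open>1/2\<close>.\<close>
  define c :: real where "c = 2 powr (- 1 / q)"
  have c: "0 < c" "c powr q = 1/2" "(1/c) powr p = 2 powr (p - 1)"
  proof -
    show "0 < c" by (simp add: c_def)
    show "c powr q = 1/2" using q unfolding c_def powr_powr by (simp add: powr_minus_divide)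
    have "p / q = p - 1" using p by (simp add: q_def)
    thus "(1/c) powr p = 2 powr (p - 1)" by (simp add: c_def powr_minus_divide powr_powr powr_divide)
  qed
  have "ennreal q * (ennreal (maximal a f n x powr (p - 1)) * f x) \<le> ennreal (1/2) * ennreal (maximal a f n x powr p) + ennreal (2 powr (p - 1) / (p - 1)) * ennreal_powr (f x) p" for x
  proof -
    let ?m = "maximal a f n x"
    have "ennreal (?m powr (p - 1)) * f x = ennreal (c * ?m powr (p - 1)) * (ennreal (1/c) * f x)"
    proof -
      have "ennreal c * ennreal (1/c) = 1" using c by (simp flip: ennreal_mult)
      moreover have "ennreal (c * ?m powr (p - 1)) * (ennreal (1/c) * f x) = ennreal c * ennreal (1/c) * (ennreal (?m powr (p - 1)) * f x)"
        using c by (simp add: ennreal_mult mult_ac del: times_divide_eq_right times_divide_eq_left)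
      ultimately show ?thesis by simp
    qed
    also have "\<dots> \<le> ennreal (1/q) * ennreal_powr (ennreal (c * ?m powr (p - 1))) q + ennreal (1/p) * ennreal_powr (ennreal (1/c) * f x) p"
      by (rule ennreal_Young) (use p q in auto)
    also have "\<dots> = ennreal (1/q * (1/2 * ?m powr p)) + ennreal (1/p * 2 powr (p - 1)) * ennreal_powr (f x) p"
    proof -
      have 1: "ennreal_powr (ennreal (c * ?m powr (p - 1))) q = ennreal (1/2 * ?m powr p)"
        using c q by (simp add: powr_mult powr_powr)
      have 2: "ennreal_powr (ennreal (1/c) * f x) p = ennreal (2 powr (p - 1)) * ennreal_powr (f x) p"
        using c p by (simp add: ennreal_powr_mult)
      have 3: "ennreal (1/q * (1/2 * ?m powr p)) = ennreal (1/q) * ennreal (1/2 * ?m powr p)"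
        using q by (intro ennreal_mult') auto
      have 4: "ennreal (1/p * 2 powr (p - 1)) = ennreal (1/p) * ennreal (2 powr (p - 1))"
        using p by (intro ennreal_mult') auto
      show ?thesis unfolding 1 2 3 4 by (simp only: mult.assoc)
    qed
    finally have "ennreal q * (ennreal (?m powr (p - 1)) * f x) \<le> ennreal q * (ennreal (1/q * (1/2 * ?m powr p)) + ennreal (1/p * 2 powr (p - 1)) * ennreal_powr (f x) p)"
      by (intro mult_left_mono) auto
    also have "\<dots> = ennreal (q * (1/q * (1/2 * ?m powr p))) + ennreal (q * (1/p * 2 powr (p - 1))) * ennreal_powr (f x) p"
      using p q by (simp add: distrib_left ennreal_mult mult.assoc del: times_divide_eq_right times_divide_eq_left)
    also have "q * (1/q * (1/2 * ?m powr p)) = 1/2 * ?m powr p" using q by simp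
    also have "q * (1/p * 2 powr (p - 1)) = 2 powr (p - 1) / (p - 1)"
      using p by (simp add: q_def)
    also have "ennreal (1/2 * ?m powr p) = ennreal (1/2) * ennreal (?m powr p)"
      by (intro ennreal_mult') auto
    finally show ?thesis .
  qed
  hence "(\<integral>\<^sup>+x. ennreal q * (ennreal (maximal a f n x powr (p - 1)) * f x) \<partial>lborel) \<le>
    (\<integral>\<^sup>+x. ennreal (1/2) * ennreal (maximal a f n x powr p) + ennreal (2 powr (p - 1) / (p - 1)) * ennreal_powr (f x) p \<partial>lborel)"
    by (intro nn_integral_mono) auto
  also have "\<dots> = ennreal (1/2) * ?X n + ennreal (2 powr (p - 1) / (p - 1)) * ?F"
    by (simp add: nn_integral_add nn_integral_cmult)
  finally have "?X n \<le> 2 * (ennreal (2 powr (p - 1) / (p - 1)) * ?F)"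
    using step Xfin by (intro ennreal_absorb_half) (auto simp: nn_integral_cmult)
  also have "2 * (ennreal (2 powr (p - 1) / (p - 1)) * ?F) = ennreal (2 powr p / (p - 1)) * ?F"
  proof -
    have "2 * ennreal (2 powr (p - 1) / (p - 1)) = ennreal (2 * (2 powr (p - 1) / (p - 1)))"
      using p by (simp only: ennreal_mult') simp
    thus ?thesis by (simp add: powr_mult_base mult.assoc[symmetric])
  qed
  finally show ?thesis .
qed

theorem Doob:
  assumes [measurable]: "f \<in> borel_measurable borel" and p: "1 < p"
  shows "(\<integral>\<^sup>+x. ennreal_powr (SUP k. E k f x) p \<partial>lborel) \<le> ennreal (2 powr p / (p - 1)) * (\<integral>\<^sup>+x. ennreal_powr (f x) p \<partial>lborel)"
    (is "_ \<le> _ * ?F")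
proof (cases "?F = top")
  case True thus ?thesis using p by (simp add: ennreal_mult_top)
next
  case False
  have fin: "E k f x < top" for k x by (rule E_finite_of_power_integrable[OF _ p False]) simp
  define G where "G N x = (SUP k\<in>{- int N..int N}. ennreal_powr (E k f x) p)" for N x
  have inc: "incseq G"
    unfolding G_def by (auto intro!: incseq_SucI le_funI SUP_subset_mono)
  have "ennreal_powr (SUP k. E k f x) p \<le> (SUP N. G N x)" for x
    unfolding ennreal_powr_SUP[OF less_trans[OF zero_less_one p]]
  proof (rule SUP_least)
    fix k :: int
    show "ennreal_powr (E k f x) p \<le> (SUP N. G N x)"
      by (rule SUP_upper2[of "nat \<bar>k\<bar>"]) (auto simp: G_def intro!: SUP_upper)
  qed
  hence "(\<integral>\<^sup>+x. ennreal_powr (SUP k. E k f x) p \<partial>lborel) \<le> (\<integral>\<^sup>+x. (SUP N. G N x) \<partial>lborel)"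
    by (intro nn_integral_mono) auto
  also have "\<dots> = (SUP N. \<integral>\<^sup>+x. G N x \<partial>lborel)"
    by (rule nn_integral_monotone_convergence_SUP[OF inc]) (unfold G_def, measurable)
  also have "\<dots> \<le> ennreal (2 powr p / (p - 1)) * ?F"
  proof (rule SUP_least)
    fix N
    have "(\<integral>\<^sup>+x. G N x \<partial>lborel) \<le> (\<integral>\<^sup>+x. ennreal (maximal (- int N) f (2 * N) x powr p) \<partial>lborel)"
    proof (rule nn_integral_mono)
      fix x
      show "G N x \<le> ennreal (maximal (- int N) f (2 * N) x powr p)"
        unfolding G_def
      proof (rule SUP_least)
        fix k assume "k \<in> {- int N..int N}"
        then obtain j where j: "k = - int N + int j" "j \<le> 2 * N"
          by (intro that[of "nat (k + int N)"]) auto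
        have "ennreal_powr (E k f x) p = ennreal (martingale (- int N) f x j powr p)"
          unfolding j(1) ennreal_martingale[OF fin, symmetric] by simp
        also have "\<dots> \<le> ennreal (maximal (- int N) f (2 * N) x powr p)"
          using p j by (intro ennreal_leI powr_mono2 maximal_ge) auto
        finally show "ennreal_powr (E k f x) p \<le> \<dots>" .
      qed
    qed
    also have "\<dots> \<le> ennreal (2 powr p / (p - 1)) * ?F" by (rule Doob_finite) (use p in auto)
    finally show "(\<integral>\<^sup>+x. G N x \<partial>lborel) \<le> ennreal (2 powr p / (p - 1)) * ?F" .
  qed
  finally show ?thesis .
qed


lemma E_mono: "(\<And>y. y \<in> cell k x \<Longrightarrow> f y \<le> g y) \<Longrightarrow> E k f x \<le> E k g x"
  unfolding E_def by (rule cl.average_mono)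

end

section \<open>The sharp reverse Hoelder inequality in one parameter\<close>

locale doubling_grid = cell_grid cell for cell :: "int \<Rightarrow> 'a::euclidean_space \<Rightarrow> 'a set" +
  fixes D :: real
  assumes doubling: "emeasure lborel (cell k x) \<le> ennreal D * emeasure lborel (cell (k + 1) x)"
    and D_ge_1: "1 \<le> D"
begin

lemma E_doubling: "E (k + 1) f x \<le> ennreal D * E k f x"
proof -
  let ?m = "emeasure lborel (cell k x)" and ?m' = "emeasure lborel (cell (k + 1) x)"
  have "E (k + 1) f x * ?m' * ?m \<le> (ennreal D * E k f x) * ?m' * ?m"
  proof -
    have "E (k + 1) f x * ?m' \<le> E k f x * ?m"
      unfolding E_def cl.average_times using cell_step[of k x]
      by (intro nn_integral_mono) (auto simp: indicator_def)
    hence "E (k + 1) f x * ?m' * ?m \<le> E k f x * ?m * (ennreal D * ?m')"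
      by (intro mult_mono[OF _ doubling]) auto
    thus ?thesis by (simp add: ac_simps)
  qed
  hence "E (k + 1) f x * (?m' * ?m) / (?m' * ?m) \<le> ennreal D * E k f x * (?m' * ?m) / (?m' * ?m)"
    by (intro divide_right_mono_ennreal) (simp add: ac_simps)
  moreover have "?m' * ?m \<noteq> 0" "?m' * ?m \<noteq> top"
    using cl.mu_ne by (auto simp: ennreal_mult_eq_top_iff)
  ultimately show ?thesis by (simp add: ennreal_mult_divide_eq del: mult_eq_0_iff)
qed

lemma martingale_doubling:
  assumes "\<And>k x. E k f x < top"
  shows "martingale a f x (Suc k) \<le> D * martingale a f x k"
proof -
  have "ennreal (martingale a f x (Suc k)) \<le> ennreal D * ennreal (martingale a f x k)"
    using E_doubling[of "a + int k" f x] by (simp add: ennreal_martingale assms ac_simps)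
  thus ?thesis using D_ge_1 by (simp flip: ennreal_mult)
qed

text \<open>The telescoping form of the decomposition of level sets into stopping cells. When the
  running maximum jumps, its new value is the conditional average of the current generation, which
  is at most \<open>D\<close> times the previous maximum; so each increment is controlled by
  \<open>doubling_increment\<close>, and the right-hand sides telescope.\<close>
lemma maximal_layer:
  assumes [measurable]: "f \<in> borel_measurable borel" and fin: "\<And>k x. E k f x < top"
    and eps: "0 < \<epsilon>" "\<epsilon> \<le> 1"
  shows "(\<integral>\<^sup>+x. ennreal (maximal a f n x powr \<epsilon>) * f x \<partial>lborel) \<le>
    (\<integral>\<^sup>+x. ennreal (martingale a f x 0 powr \<epsilon>) * f x \<partial>lborel) +
    ennreal (\<epsilon> * D) * (\<integral>\<^sup>+x. ennreal (maximal a f n x powr (1 + \<epsilon>)) \<partial>lborel)"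
proof (induction n)
  case 0 thus ?case by (simp add: maximal_def)
next
  case (Suc n)
  let ?m = "maximal a f n" and ?M = "maximal a f (Suc n)" and ?e = "\<lambda>x. martingale a f x (Suc n)"
  let ?i = "\<lambda>x. \<epsilon> * D * (?M x powr (1 + \<epsilon>) - ?m x powr (1 + \<epsilon>))"
  let ?I = "\<integral>\<^sup>+x. ennreal (?i x) \<partial>lborel"
  let ?L = "ennreal (\<epsilon> * D) * (\<integral>\<^sup>+x. ennreal (?m x powr (1 + \<epsilon>)) \<partial>lborel)"
  have mM: "?m x \<le> ?M x" for x by (simp add: maximal_Suc)
  have pos: "0 \<le> ?M x powr s - ?m x powr s" if "0 \<le> s" for x s
    using mM that by (auto intro!: powr_mono2)
  have D: "0 \<le> \<epsilon> * D" using D_ge_1 eps by simp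
  have inc: "(?M x powr \<epsilon> - ?m x powr \<epsilon>) * ?e x \<le> ?i x" for x
  proof (cases "?e x \<le> ?m x")
    case True thus ?thesis by (simp add: maximal_Suc)
  next
    case False
    have "?e x \<le> D * martingale a f x n" by (rule martingale_doubling) (rule fin)
    also have "\<dots> \<le> D * ?m x" using D_ge_1 by (intro mult_left_mono maximal_ge) auto
    finally show ?thesis using False doubling_increment[of "?m x" "?e x" D \<epsilon>] eps
      by (simp add: maximal_Suc)
  qed
  have "(\<integral>\<^sup>+x. ennreal (?M x powr \<epsilon>) * f x \<partial>lborel) \<le>
      (\<integral>\<^sup>+x. ennreal (?m x powr \<epsilon>) * f x \<partial>lborel) +
      ?I"
    using inc eps fin by (subst nn_integral_increment) (auto intro!: add_left_mono nn_integral_mono ennreal_leI)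
  also have "\<dots> \<le> (\<integral>\<^sup>+x. ennreal (martingale a f x 0 powr \<epsilon>) * f x \<partial>lborel) +
     (?L +
      ?I)"
    using add_right_mono[OF Suc] by (simp only: add.assoc)
  also have "?L + ?I = (\<integral>\<^sup>+x. ennreal (\<epsilon> * D) * ennreal (?m x powr (1 + \<epsilon>)) + ennreal (?i x) \<partial>lborel)"
    by (simp add: nn_integral_add nn_integral_cmult)
  also have "\<dots> = (\<integral>\<^sup>+x. ennreal (\<epsilon> * D) * ennreal (?M x powr (1 + \<epsilon>)) \<partial>lborel)"
  proof (intro nn_integral_cong)
    fix x
    have "ennreal (?i x) = ennreal (\<epsilon> * D) * ennreal (?M x powr (1 + \<epsilon>) - ?m x powr (1 + \<epsilon>))"
      using D by (rule ennreal_mult')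
    thus "ennreal (\<epsilon> * D) * ennreal (?m x powr (1 + \<epsilon>)) + ennreal (?i x) =
        ennreal (\<epsilon> * D) * ennreal (?M x powr (1 + \<epsilon>))"
      using pos[of "1 + \<epsilon>" x] eps by (simp flip: distrib_left ennreal_plus)
  qed
  also have "\<dots> = ennreal (\<epsilon> * D) * (\<integral>\<^sup>+x. ennreal (?M x powr (1 + \<epsilon>)) \<partial>lborel)"
    by (simp add: nn_integral_cmult)
  finally show ?case .
qed

text \<open>A quantitative Muckenhoupt condition. It follows from an \<open>A\<^sub>r\<close>
  condition for any \<open>r\<close>, and, unlike the latter, it involves a concave power of
  \<open>u\<close> only; so Jensen's inequality shows that it is inherited by averages of
  \<open>u\<close> over coarser cells and over further variables.\<close>
definition sqrt_condition :: "real \<Rightarrow> ('a \<Rightarrow> ennreal) \<Rightarrow> bool" where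
  "sqrt_condition K u \<longleftrightarrow> (\<forall>k x. E k u x < top \<and> E k u x \<le> ennreal K * (E k (\<lambda>y. ennreal_powr (u y) (1/2)) x)\<^sup>2)"

text \<open>Let \<open>w\<close> be \<open>E N u\<close> restricted to one cell of generation
  \<open>a\<close>, let \<open>X\<close> be the integral of \<open>w powr (1 + \<epsilon>)\<close>
  and let \<open>m\<close> be the running maximum of the averages of \<open>w\<close>. By
  \<open>maximal_layer\<close>, the integral of \<open>m powr \<epsilon>\<close> times
  \<open>w\<close>, which is at least \<open>X\<close>, exceeds the integral of \<open>(E a u) powr
  (1 + \<epsilon>)\<close> over the cell by at most \<open>\<epsilon> D\<close> times the integral
  of \<open>m powr (1 + \<epsilon>)\<close>. The square-root condition gives \<open>m \<le> K
  M\<^sup>2\<close> with \<open>M\<close> the running maximum of the averages of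
  \<open>\<surd>w\<close>, and Doob's inequality with exponent \<open>2 + 2\<epsilon>\<close>, away
  from the critical exponent \<open>1\<close>, bounds that integral by \<open>48 K X\<close>. So
  \<open>\<epsilon> \<le> 1/(96 D K)\<close> allows half of \<open>X\<close> to be absorbed. The
  exponent gain has order \<open>1/K\<close>, but the constant \<open>2\<close> does not depend on
  \<open>K\<close>. The function is averaged to generation \<open>N\<close> first, which makes
  \<open>w\<close> one of its own conditional averages and \<open>X\<close> finite.\<close>
theorem reverse_Holder:
  assumes [measurable]: "u \<in> borel_measurable borel" and K: "1 \<le> K"
    and cond: "sqrt_condition K u" and eps: "0 < \<epsilon>" "\<epsilon> * (96 * D * K) \<le> 1"
    and aN: "a \<le> N"
  shows "E a (\<lambda>y. ennreal_powr (E N u y) (1 + \<epsilon>)) z \<le> 2 * ennreal_powr (E a u z) (1 + \<epsilon>)"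
proof -
  have fin_u: "E k u x < top" and cond_u: "E k u x \<le> ennreal K * (E k (\<lambda>y. ennreal_powr (u y) (1/2)) x)\<^sup>2" for k x
    using cond by (auto simp: sqrt_condition_def)
  define n where "n = nat (N - a)"
  have N: "N = a + int n" using aN by (simp add: n_def)
  define Q where "Q = cell a z"
  have [measurable]: "Q \<in> sets borel" by (simp add: Q_def)
  have eps1: "\<epsilon> * K \<le> 1" "\<epsilon> \<le> 1"
  proof -
    have "\<epsilon> * (96 * 1 * K) \<le> \<epsilon> * (96 * D * K)" using eps D_ge_1 K by (intro mult_left_mono mult_right_mono) auto
    hence "96 * (\<epsilon> * K) \<le> 1" using eps(2) by (simp add: ac_simps)
    moreover have "0 \<le> \<epsilon> * K" using eps K by simp
    ultimately show 1: "\<epsilon> * K \<le> 1" by linarith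
    have "\<epsilon> * 1 \<le> \<epsilon> * K" using eps K by (intro mult_left_mono) auto
    thus "\<epsilon> \<le> 1" using 1 by linarith
  qed
  define w where "w x = E N u x * indicator Q x" for x
  define g where "g x = ennreal_powr (w x) (1/2)" for x
  have [measurable]: "w \<in> borel_measurable borel" unfolding w_def by measurable
  have [measurable]: "g \<in> borel_measurable borel" unfolding g_def by measurable
  have cells: "cell (a + int k) x \<subseteq> Q \<or> cell (a + int k) x \<inter> Q = {}" for k x
    using cell_eq_mono[of a "a + int k" _ x] cell_iff[of _ a z] unfolding Q_def by fastforce
  have Ew: "E (a + int k) w x = (if x \<in> Q then E (a + int k) u x else 0)" if "k \<le> n" for k x
  proof (cases "x \<in> Q")
    case True
    hence "cell (a + int k) x \<subseteq> Q" using cells[of k x] cell_self by blast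
    hence "E (a + int k) w x = E (a + int k) (E N u) x"
      unfolding E_def[of "a + int k"] by (intro cl.average_cong) (auto simp: w_def)
    thus ?thesis using True E_tower[of u "a + int k" N] that N by simp
  next
    case False
    hence "cell (a + int k) x \<inter> Q = {}" using cells[of k x] cell_self by blast
    hence "E (a + int k) w x = E (a + int k) (\<lambda>_. 0) x"
      unfolding E_def[of "a + int k"] by (intro cl.average_cong) (auto simp: w_def indicator_def)
    thus ?thesis using False by (simp add: E_def)
  qed
  have w_le: "w x \<le> E N u x" for x by (simp add: w_def indicator_def)
  have fin_w: "E k w x < top" for k x
  proof (cases "k \<le> N")
    case True
    have "E k w x \<le> E k (E N u) x" by (intro E_mono w_le)
    thus ?thesis using E_tower[of u k N] fin_u[of k x] True by simp
  next
    case False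
    hence "cell k x \<subseteq> cell N x" by (intro cell_mono) simp
    hence "E k w x \<le> E k (\<lambda>_. E N u x) x"
      using w_le E_const[of N N _ x u] by (intro E_mono) (metis order_refl subsetD)
    thus ?thesis using fin_u[of N x] by (simp add: E_def)
  qed
  have fin_g: "E k g x < top" for k x
  proof -
    have "E k g x \<le> ennreal_powr (E k w x) (1/2)"
      unfolding E_def g_def by (rule cl.average_Jensen_concave) auto
    also have "\<dots> < top" using fin_w by simp
    finally show ?thesis .
  qed
  let ?e = "martingale a w" and ?m = "maximal a w n"
  have w_eq: "w x = ennreal (?e x n)" for x
    using Ew[of n x] N by (simp add: ennreal_martingale[OF fin_w] w_def)
  have e_g: "?e x k \<le> K * (martingale a g x k)\<^sup>2" if "k \<le> n" for x k
  proof -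
    have "E (a + int k) w x \<le> ennreal K * (E (a + int k) g x)\<^sup>2"
    proof (cases "x \<in> Q")
      case True
      hence sub: "cell (a + int k) x \<subseteq> Q" using cells[of k x] cell_self by blast
      have "E (a + int k) (\<lambda>y. ennreal_powr (u y) (1/2)) x = E (a + int k) (E N (\<lambda>y. ennreal_powr (u y) (1/2))) x"
        using E_tower[of "\<lambda>y. ennreal_powr (u y) (1/2)" "a + int k" N] that N by simp
      also have "\<dots> \<le> E (a + int k) g x"
      proof (rule E_mono)
        fix y assume "y \<in> cell (a + int k) x"
        hence "g y = ennreal_powr (E N u y) (1/2)" using sub by (auto simp: g_def w_def)
        thus "E N (\<lambda>y. ennreal_powr (u y) (1/2)) y \<le> g y"
          unfolding E_def using cl.average_Jensen_concave[of u "1/2" N y] by simp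
      qed
      finally have "ennreal K * (E (a + int k) (\<lambda>y. ennreal_powr (u y) (1/2)) x)\<^sup>2 \<le> ennreal K * (E (a + int k) g x)\<^sup>2"
        by (intro mult_left_mono power_mono) auto
      thus ?thesis using cond_u[of "a + int k" x] Ew[OF that, of x] True by simp
    next
      case False thus ?thesis using Ew[OF that, of x] by simp
    qed
    hence "ennreal (?e x k) \<le> ennreal (K * (martingale a g x k)\<^sup>2)"
      using K by (simp add: ennreal_mult flip: ennreal_martingale[OF fin_w] ennreal_martingale[OF fin_g] ennreal_power)
    thus ?thesis using K by (simp add: ennreal_le_iff)
  qed
  have m_g: "?m x \<le> K * (maximal a g n x)\<^sup>2" for x
    unfolding maximal_def using e_g K by (intro running_max_le_square) auto
  \<comment> \<open>\<open>K powr \<epsilon>\<close> is bounded by an absolute constant, because \<open>\<epsilon> ln K \<le> \<epsilon> K \<le> 1\<close>.\<close>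
  have Keps: "K powr (1 + \<epsilon>) \<le> 3 * K"
  proof -
    have "K powr \<epsilon> = exp (\<epsilon> * ln K)" using K by (simp add: powr_def)
    also have "\<epsilon> * ln K \<le> \<epsilon> * K" using eps K ln_le_minus_one[of K] by (intro mult_left_mono) auto
    hence "exp (\<epsilon> * ln K) \<le> exp 1" using eps1 by simp
    also have "exp 1 \<le> (3::real)" by (rule exp_le)
    finally show ?thesis using K by (simp add: powr_add mult.commute)
  qed
  let ?X = "\<integral>\<^sup>+x. ennreal (?e x n powr (1 + \<epsilon>)) \<partial>lborel"
  have m_X: "(\<integral>\<^sup>+x. ennreal (?m x powr (1 + \<epsilon>)) \<partial>lborel) \<le> ennreal (48 * K) * ?X"
  proof -
    have "(\<integral>\<^sup>+x. ennreal (?m x powr (1 + \<epsilon>)) \<partial>lborel) \<le>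
       (\<integral>\<^sup>+x. ennreal (3 * K) * ennreal (maximal a g n x powr (2 + 2 * \<epsilon>)) \<partial>lborel)"
    proof (intro nn_integral_mono)
      fix x
      have "?m x powr (1 + \<epsilon>) \<le> (K * (maximal a g n x)\<^sup>2) powr (1 + \<epsilon>)"
        using eps m_g by (intro powr_mono2) auto
      also have "\<dots> = K powr (1 + \<epsilon>) * maximal a g n x powr (2 + 2 * \<epsilon>)"
        by (simp add: powr_mult powr_powr flip: powr_numeral)
      also have "\<dots> \<le> 3 * K * maximal a g n x powr (2 + 2 * \<epsilon>)"
        by (intro mult_right_mono Keps) auto
      finally show "ennreal (?m x powr (1 + \<epsilon>)) \<le> ennreal (3 * K) * ennreal (maximal a g n x powr (2 + 2 * \<epsilon>))"
        using K by (simp add: ennreal_leI flip: ennreal_mult)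
    qed
    also have "\<dots> = ennreal (3 * K) * (\<integral>\<^sup>+x. ennreal (maximal a g n x powr (2 + 2 * \<epsilon>)) \<partial>lborel)"
      by (simp add: nn_integral_cmult)
    also have "\<dots> \<le> ennreal (3 * K) * (ennreal (2 powr (2 + 2 * \<epsilon>) / (2 + 2 * \<epsilon> - 1)) * (\<integral>\<^sup>+x. ennreal_powr (g x) (2 + 2 * \<epsilon>) \<partial>lborel))"
      using eps by (intro mult_left_mono Doob_finite) auto
    also have "(\<integral>\<^sup>+x. ennreal_powr (g x) (2 + 2 * \<epsilon>) \<partial>lborel) = ?X"
      by (intro nn_integral_cong) (simp add: g_def w_eq powr_powr add_divide_distrib)
    also have "ennreal (3 * K) * (ennreal (2 powr (2 + 2 * \<epsilon>) / (2 + 2 * \<epsilon> - 1)) * ?X) \<le> ennreal (3 * K) * (ennreal 16 * ?X)"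
    proof (intro mult_left_mono mult_right_mono ennreal_leI)
      have "2 powr (2 + 2 * \<epsilon>) \<le> (2::real) powr 4" using eps1 by (intro powr_mono) auto
      hence "2 powr (2 + 2 * \<epsilon>) \<le> (16::real)" by simp
      moreover have "2 powr (2 + 2 * \<epsilon>) / (2 + 2 * \<epsilon> - 1) \<le> (2::real) powr (2 + 2 * \<epsilon>) / 1"
        using eps by (intro divide_left_mono) auto
      ultimately show "2 powr (2 + 2 * \<epsilon>) / (2 + 2 * \<epsilon> - 1) \<le> (16::real)" by simp
    qed auto
    also have "ennreal (3 * K) * (ennreal 16 * ?X) = ennreal (48 * K) * ?X"
      using K by (simp only: mult.assoc[symmetric] ennreal_mult'[symmetric]) (simp flip: ennreal_mult)?
    finally show ?thesis .
  qed
  let ?Y = "\<integral>\<^sup>+x. ennreal (?e x 0 powr \<epsilon>) * w x \<partial>lborel"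
  have split: "r powr (1 + \<epsilon>) = r powr \<epsilon> * r" if "0 \<le> r" for r :: real
    using powr_mult_base[OF that, of \<epsilon>] by (simp add: mult.commute)
  have X_le: "?X \<le> ennreal (1/2) * ?X + ?Y"
  proof -
    have "?X = (\<integral>\<^sup>+x. ennreal (?e x n powr \<epsilon>) * w x \<partial>lborel)"
      by (intro nn_integral_cong) (simp add: w_eq split ennreal_mult)
    also have "\<dots> \<le> (\<integral>\<^sup>+x. ennreal (?m x powr \<epsilon>) * w x \<partial>lborel)"
      using eps by (intro nn_integral_mono mult_right_mono ennreal_leI powr_mono2 maximal_ge) auto
    also have "\<dots> \<le> ?Y + ennreal (\<epsilon> * D) * (\<integral>\<^sup>+x. ennreal (?m x powr (1 + \<epsilon>)) \<partial>lborel)"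
      using eps eps1 by (intro maximal_layer fin_w) auto
    also have "\<dots> \<le> ?Y + ennreal (\<epsilon> * D) * (ennreal (48 * K) * ?X)"
      by (intro add_left_mono mult_left_mono m_X) auto
    also have "ennreal (\<epsilon> * D) * (ennreal (48 * K) * ?X) = ennreal (\<epsilon> * D * (48 * K)) * ?X"
      using eps D_ge_1 K by (simp add: ennreal_mult mult.assoc)
    also have "?Y + ennreal (\<epsilon> * D * (48 * K)) * ?X \<le> ?Y + ennreal (1/2) * ?X"
      using eps by (intro add_left_mono mult_right_mono ennreal_leI) auto
    finally show ?thesis by (simp only: add.commute)
  qed
  have Y_eq: "?Y = ennreal_powr (E a u z) (1 + \<epsilon>) * emeasure lborel Q"
  proof -
    have "?Y = (\<integral>\<^sup>+x. ennreal (?e x 0 powr \<epsilon>) * E a w x \<partial>lborel)"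
    proof (rule nn_integral_cellwise_const_mult)
      fix x y assume "y \<in> cell a x"
      thus "ennreal (?e y 0 powr \<epsilon>) = ennreal (?e x 0 powr \<epsilon>)"
        using martingale_const[of 0 0 y a x w] by simp
    qed simp
    also have "\<dots> = (\<integral>\<^sup>+x. ennreal_powr (E a u z) (1 + \<epsilon>) * indicator Q x \<partial>lborel)"
    proof (intro nn_integral_cong)
      fix x
      have "ennreal (?e x 0 powr \<epsilon>) * E a w x = ennreal_powr (E a w x) (1 + \<epsilon>)"
        using ennreal_martingale[of a 0 w x, OF fin_w, symmetric] by (simp add: split ennreal_mult)
      thus "ennreal (?e x 0 powr \<epsilon>) * E a w x = ennreal_powr (E a u z) (1 + \<epsilon>) * indicator Q x"
        using Ew[of 0 x] E_const[of a a x z u] by (auto simp: Q_def)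
    qed
    finally show ?thesis by (simp add: nn_integral_cmult_indicator)
  qed
  \<comment> \<open>By doubling, \<open>w\<close> is at most \<open>D ^ n\<close> times its average over the cell of generation \<open>a\<close>.\<close>
  have X_fin: "?X < top"
  proof -
    have De: "?e x k \<le> D ^ k * ?e x 0" for k x
    proof (induction k)
      case (Suc k)
      have "?e x (Suc k) \<le> D * ?e x k" by (rule martingale_doubling) (rule fin_w)
      also have "\<dots> \<le> D * (D ^ k * ?e x 0)" using Suc D_ge_1 by (intro mult_left_mono) auto
      finally show ?case by simp
    qed simp
    have "?X \<le> (\<integral>\<^sup>+x. ennreal ((D ^ n) powr \<epsilon>) * (ennreal (?e x 0 powr \<epsilon>) * w x) \<partial>lborel)"
    proof (intro nn_integral_mono)
      fix x
      have "?e x n powr \<epsilon> \<le> (D ^ n) powr \<epsilon> * ?e x 0 powr \<epsilon>"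
        using powr_mono2[OF _ _ De[of x n], of \<epsilon>] eps by (simp add: powr_mult)
      hence "?e x n powr (1 + \<epsilon>) \<le> (D ^ n) powr \<epsilon> * (?e x 0 powr \<epsilon> * ?e x n)"
        by (simp add: split mult_right_mono flip: mult.assoc)
      thus "ennreal (?e x n powr (1 + \<epsilon>)) \<le> ennreal ((D ^ n) powr \<epsilon>) * (ennreal (?e x 0 powr \<epsilon>) * w x)"
        by (subst w_eq) (simp only: ennreal_mult'[symmetric] powr_ge_zero ennreal_leI)
    qed
    also have "\<dots> = ennreal ((D ^ n) powr \<epsilon>) * ?Y" by (simp add: nn_integral_cmult)
    also have "\<dots> < top"
      unfolding Y_eq Q_def using fin_u[of a z] cl.fin[of a z] by (auto simp: ennreal_mult_less_top)
    finally show ?thesis .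
  qed
  have "?X \<le> 2 * (ennreal_powr (E a u z) (1 + \<epsilon>) * emeasure lborel Q)"
    using ennreal_absorb_half[OF X_le X_fin] Y_eq by simp
  moreover have "?X = E a (\<lambda>y. ennreal_powr (E N u y) (1 + \<epsilon>)) z * emeasure lborel Q"
    unfolding E_def[of a] Q_def cl.average_times
  proof (intro nn_integral_cong)
    fix x
    have "ennreal (?e x n powr (1 + \<epsilon>)) = ennreal_powr (w x) (1 + \<epsilon>)" by (simp add: w_eq)
    thus "ennreal (?e x n powr (1 + \<epsilon>)) = ennreal_powr (E N u x) (1 + \<epsilon>) * indicator (cell a z) x"
      by (auto simp: w_def Q_def indicator_def)
  qed
  ultimately have "E a (\<lambda>y. ennreal_powr (E N u y) (1 + \<epsilon>)) z * emeasure lborel Q / emeasure lborel Q \<le>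
     2 * ennreal_powr (E a u z) (1 + \<epsilon>) * emeasure lborel Q / emeasure lborel Q"
    by (intro divide_right_mono_ennreal) (simp add: mult.assoc)
  thus ?thesis using cl.mu_ne[of a z] by (simp add: ennreal_mult_divide_eq Q_def)
qed

end

section \<open>Averages over products\<close>

lemma measurable_fst_section:
  assumes "f \<in> borel_measurable (borel :: ('a::euclidean_space \<times> 'b::euclidean_space) measure)"
  shows "(\<lambda>x. f (x, y)) \<in> borel_measurable borel"
proof -
  have "(\<lambda>x. (x, y)) \<in> borel \<rightarrow>\<^sub>M borel"
    by (intro borel_measurable_continuous_onI continuous_intros)
  from measurable_compose[OF this assms] show ?thesis .
qed

lemma measurable_snd_section:
  assumes "f \<in> borel_measurable (borel :: ('a::euclidean_space \<times> 'b::euclidean_space) measure)"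
  shows "(\<lambda>y. f (x, y)) \<in> borel_measurable borel"
proof -
  have "(\<lambda>y. (x, y)) \<in> borel \<rightarrow>\<^sub>M borel"
    by (intro borel_measurable_continuous_onI continuous_intros)
  from measurable_compose[OF this assms] show ?thesis .
qed

lemma nn_integral_lborel_fst:
  fixes f :: "'a::euclidean_space \<times> 'b::euclidean_space \<Rightarrow> ennreal"
  assumes "f \<in> borel_measurable borel"
  shows "(\<integral>\<^sup>+x. (\<integral>\<^sup>+y. f (x, y) \<partial>lborel) \<partial>lborel) = (\<integral>\<^sup>+z. f z \<partial>lborel)"
proof -
  have "f \<in> borel_measurable (lborel \<Otimes>\<^sub>M lborel)" unfolding lborel_prod using assms by simp
  from lborel.nn_integral_fst[OF this] show ?thesis unfolding lborel_prod .
qed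

lemma nn_integral_lborel_snd:
  fixes f :: "'a::euclidean_space \<times> 'b::euclidean_space \<Rightarrow> ennreal"
  assumes "f \<in> borel_measurable borel"
  shows "(\<integral>\<^sup>+y. (\<integral>\<^sup>+x. f (x, y) \<partial>lborel) \<partial>lborel) = (\<integral>\<^sup>+z. f z \<partial>lborel)"
proof -
  have "f \<in> borel_measurable (lborel \<Otimes>\<^sub>M lborel)" unfolding lborel_prod using assms by simp
  from lborel_pair.nn_integral_snd[OF this] show ?thesis unfolding lborel_prod .
qed

lemma emeasure_lborel_Times:
  fixes C1 :: "'a::euclidean_space set" and C2 :: "'b::euclidean_space set"
  assumes "C1 \<in> sets borel" "C2 \<in> sets borel"
  shows "emeasure lborel (C1 \<times> C2) = emeasure lborel C1 * emeasure lborel C2"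
proof -
  have "C1 \<in> sets lborel" "C2 \<in> sets lborel" using assms by simp_all
  from lborel.emeasure_pair_measure_Times[OF this] show ?thesis unfolding lborel_prod .
qed

lemma sets_Times_borel:
  fixes C1 :: "'a::euclidean_space set" and C2 :: "'b::euclidean_space set"
  assumes "C1 \<in> sets borel" "C2 \<in> sets borel"
  shows "C1 \<times> C2 \<in> sets borel"
  unfolding borel_prod[symmetric] by (rule pair_measureI[OF assms])

lemma finite_cell_Times:
  assumes "finite_cell (C1 :: 'a::euclidean_space set)" "finite_cell (C2 :: 'b::euclidean_space set)"
  shows "finite_cell (C1 \<times> C2)"
proof -
  interpret C1: finite_cell C1 by fact
  interpret C2: finite_cell C2 by fact
  have "emeasure lborel (C1 \<times> C2) = C1.mu * C2.mu"
    by (rule emeasure_lborel_Times) auto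
  thus ?thesis
    using C1.pos C2.pos C1.fin C2.fin sets_Times_borel[OF C1.sets_E C2.sets_E]
    by (simp add: finite_cell_def ennreal_mult_less_top ennreal_zero_less_mult_iff)
qed

lemma measurable_average_section:
  fixes f :: "'a::euclidean_space \<times> 'b::euclidean_space \<Rightarrow> ennreal"
  assumes f: "f \<in> borel_measurable borel" and "finite_cell C"
  shows "(\<lambda>x. nn_average C (\<lambda>y. f (x, y))) \<in> borel_measurable borel"
proof -
  interpret finite_cell C by fact
  have [measurable]: "f \<in> borel_measurable (borel \<Otimes>\<^sub>M borel)" using f by (simp add: borel_prod)
  show ?thesis unfolding nn_average_lborel by measurable
qed

lemma average_Times:
  fixes f :: "'a::euclidean_space \<times> 'b::euclidean_space \<Rightarrow> ennreal"
  assumes f[measurable]: "f \<in> borel_measurable borel" and "finite_cell C1" "finite_cell C2"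
  shows "nn_average (C1 \<times> C2) f = nn_average C1 (\<lambda>x. nn_average C2 (\<lambda>y. f (x, y)))"
    and "nn_average (C1 \<times> C2) f = nn_average C2 (\<lambda>y. nn_average C1 (\<lambda>x. f (x, y)))"
proof -
  interpret C1: finite_cell C1 by fact
  interpret C2: finite_cell C2 by fact
  interpret C: finite_cell "C1 \<times> C2" by (rule finite_cell_Times) fact+
  have [measurable]: "f \<in> borel_measurable (borel \<Otimes>\<^sub>M borel)" using f by (simp add: borel_prod)
  have [measurable]: "C1 \<times> C2 \<in> sets borel" by simp
  let ?h = "\<lambda>z. f z * indicator (C1 \<times> C2) z"
  have mh: "?h \<in> borel_measurable borel" by measurable
  have m: "emeasure lborel (C1 \<times> C2) = C1.mu * C2.mu" by (rule emeasure_lborel_Times) auto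
  have 1: "(\<integral>\<^sup>+y. f (x, y) * indicator (C1 \<times> C2) (x, y) \<partial>lborel) = nn_average C2 (\<lambda>y. f (x, y)) * C2.mu * indicator C1 x" for x
    unfolding C2.average_times by (subst nn_integral_multc[symmetric]) (auto simp: indicator_def intro!: nn_integral_cong)
  have 2: "(\<integral>\<^sup>+x. f (x, y) * indicator (C1 \<times> C2) (x, y) \<partial>lborel) = nn_average C1 (\<lambda>x. f (x, y)) * C1.mu * indicator C2 y" for y
    unfolding C1.average_times by (subst nn_integral_multc[symmetric]) (auto simp: indicator_def intro!: nn_integral_cong)
  have [measurable]: "(\<lambda>x. nn_average C2 (\<lambda>y. f (x, y))) \<in> borel_measurable borel"
    by (rule measurable_average_section) fact+
  have "(\<integral>\<^sup>+z. ?h z \<partial>lborel) = (\<integral>\<^sup>+x. C2.mu * (nn_average C2 (\<lambda>y. f (x, y)) * indicator C1 x) \<partial>lborel)"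
    unfolding nn_integral_lborel_fst[OF mh, symmetric] 1 by (simp add: mult_ac)
  also have "\<dots> = (nn_average C1 (\<lambda>x. nn_average C2 (\<lambda>y. f (x, y))) * C1.mu) * C2.mu"
    unfolding C1.average_times
    by (subst nn_integral_cmult) (auto simp: mult.commute)
  finally show "nn_average (C1 \<times> C2) f = nn_average C1 (\<lambda>x. nn_average C2 (\<lambda>y. f (x, y)))"
    unfolding C.nn_average_lborel m using C1.mu_ne C2.mu_ne
    by (simp add: mult.assoc ennreal_mult_divide_eq ennreal_mult_eq_top_iff)
  have [measurable]: "(\<lambda>y. nn_average C1 (\<lambda>x. f (x, y))) \<in> borel_measurable borel"
    unfolding C1.nn_average_lborel by measurable
  have "(\<integral>\<^sup>+z. ?h z \<partial>lborel) = (\<integral>\<^sup>+y. C1.mu * (nn_average C1 (\<lambda>x. f (x, y)) * indicator C2 y) \<partial>lborel)"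
    unfolding nn_integral_lborel_snd[OF mh, symmetric] 2 by (simp add: mult_ac)
  also have "\<dots> = (nn_average C2 (\<lambda>y. nn_average C1 (\<lambda>x. f (x, y))) * C2.mu) * C1.mu"
    unfolding C2.average_times
    by (subst nn_integral_cmult) (auto simp: mult.commute)
  finally show "nn_average (C1 \<times> C2) f = nn_average C2 (\<lambda>y. nn_average C1 (\<lambda>x. f (x, y)))"
    unfolding C.nn_average_lborel m using C1.mu_ne C2.mu_ne
    by (simp only: mult.assoc mult.commute[of C2.mu]) (simp add: ennreal_mult_divide_eq ennreal_mult_eq_top_iff)
qed

text \<open>The convex function \<open>t powr q\<close> lies above its tangent at \<open>g\<close>,
  again by Young's inequality.\<close>
lemma powr_perturb:
  fixes g F T n q :: real
  assumes "0 \<le> g" "g \<le> n" "0 \<le> F" "0 \<le> T" "g \<le> F + T" "1 < q"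
  shows "g powr q \<le> F powr q + q * n powr (q - 1) * T"
proof (cases "g \<le> F")
  case True
  hence "g powr q \<le> F powr q" using assms by (intro powr_mono2) auto
  thus ?thesis using assms by (smt (verit) mult_nonneg_nonneg powr_ge_zero)
next
  case False
  define r where "r = q / (q - 1)"
  have r: "1 < r" "1 / r + 1 / q = 1" "(q - 1) * r = q" "q / r = q - 1"
    using assms by (auto simp: r_def field_simps)
  have "g powr (q - 1) * F \<le> g powr q / r + F powr q / q"
    using Youngs_inequality[of r q "g powr (q - 1)" F] assms r by (simp add: powr_powr)
  hence "q * (g powr (q - 1) * F) \<le> q * (g powr q / r + F powr q / q)"
    using assms by (intro mult_left_mono) auto
  also have "\<dots> = (q / r) * g powr q + F powr q" using assms by (simp add: field_simps)
  also have "\<dots> = q * g powr q - g powr q + F powr q" using r by (simp add: left_diff_distrib)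
  also have "g powr q = g powr (q - 1) * g"
    using powr_mult_base[of g "q - 1"] assms by (simp add: mult.commute)
  finally have "g powr (q - 1) * g \<le> F powr q + q * (g powr (q - 1) * (g - F))"
    by (simp add: algebra_simps)
  also have "q * (g powr (q - 1) * (g - F)) \<le> q * (n powr (q - 1) * T)"
    using assms False by (intro mult_left_mono mult_mono powr_mono2) auto
  finally show ?thesis
    using powr_mult_base[of g "q - 1"] assms by (simp add: ac_simps)
qed

section \<open>Mean oscillation and differentiation of bounded functions\<close>

context cell_grid
begin

text \<open>There are countably many cells of a given generation, so the average over the cell
  containing \<open>X m\<close> is a countable supremum of averages over fixed cells.\<close>
lemma measurable_E_section:
  assumes [measurable]: "f \<in> borel_measurable (M \<Otimes>\<^sub>M borel)" "X \<in> M \<rightarrow>\<^sub>M borel"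
  shows "(\<lambda>m. E k (\<lambda>y. f (m, y)) (X m)) \<in> borel_measurable M"
proof -
  have "E k (\<lambda>y. f (m, y)) (X m) = (SUP C\<in>range (cell k). nn_average C (\<lambda>y. f (m, y)) * indicator C (X m))" for m
  proof (rule antisym)
    show "E k (\<lambda>y. f (m, y)) (X m) \<le> (SUP C\<in>range (cell k). nn_average C (\<lambda>y. f (m, y)) * indicator C (X m))"
      by (rule SUP_upper2[of "cell k (X m)"]) (auto simp: E_def cell_self)
    show "(SUP C\<in>range (cell k). nn_average C (\<lambda>y. f (m, y)) * indicator C (X m)) \<le> E k (\<lambda>y. f (m, y)) (X m)"
      using cell_eq by (auto intro!: SUP_least simp: E_def indicator_def)
  qed
  moreover have "(\<lambda>m. SUP C\<in>range (cell k). nn_average C (\<lambda>y. f (m, y)) * indicator C (X m)) \<in> borel_measurable M"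
  proof (rule borel_measurable_SUP)
    fix C assume "C \<in> range (cell k)"
    then obtain z where z: "C = cell k z" by auto
    show "(\<lambda>m. nn_average C (\<lambda>y. f (m, y)) * indicator C (X m)) \<in> borel_measurable M"
      unfolding z cl.nn_average_lborel by measurable
  qed (rule countable_cells)
  ultimately show ?thesis by simp
qed

text \<open>The mean deviation from the value at the point, not from the mean value.\<close>
definition osc :: "int \<Rightarrow> ('a \<Rightarrow> real) \<Rightarrow> 'a \<Rightarrow> ennreal" where
  "osc N g x = E N (\<lambda>y. ennreal \<bar>g y - g x\<bar>) x"

lemma measurable_osc [measurable]:
  assumes [measurable]: "g \<in> borel_measurable borel"
  shows "osc N g \<in> borel_measurable borel"
proof -
  have "(\<lambda>(x, y). ennreal \<bar>g y - g x\<bar>) \<in> borel_measurable (borel \<Otimes>\<^sub>M borel)" by measurable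
  from measurable_E_section[OF this, of "\<lambda>x. x" N] show ?thesis by (simp add: osc_def[abs_def])
qed

lemma osc_triangle:
  assumes [measurable]: "g \<in> borel_measurable borel" "h \<in> borel_measurable borel"
  shows "osc N g x \<le> ennreal \<bar>g x - h x\<bar> + (osc N h x + E N (\<lambda>y. ennreal \<bar>g y - h y\<bar>) x)"
proof -
  have "osc N g x \<le> E N (\<lambda>y. ennreal \<bar>g x - h x\<bar> + (ennreal \<bar>h y - h x\<bar> + ennreal \<bar>g y - h y\<bar>)) x"
    unfolding osc_def by (intro E_mono) (auto intro!: ennreal_leI simp flip: ennreal_plus)
  also have "\<dots> = ennreal \<bar>g x - h x\<bar> + (osc N h x + E N (\<lambda>y. ennreal \<bar>g y - h y\<bar>) x)"
    unfolding E_def osc_def by (simp add: cl.average_add)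
  finally show ?thesis .
qed

lemma osc_continuous:
  assumes shrink: "\<And>x e. 0 < e \<Longrightarrow> \<exists>N0. \<forall>N\<ge>N0. cell N x \<subseteq> ball x e"
    and cont: "continuous_on UNIV h"
  shows "(\<lambda>n. osc (a + int n) h x) \<longlonglongrightarrow> 0"
proof (rule tendsto_0_if_Limsup_eq_0_ennreal, rule antisym)
  show "limsup (\<lambda>n. osc (a + int n) h x) \<le> 0"
  proof (rule ennreal_le_epsilon)
    fix e :: real assume "0 < e"
    have "isCont h x" using cont by (simp add: continuous_on_eq_continuous_at)
    then obtain d where d: "0 < d" "\<And>y. dist y x < d \<Longrightarrow> \<bar>h y - h x\<bar> < e"
      using \<open>0 < e\<close> unfolding continuous_at_eps_delta dist_real_def by metis
    obtain N0 where N0: "\<And>N. N \<ge> N0 \<Longrightarrow> cell N x \<subseteq> ball x d" using shrink[OF d(1)] by metis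
    have "osc (a + int n) h x \<le> ennreal e" if "n \<ge> nat (N0 - a)" for n
    proof -
      have "osc (a + int n) h x \<le> E (a + int n) (\<lambda>_. ennreal e) x"
        unfolding osc_def
      proof (rule E_mono)
        fix y assume "y \<in> cell (a + int n) x"
        moreover have "N0 \<le> a + int n" using that by linarith
        ultimately have "dist y x < d" using N0[of "a + int n"] by (auto simp: dist_commute)
        thus "ennreal \<bar>h y - h x\<bar> \<le> ennreal e" using d by (intro ennreal_leI) force
      qed
      thus ?thesis by (simp add: E_def)
    qed
    hence "eventually (\<lambda>n. osc (a + int n) h x \<le> ennreal e) sequentially"
      unfolding eventually_sequentially by blast
    thus "limsup (\<lambda>n. osc (a + int n) h x) \<le> 0 + ennreal e" by (simp add: Limsup_bounded)
  qed
qed simp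

text \<open>A differentiation theorem: averages of a bounded function over shrinking cells converge
  to it in \<open>L\<^sup>1\<close> on sets of finite measure. For continuous functions this is
  dominated convergence; a bounded measurable function is an almost everywhere limit of continuous
  functions, which may be truncated at the same bound.\<close>
lemma osc_tendsto_0:
  assumes shrink: "\<And>x e. 0 < e \<Longrightarrow> \<exists>N0. \<forall>N\<ge>N0. cell N x \<subseteq> ball x e"
    and [measurable]: "g \<in> borel_measurable borel" "Q \<in> sets borel"
    and bound: "\<And>x. \<bar>g x\<bar> \<le> B"
    and Q: "\<And>x. x \<in> Q \<Longrightarrow> cell a x \<subseteq> Q" and Qfin: "emeasure lborel Q < top"
  shows "(\<lambda>n. \<integral>\<^sup>+x. osc (a + int n) g x * indicator Q x \<partial>lborel) \<longlonglongrightarrow> 0"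
proof (rule tendsto_0_if_Limsup_eq_0_ennreal, rule antisym)
  let ?J = "\<lambda>h n. \<integral>\<^sup>+x. osc (a + int n) h x * indicator Q x \<partial>lborel"
  have "g measurable_on UNIV" by (intro lebesgue_measurable_imp_measurable_on) (auto simp: measurable_completion)
  then obtain Z \<phi> where Z: "negligible Z" and \<phi>: "\<And>m. continuous_on UNIV (\<phi> m)"
    "\<And>x. x \<notin> Z \<Longrightarrow> (\<lambda>m. \<phi> m x) \<longlonglongrightarrow> g x"
    unfolding measurable_on_def by auto
  have B: "0 \<le> B" using bound[of undefined] by linarith
  define \<psi> where "\<psi> m x = max (- B) (min B (\<phi> m x :: real))" for m :: nat and x
  have \<psi>: "continuous_on UNIV (\<psi> m)" "\<bar>\<psi> m x\<bar> \<le> B" for m x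
    unfolding \<psi>_def using B by (auto intro!: continuous_intros \<phi>)
  have [measurable]: "\<psi> m \<in> borel_measurable borel" for m
    using \<psi>(1) by (rule borel_measurable_continuous_onI)
  have lim: "(\<lambda>m. \<psi> m x) \<longlonglongrightarrow> g x" if "x \<notin> Z" for x
  proof -
    have "(\<lambda>m. \<psi> m x) \<longlonglongrightarrow> max (- B) (min B (g x))"
      unfolding \<psi>_def by (intro tendsto_intros \<phi>(2) that)
    thus ?thesis using bound[of x] by (simp add: max_def min_def abs_le_iff split: if_splits)
  qed
  have BQ: "(\<integral>\<^sup>+x. ennreal C * indicator Q x \<partial>lborel) < top" for C
    using Qfin by (simp add: nn_integral_cmult_indicator ennreal_mult_less_top)
  have AEZ: "AE x in lborel. x \<notin> Z"
    using Z AE_not_in[of Z lebesgue] by (simp add: negligible_iff_null_sets AE_completion_iff)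
  have appr: "(\<lambda>m. \<integral>\<^sup>+x. ennreal \<bar>g x - \<psi> m x\<bar> * indicator Q x \<partial>lborel) \<longlonglongrightarrow> (\<integral>\<^sup>+x. 0 \<partial>(lborel :: 'a measure))"
  proof (rule nn_integral_dominated_convergence[OF _ _ _ _ BQ[of "2 * B", folded infinity_ennreal_def]])
    show "AE x in lborel. ennreal \<bar>g x - \<psi> j x\<bar> * indicator Q x \<le> ennreal (2 * B) * indicator Q x" for j
    proof (rule AE_I2, rule mult_right_mono, rule ennreal_leI)
      fix x show "\<bar>g x - \<psi> j x\<bar> \<le> 2 * B" using bound[of x] \<psi>(2)[of j x] by linarith
    qed simp
    show "AE x in lborel. (\<lambda>m. ennreal \<bar>g x - \<psi> m x\<bar> * indicator Q x) \<longlonglongrightarrow> 0"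
      using AEZ
    proof eventually_elim
      case (elim x)
      have "(\<lambda>m. \<bar>g x - \<psi> m x\<bar>) \<longlonglongrightarrow> \<bar>g x - g x\<bar>" by (intro tendsto_intros lim elim)
      hence "(\<lambda>m. ennreal \<bar>g x - \<psi> m x\<bar>) \<longlonglongrightarrow> 0"
        using tendsto_ennrealI by fastforce
      thus ?case by (cases "x \<in> Q") (auto simp: indicator_def)
    qed
  qed auto
  have osc_psi: "(\<lambda>n. ?J (\<psi> m) n) \<longlonglongrightarrow> (\<integral>\<^sup>+x. 0 \<partial>(lborel :: 'a measure))" for m
  proof (rule nn_integral_dominated_convergence[OF _ _ _ _ BQ[of "2 * B", folded infinity_ennreal_def]])
    show "AE x in lborel. osc (a + int j) (\<psi> m) x * indicator Q x \<le> ennreal (2 * B) * indicator Q x" for j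
    proof (rule AE_I2, rule mult_right_mono)
      fix x
      have "osc (a + int j) (\<psi> m) x \<le> E (a + int j) (\<lambda>_. ennreal (2 * B)) x"
        unfolding osc_def
      proof (intro E_mono ennreal_leI)
        fix y show "\<bar>\<psi> m y - \<psi> m x\<bar> \<le> 2 * B" using \<psi>(2)[of m x] \<psi>(2)[of m y] by linarith
      qed
      thus "osc (a + int j) (\<psi> m) x \<le> ennreal (2 * B)" by (simp add: E_def)
    qed simp
    show "AE x in lborel. (\<lambda>n. osc (a + int n) (\<psi> m) x * indicator Q x) \<longlonglongrightarrow> 0"
    proof (rule AE_I2)
      fix x show "(\<lambda>n. osc (a + int n) (\<psi> m) x * indicator Q x) \<longlonglongrightarrow> 0"
        using osc_continuous[OF shrink \<psi>(1), of a m x] by (cases "x \<in> Q") (auto simp: indicator_def)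
    qed
  qed auto
  show "limsup (\<lambda>n. ?J g n) \<le> 0"
  proof (rule ennreal_le_epsilon)
    fix e :: real assume e: "0 < e"
    let ?d = "\<lambda>m. \<integral>\<^sup>+x. ennreal \<bar>g x - \<psi> m x\<bar> * indicator Q x \<partial>lborel"
    have "eventually (\<lambda>m. ?d m < ennreal (e / 3)) sequentially"
      using order_tendstoD(2)[OF appr, of "ennreal (e / 3)"] e by simp
    then obtain m where m: "?d m < ennreal (e / 3)" by (auto simp: eventually_sequentially)
    have "eventually (\<lambda>n. (?J (\<psi> m) n) < ennreal (e / 3)) sequentially"
      using order_tendstoD(2)[OF osc_psi[of m], of "ennreal (e / 3)"] e by simp
    hence "eventually (\<lambda>n. (?J g n) \<le> ennreal e) sequentially"
    proof eventually_elim
      case (elim n)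
      have iQ: "y \<in> cell (a + int n) x \<Longrightarrow> (indicator Q y :: ennreal) = indicator Q x" for x y
      proof -
        assume y: "y \<in> cell (a + int n) x"
        have "cell a y = cell a x" using cell_eq_mono[OF _ y, of a] by simp
        thus ?thesis using Q[of x] Q[of y] cell_self[of x a] cell_self[of y a] by (auto simp: indicator_def)
      qed
      have EQ: "(\<integral>\<^sup>+x. indicator Q x * E (a + int n) (\<lambda>y. ennreal \<bar>g y - \<psi> m y\<bar>) x \<partial>lborel) = (\<integral>\<^sup>+x. indicator Q x * ennreal \<bar>g x - \<psi> m x\<bar> \<partial>lborel)"
        by (rule nn_integral_cellwise_const_mult[symmetric]) (auto intro: iQ)
      have "(?J g n) \<le>
         (\<integral>\<^sup>+x. ennreal \<bar>g x - \<psi> m x\<bar> * indicator Q x + (osc (a + int n) (\<psi> m) x * indicator Q x +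
           indicator Q x * E (a + int n) (\<lambda>y. ennreal \<bar>g y - \<psi> m y\<bar>) x) \<partial>lborel)"
      proof (rule nn_integral_mono)
        fix x
        show "osc (a + int n) g x * indicator Q x \<le> ennreal \<bar>g x - \<psi> m x\<bar> * indicator Q x + (osc (a + int n) (\<psi> m) x * indicator Q x +
           indicator Q x * E (a + int n) (\<lambda>y. ennreal \<bar>g y - \<psi> m y\<bar>) x)"
          using osc_triangle[of g "\<psi> m" "a + int n" x] by (cases "x \<in> Q") auto
      qed
      also have "\<dots> = ?d m + ((?J (\<psi> m) n) + ?d m)"
        by (simp add: nn_integral_add EQ mult.commute)
      also have "\<dots> \<le> ennreal (e / 3) + (ennreal (e / 3) + ennreal (e / 3))"
        using m elim by (intro add_mono) auto
      also have "\<dots> = ennreal e" using e by (simp flip: ennreal_plus)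
      finally show ?case .
    qed
    thus "limsup (\<lambda>n. ?J g n) \<le> 0 + ennreal e"
      by (simp add: Limsup_bounded)
  qed
qed simp

end

section \<open>Two parameters: reverse Hoelder inequality and strong maximal function\<close>

locale two_grids = A: doubling_grid c1 D + B: doubling_grid c2 D
  for c1 :: "int \<Rightarrow> 'a::euclidean_space \<Rightarrow> 'a set" and c2 :: "int \<Rightarrow> 'b::euclidean_space \<Rightarrow> 'b set" and D :: real +
  assumes shrink1: "0 < e \<Longrightarrow> \<exists>N0. \<forall>N\<ge>N0. c1 N x \<subseteq> ball x e"
    and shrink2: "0 < e \<Longrightarrow> \<exists>N0. \<forall>N\<ge>N0. c2 N y \<subseteq> ball y e"
begin

definition rect :: "int \<Rightarrow> int \<Rightarrow> 'a \<times> 'b \<Rightarrow> ('a \<times> 'b) set" where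
  "rect k l z = c1 k (fst z) \<times> c2 l (snd z)"

lemma finite_cell1: "finite_cell (c1 k x)" by unfold_locales
lemma finite_cell2: "finite_cell (c2 k x)" by unfold_locales

sublocale R: finite_cell "rect k l z" for k l z
  unfolding rect_def by (intro finite_cell_Times finite_cell1 finite_cell2)

lemma average_rect:
  assumes "f \<in> borel_measurable borel"
  shows "nn_average (rect k l z) f = A.E k (\<lambda>x. B.E l (\<lambda>y. f (x, y)) (snd z)) (fst z)"
    and "nn_average (rect k l z) f = B.E l (\<lambda>y. A.E k (\<lambda>x. f (x, y)) (fst z)) (snd z)"
  unfolding rect_def A.E_def B.E_def using average_Times[OF assms finite_cell1 finite_cell2] by simp_all

sublocale diag: cell_grid "\<lambda>k. rect k k"
proof
  fix k z
  have "range (rect k k) \<subseteq> (\<lambda>(C1, C2). C1 \<times> C2) ` (range (c1 k) \<times> range (c2 k))"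
    by (auto simp: rect_def image_iff)
  thus "countable (range (rect k k))"
    by (rule countable_subset) (intro countable_image countable_SIGMA A.countable_cells B.countable_cells)
  show "z \<in> rect k k z" using A.cell_self B.cell_self by (cases z) (auto simp: rect_def)
  show "rect k k y = rect k k z" if "y \<in> rect k k z" for y
    using that A.cell_eq[of "fst y" k "fst z"] B.cell_eq[of "snd y" k "snd z"] by (auto simp: rect_def)
  show "rect (k + 1) (k + 1) z \<subseteq> rect k k z"
    using A.cell_step B.cell_step by (fastforce simp: rect_def)
qed (auto simp: R.pos R.fin)

lemma measurable_rect_average [measurable]: "(\<lambda>z. nn_average (rect k l z) f) \<in> borel_measurable borel"
proof (rule diag.measurable_cellwise_const[of "max k l"])
  fix z y assume "y \<in> rect (max k l) (max k l) z"
  hence "c1 k (fst y) = c1 k (fst z)" "c2 l (snd y) = c2 l (snd z)"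
    using A.cell_eq_mono[of k "max k l" "fst y" "fst z"] B.cell_eq_mono[of l "max k l" "snd y" "snd z"]
    by (auto simp: rect_def)
  thus "nn_average (rect k l y) f = nn_average (rect k l z) f" by (simp add: rect_def)
qed

lemma shrink_diag: "0 < e \<Longrightarrow> \<exists>N0. \<forall>N\<ge>N0. rect N N z \<subseteq> ball z e"
proof -
  assume e: "0 < e"
  obtain N1 where N1: "\<forall>N\<ge>N1. c1 N (fst z) \<subseteq> ball (fst z) (e/2)" using shrink1[of "e/2" "fst z"] e by auto
  obtain N2 where N2: "\<forall>N\<ge>N2. c2 N (snd z) \<subseteq> ball (snd z) (e/2)" using shrink2[of "e/2" "snd z"] e by auto
  have "rect N N z \<subseteq> ball z e" if "N \<ge> max N1 N2" for N
  proof
    fix y assume "y \<in> rect N N z"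
    hence "fst y \<in> c1 N (fst z)" "snd y \<in> c2 N (snd z)" by (auto simp: rect_def)
    moreover have "N1 \<le> N" "N2 \<le> N" using that by auto
    ultimately have "fst y \<in> ball (fst z) (e/2)" "snd y \<in> ball (snd z) (e/2)"
      using N1 N2 by blast+
    hence "dist (fst z) (fst y) < e/2" "dist (snd z) (snd y) < e/2" by auto
    moreover have "dist z y \<le> dist (fst z) (fst y) + dist (snd z) (snd y)"
      unfolding dist_prod_def by (rule sqrt_sum_squares_le_sum) auto
    ultimately show "y \<in> ball z e" by simp
  qed
  thus ?thesis by blast
qed

text \<open>The square-root condition on all rectangles whose sides are cells of arbitrary,
  unrelated generations.\<close>
definition sqrt_condition2 :: "real \<Rightarrow> ('a \<times> 'b \<Rightarrow> ennreal) \<Rightarrow> bool" where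
  "sqrt_condition2 K w \<longleftrightarrow> (\<forall>k l z. nn_average (rect k l z) w < top \<and>
     nn_average (rect k l z) w \<le> ennreal K * (nn_average (rect k l z) (\<lambda>y. ennreal_powr (w y) (1/2)))\<^sup>2)"

text \<open>The average of \<open>w\<close> over the first variable on a fixed cell satisfies the
  one-parameter condition in the second variable with the same \<open>K\<close>, by Jensen's
  inequality for the square root; the same is true with the variables interchanged. So the
  one-parameter inequality may be used twice. The averages of generation \<open>N\<close> turn
  slices of \<open>w\<close> into averages over thin rectangles, to which the hypothesis
  applies.\<close>
lemma reverse_Holder_discrete:
  assumes w[measurable]: "w \<in> borel_measurable borel" and K: "1 \<le> K" and cond: "sqrt_condition2 K w"
    and eps: "0 < \<epsilon>" "\<epsilon> * (96 * D * K) \<le> 1" and N: "k \<le> N" "l \<le> N"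
  shows "nn_average (rect k l z) (\<lambda>y. ennreal_powr (diag.E N w y) (1 + \<epsilon>)) \<le> 4 * ennreal_powr (nn_average (rect k l z) w) (1 + \<epsilon>)"
proof -
  obtain z1 z2 where z: "z = (z1, z2)" by force
  define s where "s = (\<lambda>y. ennreal_powr (w y) (1/2))"
  have [measurable]: "s \<in> borel_measurable borel" unfolding s_def by measurable
  have c: "nn_average (rect i j (x, y)) w < top"
    "nn_average (rect i j (x, y)) w \<le> ennreal K * (nn_average (rect i j (x, y)) s)\<^sup>2" for i j x y
    using cond unfolding sqrt_condition2_def s_def by auto
  have [measurable]: "(\<lambda>y. A.E i (\<lambda>x. f (x, y)) x) \<in> borel_measurable borel"
    if "f \<in> borel_measurable borel" for f :: "'a \<times> 'b \<Rightarrow> ennreal" and i x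
  proof -
    have [measurable]: "f \<in> borel_measurable (borel \<Otimes>\<^sub>M borel)" using that by (simp add: borel_prod)
    show ?thesis unfolding A.E_def A.cl.nn_average_lborel by measurable
  qed
  have mB[measurable]: "(\<lambda>x. B.E i (\<lambda>y. f (x, y)) y) \<in> borel_measurable borel"
    if "f \<in> borel_measurable borel" for f :: "'a \<times> 'b \<Rightarrow> ennreal" and i y
    unfolding B.E_def by (rule measurable_average_section[OF that finite_cell2])
  define u where "u x y = A.E N (\<lambda>x. w (x, y)) x" for x y
  have um: "u x \<in> borel_measurable borel" for x unfolding u_def using w by measurable
  have Eu: "B.E j (u x) y = nn_average (rect N j (x, y)) w" for j x y
    by (simp add: average_rect(2)[OF w] u_def[abs_def])
  have su: "B.sqrt_condition K (u x)" for x
    unfolding B.sqrt_condition_def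
  proof (intro allI conjI)
    fix j y
    show "B.E j (u x) y < top" unfolding Eu by (rule c)
    have "nn_average (rect N j (x, y)) s \<le> B.E j (\<lambda>y. ennreal_powr (u x y) (1/2)) y"
    proof -
      have "A.E N (\<lambda>x. s (x, y')) x \<le> ennreal_powr (u x y') (1/2)" for y'
        unfolding A.E_def s_def u_def
        using A.cl.average_Jensen_concave[OF measurable_fst_section[OF w], of "1/2"] by simp
      thus ?thesis by (simp add: average_rect(2) B.E_mono)
    qed
    hence "ennreal K * (nn_average (rect N j (x, y)) s)\<^sup>2 \<le> ennreal K * (B.E j (\<lambda>y. ennreal_powr (u x y) (1/2)) y)\<^sup>2"
      by (intro mult_left_mono power_mono) auto
    thus "B.E j (u x) y \<le> ennreal K * (B.E j (\<lambda>y. ennreal_powr (u x y) (1/2)) y)\<^sup>2"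
      unfolding Eu by (rule order_trans[OF c(2)])
  qed
  define v where "v x = B.E l (\<lambda>y. w (x, y)) z2" for x
  have vm[measurable]: "v \<in> borel_measurable borel" unfolding v_def using w by measurable
  have Ev: "A.E i v x = nn_average (rect i l (x, z2)) w" for i x
    by (simp add: average_rect(1)[OF w] v_def[abs_def])
  have sv: "A.sqrt_condition K v"
    unfolding A.sqrt_condition_def
  proof (intro allI conjI)
    fix j x
    show "A.E j v x < top" unfolding Ev by (rule c)
    have "nn_average (rect j l (x, z2)) s \<le> A.E j (\<lambda>x. ennreal_powr (v x) (1/2)) x"
    proof -
      have "B.E l (\<lambda>y. s (x', y)) z2 \<le> ennreal_powr (v x') (1/2)" for x'
        unfolding B.E_def s_def v_def
        using B.cl.average_Jensen_concave[OF measurable_snd_section[OF w], of "1/2"] by simp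
      thus ?thesis by (simp add: average_rect(1) A.E_mono)
    qed
    hence "ennreal K * (nn_average (rect j l (x, z2)) s)\<^sup>2 \<le> ennreal K * (A.E j (\<lambda>x. ennreal_powr (v x) (1/2)) x)\<^sup>2"
      by (intro mult_left_mono power_mono) auto
    thus "A.E j v x \<le> ennreal K * (A.E j (\<lambda>x. ennreal_powr (v x) (1/2)) x)\<^sup>2"
      unfolding Ev by (rule order_trans[OF c(2)])
  qed
  let ?p = "\<lambda>t. ennreal_powr t (1 + \<epsilon>)"
  have pm: "(\<lambda>y. ?p (diag.E N w y)) \<in> borel_measurable borel" by measurable
  have "nn_average (rect k l z) (\<lambda>y. ?p (diag.E N w y)) = A.E k (\<lambda>x. B.E l (\<lambda>y. ?p (B.E N (u x) y)) z2) z1"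
    unfolding average_rect(1)[OF pm] by (simp add: z Eu diag.E_def)
  also have "\<dots> \<le> A.E k (\<lambda>x. 2 * ?p (A.E N v x)) z1"
  proof (rule A.E_mono)
    fix x
    have "B.E l (\<lambda>y. ?p (B.E N (u x) y)) z2 \<le> 2 * ?p (B.E l (u x) z2)"
      by (rule B.reverse_Holder[OF um K su eps]) (rule N)
    also have "B.E l (u x) z2 = A.E N v x" by (simp add: Eu Ev)
    finally show "B.E l (\<lambda>y. ?p (B.E N (u x) y)) z2 \<le> 2 * ?p (A.E N v x)" .
  qed
  also have "\<dots> = 2 * A.E k (\<lambda>x. ?p (A.E N v x)) z1"
    unfolding A.E_def[of k] by (rule A.cl.average_cmult) measurable
  also have "\<dots> \<le> 2 * (2 * ?p (A.E k v z1))"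
    by (intro mult_left_mono A.reverse_Holder[OF vm K sv eps] N) auto
  also have "\<dots> = 4 * ?p (nn_average (rect k l z) w)"
    by (simp add: Ev z flip: mult.assoc)
  finally show ?thesis .
qed

text \<open>The limit \<open>N \<rightarrow> \<infinity>\<close> of the discrete inequality. It is
  taken for the truncations \<open>min w m\<close>, whose averages of generation \<open>N\<close>
  lie below those of \<open>w\<close> and differ from the truncation by at most its oscillation,
  which tends to zero in mean; monotone convergence removes the truncation.\<close>
theorem reverse_Holder_rect:
  assumes w[measurable]: "w \<in> borel_measurable borel" and K: "1 \<le> K" and cond: "sqrt_condition2 K w"
    and eps: "0 < \<epsilon>" "\<epsilon> * (96 * D * K) \<le> 1"
  shows "nn_average (rect k l z) (\<lambda>y. ennreal_powr (w y) (1 + \<epsilon>)) \<le> 4 * ennreal_powr (nn_average (rect k l z) w) (1 + \<epsilon>)"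
proof -
  let ?p = "\<lambda>t. ennreal_powr t (1 + \<epsilon>)" and ?R = "rect k l z"
  define a where "a = max k l"
  define S where "S = 4 * ?p (nn_average ?R w)"
  have trunc: "nn_average ?R (\<lambda>y. ?p (min (w y) (of_nat m))) \<le> S" for m :: nat
  proof -
    \<comment> \<open>The truncation as a bounded real function, so that oscillations can be formed.\<close>
    define g where "g y = enn2real (min (w y) (of_nat m))" for y
    have [measurable]: "g \<in> borel_measurable borel" unfolding g_def by measurable
    have g_eq: "ennreal (g y) = min (w y) (of_nat m)" for y
    proof -
      have "min (w y) (of_nat m) < top" by (simp add: min_less_iff_disj of_nat_less_top)
      thus ?thesis by (simp add: g_def)
    qed
    have g_bd: "0 \<le> g y" "g y \<le> real m" for y
    proof -
      show "0 \<le> g y" by (simp add: g_def)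
      have "ennreal (g y) \<le> ennreal (real m)" unfolding g_eq by (simp add: ennreal_of_nat_eq_real_of_nat)
      thus "g y \<le> real m" by simp
    qed
    let ?J = "\<lambda>n. \<integral>\<^sup>+x. diag.osc (a + int n) g x * indicator ?R x \<partial>lborel"
    let ?c = "(1 + \<epsilon>) * real m powr \<epsilon>"
    have RQ: "rect a a x \<subseteq> ?R" if "x \<in> ?R" for x
    proof -
      have "c1 a (fst x) \<subseteq> c1 k (fst x)" "c2 a (snd x) \<subseteq> c2 l (snd x)"
        using A.cell_mono[of k a] B.cell_mono[of l a] by (auto simp: a_def)
      moreover have "c1 k (fst x) = c1 k (fst z)" "c2 l (snd x) = c2 l (snd z)"
        using that A.cell_eq B.cell_eq by (auto simp: rect_def mem_Times_iff)
      ultimately show ?thesis unfolding rect_def by blast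
    qed
    have lim: "(\<lambda>n. ?J n) \<longlonglongrightarrow> 0"
    proof (rule diag.osc_tendsto_0[OF shrink_diag])
      show "\<bar>g x\<bar> \<le> real m" for x using g_bd[of x] by simp
      show "emeasure lborel ?R < top" by (rule R.fin)
      show "rect a a x \<subseteq> ?R" if "x \<in> ?R" for x by (rule RQ[OF that])
    qed auto
    have "nn_average ?R (\<lambda>y. ?p (ennreal (g y))) \<le> S + ennreal ?c * ?J n / emeasure lborel ?R" for n
    proof -
      let ?N = "a + int n"
      have fin: "diag.E ?N w y < top" for y
        using cond unfolding sqrt_condition2_def diag.E_def by blast
      have pw: "?p (ennreal (g y)) \<le> ?p (diag.E ?N w y) + ennreal ?c * diag.osc ?N g y" for y
      proof -
        have "diag.osc ?N g y \<le> diag.E ?N (\<lambda>_. ennreal (2 * real m)) y"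
          unfolding diag.osc_def
        proof (intro diag.E_mono ennreal_leI)
          fix x show "\<bar>g x - g y\<bar> \<le> 2 * real m" using g_bd[of x] g_bd[of y] by linarith
        qed
        hence "diag.osc ?N g y < top" by (simp add: diag.E_def order.strict_trans1)
        then obtain T where T: "diag.osc ?N g y = ennreal T" "0 \<le> T" by (cases "diag.osc ?N g y") auto
        obtain F where F: "diag.E ?N w y = ennreal F" "0 \<le> F" using fin[of y] by (cases "diag.E ?N w y") auto
        have "ennreal (g y) = diag.E ?N (\<lambda>_. ennreal (g y)) y" by (simp add: diag.E_def)
        also have "\<dots> \<le> diag.E ?N (\<lambda>x. w x + ennreal \<bar>g x - g y\<bar>) y"
        proof (rule diag.E_mono)
          fix x
          have "ennreal (g y) \<le> ennreal (g x + \<bar>g x - g y\<bar>)" by (intro ennreal_leI) auto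
          also have "\<dots> = ennreal (g x) + ennreal \<bar>g x - g y\<bar>" using g_bd by (simp add: ennreal_plus)
          also have "\<dots> \<le> w x + ennreal \<bar>g x - g y\<bar>" by (intro add_right_mono) (simp add: g_eq)
          finally show "ennreal (g y) \<le> w x + ennreal \<bar>g x - g y\<bar>" .
        qed
        also have "\<dots> = diag.E ?N w y + diag.osc ?N g y"
          unfolding diag.E_def diag.osc_def by (rule R.average_add) measurable
        finally have "g y \<le> F + T" using F T g_bd by (simp add: T F flip: ennreal_plus)
        hence "g y powr (1 + \<epsilon>) \<le> F powr (1 + \<epsilon>) + ?c * T"
          using powr_perturb[of "g y" "real m" F T "1 + \<epsilon>"] g_bd[of y] F T eps by simp
        hence "ennreal (g y powr (1 + \<epsilon>)) \<le> ennreal (F powr (1 + \<epsilon>) + ?c * T)" by (rule ennreal_leI)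
        also have "\<dots> = ennreal (F powr (1 + \<epsilon>)) + ennreal ?c * ennreal T"
          using F T eps by (simp add: ennreal_plus ennreal_mult)
        finally show ?thesis using F T g_bd[of y] by simp
      qed
      have "nn_average ?R (\<lambda>y. ?p (ennreal (g y))) \<le> nn_average ?R (\<lambda>y. ?p (diag.E ?N w y) + ennreal ?c * diag.osc ?N g y)"
        by (intro R.average_mono pw)
      also have "\<dots> = nn_average ?R (\<lambda>y. ?p (diag.E ?N w y)) + ennreal ?c * nn_average ?R (diag.osc ?N g)"
        by (subst R.average_add) (simp_all add: R.average_cmult)
      also have "nn_average ?R (\<lambda>y. ?p (diag.E ?N w y)) \<le> S"
        unfolding S_def by (rule reverse_Holder_discrete[OF w K cond eps]) (auto simp: a_def)
      finally show ?thesis by (simp add: R.nn_average_lborel[where g = "diag.osc ?N g"] ennreal_times_divide add_right_mono)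
    qed
    moreover have "(\<lambda>n. S + ennreal ?c * ?J n / emeasure lborel ?R) \<longlonglongrightarrow> S"
    proof -
      have "(\<lambda>n. inverse (emeasure lborel ?R) * (ennreal ?c * ?J n)) \<longlonglongrightarrow> inverse (emeasure lborel ?R) * (ennreal ?c * 0)"
        using R.mu_ne[of k l z] by (intro ennreal_tendsto_cmult lim) (auto simp: less_top[symmetric])
      hence "(\<lambda>n. ennreal ?c * ?J n / emeasure lborel ?R) \<longlonglongrightarrow> 0"
        by (simp add: divide_ennreal_def mult.commute)
      from tendsto_add[OF tendsto_const[of S] this] show ?thesis by simp
    qed
    ultimately have "nn_average ?R (\<lambda>y. ?p (ennreal (g y))) \<le> S"
      by (intro LIMSEQ_le_const) auto
    thus ?thesis by (simp add: g_eq)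
  qed
  have inc: "incseq (\<lambda>m y. ?p (min (w y) (of_nat m)) * indicator ?R y)"
    using eps by (auto intro!: incseq_SucI le_funI mult_right_mono ennreal_powr_mono min.mono)
  have sup: "(SUP m. ?p (min (w y) (of_nat m)) * indicator ?R y) = ?p (w y) * indicator ?R y" for y
  proof -
    have "(SUP m::nat. min (w y) (of_nat m)) = w y"
    proof -
      have "(SUP m::nat. min (w y) (of_nat m)) = min (w y) (SUP m::nat. of_nat m)"
        by (simp add: inf_SUP flip: inf_min)
      thus ?thesis by (simp add: ennreal_SUP_of_nat_eq_top)
    qed
    moreover have "?p (SUP m::nat. min (w y) (of_nat m)) = (SUP m::nat. ?p (min (w y) (of_nat m)))"
      using eps by (intro ennreal_powr_SUP) auto
    ultimately show ?thesis by (simp add: SUP_mult_right_ennreal[symmetric])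
  qed
  have "(\<integral>\<^sup>+y. ?p (w y) * indicator ?R y \<partial>lborel) = (SUP m. \<integral>\<^sup>+y. ?p (min (w y) (of_nat m)) * indicator ?R y \<partial>lborel)"
    unfolding sup[symmetric] by (rule nn_integral_monotone_convergence_SUP[OF inc]) measurable
  also have "\<dots> \<le> S * emeasure lborel ?R"
  proof (rule SUP_least)
    fix m
    show "(\<integral>\<^sup>+y. ?p (min (w y) (of_nat m)) * indicator ?R y \<partial>lborel) \<le> S * emeasure lborel ?R"
      unfolding R.average_times[symmetric] by (intro mult_right_mono trunc) auto
  qed
  finally have "(\<integral>\<^sup>+y. ?p (w y) * indicator ?R y \<partial>lborel) / emeasure lborel ?R \<le> S * emeasure lborel ?R / emeasure lborel ?R"
    by (rule divide_right_mono_ennreal)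
  thus ?thesis using R.mu_ne[of k l z] unfolding R.nn_average_lborel S_def by (simp add: ennreal_mult_divide_eq)
qed

definition strong_maximal :: "('a \<times> 'b \<Rightarrow> ennreal) \<Rightarrow> 'a \<times> 'b \<Rightarrow> ennreal" where
  "strong_maximal f z = (SUP k. SUP l. nn_average (rect k l z) f)"

text \<open>An average over a rectangle is an iterated average, so the strong maximal function is
  dominated by the composition of the two one-parameter maximal functions, to each of which Doob's
  inequality applies by Tonelli's theorem.\<close>
theorem strong_maximal_bound:
  assumes f[measurable]: "f \<in> borel_measurable borel" and q: "1 < q"
  shows "(\<integral>\<^sup>+z. ennreal_powr (strong_maximal f z) q \<partial>lborel) \<le>
    ennreal ((2 powr q / (q - 1))\<^sup>2) * (\<integral>\<^sup>+z. ennreal_powr (f z) q \<partial>lborel)"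
proof -
  let ?C = "2 powr q / (q - 1)"
  have f'[measurable]: "f \<in> borel_measurable (borel \<Otimes>\<^sub>M borel)" using f by (simp add: borel_prod)
  define S where "S z = (SUP l. B.E l (\<lambda>y. f (fst z, y)) (snd z))" for z
  define T where "T z = (SUP k. A.E k (\<lambda>x. S (x, snd z)) (fst z))" for z
  have S': "S \<in> borel_measurable (borel \<Otimes>\<^sub>M borel)"
    unfolding S_def
  proof (rule borel_measurable_SUP)
    fix l
    have "(\<lambda>(m, y). f (fst m, y)) \<in> borel_measurable ((borel \<Otimes>\<^sub>M borel) \<Otimes>\<^sub>M borel)" by measurable
    from B.measurable_E_section[OF this, of snd l]
    show "(\<lambda>z. B.E l (\<lambda>y. f (fst z, y)) (snd z)) \<in> borel_measurable (borel \<Otimes>\<^sub>M borel)" by simp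
  qed auto
  hence Sb: "S \<in> borel_measurable borel" by (simp add: borel_prod)
  note S'[measurable]
  have T': "T \<in> borel_measurable (borel \<Otimes>\<^sub>M borel)"
    unfolding T_def
  proof (rule borel_measurable_SUP)
    fix k
    have "(\<lambda>(m, x). S (x, snd m)) \<in> borel_measurable ((borel \<Otimes>\<^sub>M borel) \<Otimes>\<^sub>M borel)" by measurable
    from A.measurable_E_section[OF this, of fst k]
    show "(\<lambda>z. A.E k (\<lambda>x. S (x, snd z)) (fst z)) \<in> borel_measurable (borel \<Otimes>\<^sub>M borel)" by simp
  qed auto
  hence Tb: "T \<in> borel_measurable borel" by (simp add: borel_prod)
  have [measurable]: "(\<lambda>x. S (x, y)) \<in> borel_measurable borel" for y by (rule measurable_fst_section[OF Sb])
  have [measurable]: "(\<lambda>y. f (x, y)) \<in> borel_measurable borel" for x by (rule measurable_snd_section[OF f])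
  have M_T: "strong_maximal f z \<le> T z" for z
    unfolding strong_maximal_def T_def
  proof (intro SUP_mono' SUP_least)
    fix k l
    show "nn_average (rect k l z) f \<le> A.E k (\<lambda>x. S (x, snd z)) (fst z)"
      unfolding average_rect(1)[OF f] by (intro A.E_mono) (auto simp: S_def intro!: SUP_upper)
  qed
  have pT: "(\<lambda>z. ennreal_powr (T z) q) \<in> borel_measurable borel" using Tb by measurable
  have pS: "(\<lambda>z. ennreal_powr (S z) q) \<in> borel_measurable borel" using Sb by measurable
  have pf: "(\<lambda>z. ennreal_powr (f z) q) \<in> borel_measurable borel" by measurable
  have mS: "(\<lambda>y. \<integral>\<^sup>+x. ennreal_powr (S (x, y)) q \<partial>lborel) \<in> borel_measurable lborel" by measurable
  have mf: "(\<lambda>x. \<integral>\<^sup>+y. ennreal_powr (f (x, y)) q \<partial>lborel) \<in> borel_measurable lborel" by measurable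
  have "(\<integral>\<^sup>+z. ennreal_powr (strong_maximal f z) q \<partial>lborel) \<le> (\<integral>\<^sup>+z. ennreal_powr (T z) q \<partial>lborel)"
    using q by (intro nn_integral_mono ennreal_powr_mono M_T) auto
  also have "\<dots> = (\<integral>\<^sup>+y. (\<integral>\<^sup>+x. ennreal_powr (T (x, y)) q \<partial>lborel) \<partial>lborel)"
    by (rule nn_integral_lborel_snd[OF pT, symmetric])
  also have "\<dots> \<le> (\<integral>\<^sup>+y. ennreal ?C * (\<integral>\<^sup>+x. ennreal_powr (S (x, y)) q \<partial>lborel) \<partial>lborel)"
    unfolding T_def fst_conv snd_conv by (intro nn_integral_mono A.Doob q) measurable
  also have "\<dots> = ennreal ?C * (\<integral>\<^sup>+z. ennreal_powr (S z) q \<partial>lborel)"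
    by (simp only: nn_integral_cmult[OF mS] nn_integral_lborel_snd[OF pS])
  also have "(\<integral>\<^sup>+z. ennreal_powr (S z) q \<partial>lborel) = (\<integral>\<^sup>+x. (\<integral>\<^sup>+y. ennreal_powr (S (x, y)) q \<partial>lborel) \<partial>lborel)"
    by (rule nn_integral_lborel_fst[OF pS, symmetric])
  also have "\<dots> \<le> (\<integral>\<^sup>+x. ennreal ?C * (\<integral>\<^sup>+y. ennreal_powr (f (x, y)) q \<partial>lborel) \<partial>lborel)"
    unfolding S_def fst_conv snd_conv by (intro nn_integral_mono B.Doob q) measurable
  also have "\<dots> = ennreal ?C * (\<integral>\<^sup>+z. ennreal_powr (f z) q \<partial>lborel)"
    by (simp only: nn_integral_cmult[OF mf] nn_integral_lborel_fst[OF pf])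
  finally have "(\<integral>\<^sup>+z. ennreal_powr (strong_maximal f z) q \<partial>lborel) \<le> ennreal ?C * (ennreal ?C * (\<integral>\<^sup>+z. ennreal_powr (f z) q \<partial>lborel))"
    by (simp add: mult_left_mono)
  also have "\<dots> = ennreal (?C\<^sup>2) * (\<integral>\<^sup>+z. ennreal_powr (f z) q \<partial>lborel)"
  proof -
    have "ennreal (?C\<^sup>2) = ennreal ?C * ennreal ?C"
      unfolding power2_eq_square using q by (intro ennreal_mult') auto
    thus ?thesis by (simp only: mult.assoc)
  qed
  finally show ?thesis .
qed

end

section \<open>Complex matrices acting on a real inner product space\<close>

text \<open>The real inner product is the real part of the Hermitian one. So conjugate transposition
  is the adjoint for the real inner product as well.\<close>
lemma inner_complex_vec: "inner (x :: complex^'d) y = Re (\<Sum>i\<in>UNIV. cnj (x $ i) * y $ i)"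
  by (simp add: inner_vec_def inner_complex_def)

lemma inner_matrix_vector:
  "inner (A *v x) y = inner x (conj_transpose A *v (y :: complex^'d))"
proof -
  have "(\<Sum>i\<in>UNIV. cnj ((A *v x) $ i) * y $ i) = (\<Sum>i\<in>UNIV. \<Sum>j\<in>UNIV. cnj (A $ i $ j) * cnj (x $ j) * y $ i)"
    by (simp add: matrix_vector_mult_def sum_distrib_right)
  also have "\<dots> = (\<Sum>j\<in>UNIV. \<Sum>i\<in>UNIV. cnj (A $ i $ j) * cnj (x $ j) * y $ i)"
    by (rule sum.swap)
  also have "\<dots> = (\<Sum>j\<in>UNIV. cnj (x $ j) * (conj_transpose A *v y) $ j)"
    by (simp add: matrix_vector_mult_def conj_transpose_def sum_distrib_left mult_ac)
  finally show ?thesis by (simp add: inner_complex_vec)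
qed

lemma conj_transpose_mult: "conj_transpose (A ** B) = conj_transpose B ** conj_transpose A"
  by (simp add: conj_transpose_def matrix_matrix_mult_def vec_eq_iff mult.commute)

lemma linear_matrix_vector: "linear ((*v) (A :: complex^'d^'d))"
  by (rule linearI)
    (simp_all add: matrix_vector_right_distrib vec_eq_iff matrix_vector_mult_def scaleR_sum_right distrib_left sum.distrib)

lemma bounded_linear_matrix_vector: "bounded_linear ((*v) (A :: complex^'d^'d))"
  using linear_matrix_vector linear_conv_bounded_linear by blast

lemma norm_matrix_vector_le: "norm (A *v x) \<le> matrix_opnorm A * norm x"
  unfolding matrix_opnorm_def by (rule onorm[OF bounded_linear_matrix_vector])

lemma matrix_opnorm_nonneg: "0 \<le> matrix_opnorm A"
  unfolding matrix_opnorm_def by (rule onorm_pos_le[OF bounded_linear_matrix_vector])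

lemma norm_conj_transpose_vector_le: "norm (conj_transpose A *v x) \<le> matrix_opnorm A * norm x"
proof (cases "conj_transpose A *v x = 0")
  case False
  let ?y = "conj_transpose A *v x"
  have "norm ?y * norm ?y = inner (A *v ?y) x"
    by (simp add: inner_matrix_vector power2_norm_eq_inner[symmetric] power2_eq_square)
  also have "\<dots> \<le> norm (A *v ?y) * norm x" by (rule norm_cauchy_schwarz)
  also have "\<dots> \<le> (matrix_opnorm A * norm ?y) * norm x"
    by (intro mult_right_mono norm_matrix_vector_le) auto
  finally have "norm ?y * norm ?y \<le> (matrix_opnorm A * norm x) * norm ?y" by (simp add: mult_ac)
  thus ?thesis using False by simp
qed (simp add: matrix_opnorm_nonneg)

definition cinner :: "complex^'d \<Rightarrow> complex^'d \<Rightarrow> complex" where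
  "cinner x y = (\<Sum>i\<in>UNIV. cnj (x $ i) * y $ i)"

lemma Re_cinner: "Re (cinner x y) = inner x y"
  by (simp add: cinner_def inner_complex_vec)

lemma Im_cinner: "Im (cinner x y) = inner (\<i> *s x) y"
  by (simp add: cinner_def inner_complex_vec)

lemma cinner_self: "cinner x x = complex_of_real ((norm x)\<^sup>2)"
proof -
  have "Im (cinner x x) = 0" by (simp add: cinner_def mult.commute)
  thus ?thesis by (simp add: complex_eq_iff Re_cinner power2_norm_eq_inner)
qed

lemma cinner_commute: "cinner y x = cnj (cinner x y)"
  by (simp add: cinner_def mult.commute)

lemma cinner_matrix: "cinner x (A *v y) = cinner (conj_transpose A *v x) y"
proof -
  have "cinner x (A *v y) = (\<Sum>i\<in>UNIV. \<Sum>j\<in>UNIV. cnj (x $ i) * A $ i $ j * y $ j)"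
    by (simp add: cinner_def matrix_vector_mult_def sum_distrib_left mult_ac)
  also have "\<dots> = (\<Sum>j\<in>UNIV. \<Sum>i\<in>UNIV. cnj (x $ i) * A $ i $ j * y $ j)" by (rule sum.swap)
  also have "\<dots> = cinner (conj_transpose A *v x) y"
    by (simp add: cinner_def matrix_vector_mult_def conj_transpose_def sum_distrib_left sum_distrib_right mult_ac)
  finally show ?thesis .
qed

lemma cinner_scale: "cinner (complex_of_real c *s x) y = complex_of_real c * cinner x y"
  by (simp add: cinner_def sum_distrib_left mult.assoc)

section \<open>Spectral theorem and functional calculus\<close>

text \<open>The orthogonal complement \<open>V\<close> of the given eigenvectors is not zero, by a
  count of real dimensions, and is invariant under \<open>A\<close>. A unit vector of
  \<open>V\<close> that maximises the quadratic form of \<open>A\<close> is an eigenvector: with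
  \<open>c\<close> the maximum, \<open>B = c - A\<close> is positive semidefinite on
  \<open>V\<close> and its form vanishes at \<open>v\<close>; varying \<open>v\<close> in the
  direction of \<open>B v\<close> gives \<open>B v = 0\<close>.\<close>
lemma hermitian_eigenvector_orthogonal:
  fixes A :: "complex^'d^'d" and u :: "'d \<Rightarrow> complex^'d"
  assumes herm: "conj_transpose A = A" and S: "S \<noteq> UNIV"
    and ev: "\<And>i. i \<in> S \<Longrightarrow> A *v u i = complex_of_real (l i) *s u i"
  obtains v c where "norm v = 1" "\<And>i. i \<in> S \<Longrightarrow> cinner (u i) v = 0" "A *v v = complex_of_real c *s v"
proof -
  define T where "T = u ` S \<union> (\<lambda>i. \<i> *s u i) ` S"
  define V where "V = {v. \<forall>y\<in>T. inner y v = 0}"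
  have V_iff: "v \<in> V \<longleftrightarrow> (\<forall>i\<in>S. cinner (u i) v = 0)" for v
    by (auto simp: V_def T_def complex_eq_iff Re_cinner Im_cinner)
  have sub: "subspace V" by (auto simp: V_def subspace_def inner_add_right)
  have "card S < CARD('d)" using S by (intro psubset_card_mono) auto
  have "dim T \<le> card T" by (rule dim_le_card') (simp add: T_def)
  also have "\<dots> \<le> card (u ` S) + card ((\<lambda>i. \<i> *s u i) ` S)" unfolding T_def by (rule card_Un_le)
  also have "\<dots> \<le> card S + card S" by (intro add_mono card_image_le) auto
  also have "\<dots> < DIM(complex^'d)" using \<open>card S < CARD('d)\<close> by simp
  finally obtain x where x: "x \<noteq> 0" "\<And>y. y \<in> span T \<Longrightarrow> orthogonal x y"
    using orthogonal_to_subspace_exists by blast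
  hence xV: "x \<in> V" by (auto simp: V_def orthogonal_def inner_commute span_base)
  let ?q = "\<lambda>v. inner v (A *v v)"
  have cq: "continuous_on UNIV ?q"
    by (intro continuous_intros linear_continuous_on bounded_linear_matrix_vector)
  have "closed V" by (rule closed_subspace[OF sub])
  hence "compact (V \<inter> sphere 0 1)" by (intro closed_Int_compact) auto
  moreover have "(1 / norm x) *\<^sub>R x \<in> V \<inter> sphere 0 1" using x xV sub by (simp add: subspace_scale)
  ultimately have "\<exists>v\<in>V \<inter> sphere 0 1. \<forall>y\<in>V \<inter> sphere 0 1. ?q y \<le> ?q v"
    by (intro continuous_attains_sup continuous_on_subset[OF cq]) auto
  then obtain v where "v \<in> V \<inter> sphere 0 1" "\<forall>y\<in>V \<inter> sphere 0 1. ?q y \<le> ?q v" by blast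
  hence v: "v \<in> V" "norm v = 1" "\<And>y. y \<in> V \<Longrightarrow> norm y = 1 \<Longrightarrow> ?q y \<le> ?q v" by auto
  define c where "c = ?q v"
  define B where "B y = c *\<^sub>R y - A *v y" for y
  have linB: "linear B" unfolding B_def
    by (intro linear_compose_sub linear_matrix_vector) (auto intro: linearI simp: algebra_simps)
  have AV: "A *v y \<in> V" if "y \<in> V" for y
    unfolding V_iff
  proof
    fix i assume "i \<in> S"
    have "cinner (u i) (A *v y) = cinner (A *v u i) y" by (simp add: cinner_matrix herm)
    also have "\<dots> = 0" using \<open>i \<in> S\<close> that by (simp add: ev cinner_scale V_iff)
    finally show "cinner (u i) (A *v y) = 0" .
  qed
  have BV: "B y \<in> V" if "y \<in> V" for y
    unfolding B_def using sub AV that by (intro subspace_diff subspace_scale)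
  have psd: "0 \<le> inner y (B y)" if "y \<in> V" for y
  proof (cases "y = 0")
    case False
    have "?q ((1 / norm y) *\<^sub>R y) \<le> c"
      unfolding c_def using False that sub by (intro v) (auto simp: subspace_scale)
    hence "?q y / (norm y)\<^sup>2 \<le> c"
      by (simp add: linear_scale[OF linear_matrix_vector] power2_eq_square)
    hence "?q y \<le> c * (norm y)\<^sup>2" using False by (simp add: divide_le_eq)
    thus ?thesis by (simp add: B_def inner_diff_right power2_norm_eq_inner)
  qed simp
  have symB: "inner y (B z) = inner (B y) z" for y z
    by (simp add: B_def inner_diff_right inner_diff_left inner_matrix_vector herm)
  define w where "w = B v"
  have w: "w \<in> V" unfolding w_def by (rule BV[OF v(1)])
  have "inner v (B v) = 0"
    using v(2) by (simp add: B_def inner_diff_right c_def power2_norm_eq_inner[symmetric])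
  define d where "d = inner w (B w)"
  have d: "0 \<le> d" unfolding d_def by (rule psd[OF w])
  have quad: "0 \<le> - 2 * t * (norm w)\<^sup>2 + t\<^sup>2 * d" for t
  proof -
    have "0 \<le> inner (v - t *\<^sub>R w) (B (v - t *\<^sub>R w))"
      using sub v(1) w by (intro psd subspace_diff subspace_scale)
    also have "\<dots> = inner v (B v) - t * inner w (B v) - t * inner v (B w) + t\<^sup>2 * d"
      by (simp add: linear_diff[OF linB] linear_scale[OF linB] inner_diff_left inner_diff_right d_def power2_eq_square algebra_simps)
    also have "inner v (B w) = (norm w)\<^sup>2" unfolding symB by (simp add: w_def power2_norm_eq_inner)
    also have "inner w (B v) = (norm w)\<^sup>2" by (simp add: w_def power2_norm_eq_inner)
    finally show ?thesis using \<open>inner v (B v) = 0\<close> by simp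
  qed
  have "w = 0"
  proof (rule ccontr)
    assume "w \<noteq> 0"
    define m where "m = (norm w)\<^sup>2"
    have m: "0 < m" using \<open>w \<noteq> 0\<close> by (simp add: m_def)
    \<comment> \<open>For small positive \<open>t\<close> the linear term of \<open>quad\<close> dominates; this \<open>t\<close> is small enough.\<close>
    define t where "t = m / (d + 1)"
    have t: "0 < t" using m d by (simp add: t_def)
    have "t * d \<le> t * (d + 1)" using t by simp
    also have "\<dots> = m" using d by (simp add: t_def)
    finally have "t * (t * d) \<le> t * m" using t by simp
    hence "t\<^sup>2 * d \<le> t * m" by (simp add: power2_eq_square mult.assoc)
    hence "- 2 * t * m + t\<^sup>2 * d \<le> - (t * m)" by (simp add: mult.commute)
    moreover have "0 < t * m" using t m by simp
    ultimately show False using quad[of t] by (simp add: m_def)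
  qed
  hence "A *v v = c *\<^sub>R v" by (simp add: w_def B_def)
  also have "\<dots> = complex_of_real c *s v" by (simp add: vec_eq_iff scaleR_conv_of_real[where 'a=complex])
  finally show thesis using v(1,2) by (intro that[of v c]) (auto simp: V_iff)
qed

lemma hermitian_orthonormal_eigenvectors:
  fixes A :: "complex^'d^'d" and S :: "'d set"
  assumes herm: "conj_transpose A = A"
  shows "\<exists>u l. (\<forall>i\<in>S. A *v u i = complex_of_real (l i) *s u i) \<and>
    (\<forall>i\<in>S. \<forall>j\<in>S. cinner (u i) (u j) = (if i = j then 1 else 0))"
proof -
  have "finite S" by simp
  thus ?thesis
  proof induction
    case (insert k S)
    then obtain u l where ul: "\<And>i. i \<in> S \<Longrightarrow> A *v u i = complex_of_real (l i) *s u i"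
      "\<And>i j. i \<in> S \<Longrightarrow> j \<in> S \<Longrightarrow> cinner (u i) (u j) = (if i = j then 1 else 0)" by blast
    obtain v c where v: "norm v = 1" "\<And>i. i \<in> S \<Longrightarrow> cinner (u i) v = 0" "A *v v = complex_of_real c *s v"
      using hermitian_eigenvector_orthogonal[OF herm _ ul(1), of S "\<lambda>i. i"] insert.hyps by blast
    have v': "cinner v (u i) = 0" if "i \<in> S" for i
      using v(2)[OF that] cinner_commute[of v "u i"] by simp
    have vv: "cinner v v = 1" using v(1) by (simp add: cinner_self)
    show ?case
    proof (intro exI conjI ballI)
      fix i assume "i \<in> insert k S"
      thus "A *v (u(k := v)) i = complex_of_real ((l(k := c)) i) *s (u(k := v)) i"
        using ul(1) v(3) insert.hyps by auto
      fix j assume "j \<in> insert k S"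
      thus "cinner ((u(k := v)) i) ((u(k := v)) j) = (if i = j then 1 else 0)"
        using \<open>i \<in> insert k S\<close> ul(2) v(2) v' vv insert.hyps by auto
    qed
  qed simp
qed

text \<open>The matrix with eigenvalues \<open>l\<close> in the orthonormal basis formed by the
  columns of \<open>U\<close>.\<close>
definition spec :: "complex^'d^'d \<Rightarrow> ('d \<Rightarrow> real) \<Rightarrow> complex^'d^'d" where
  "spec U l = U ** real_diag l ** conj_transpose U"

lemma mult_real_diag_nth: "(X ** real_diag l) $ i $ k = complex_of_real (l k) * X $ i $ k"
proof -
  have "X $ i $ j * (if j = k then complex_of_real (l j) else 0) = (if j = k then complex_of_real (l j) * X $ i $ j else 0)" for j
    by simp
  thus ?thesis by (simp add: matrix_matrix_mult_def real_diag_def)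
qed

lemma spec_nth: "spec U l $ i $ j = (\<Sum>k\<in>UNIV. complex_of_real (l k) * (U $ i $ k * cnj (U $ j $ k)))"
proof -
  have "spec U l $ i $ j = (\<Sum>k\<in>UNIV. (U ** real_diag l) $ i $ k * cnj (U $ j $ k))"
    unfolding spec_def matrix_matrix_mult_def[of "U ** real_diag l"] by (simp add: conj_transpose_def)
  thus ?thesis by (simp only: mult_real_diag_nth mult.assoc)
qed

lemma conj_transpose_spec: "conj_transpose (spec U l) = spec U l"
proof -
  have "cnj (spec U l $ j $ i) = spec U l $ i $ j" for i j
    unfolding spec_nth by (simp add: mult.commute)
  thus ?thesis by (simp only: vec_eq_iff conj_transpose_def vec_lambda_beta) simp
qed

lemma real_diag_mult: "real_diag l ** real_diag m = real_diag (\<lambda>i. l i * m i)"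
  by (simp add: vec_eq_iff mult_real_diag_nth) (simp add: real_diag_def)

lemma spec_mult: "unitary_matrix U \<Longrightarrow> spec U l ** spec U m = spec U (\<lambda>i. l i * m i)"
proof -
  assume "unitary_matrix U"
  hence "spec U l ** spec U m = U ** real_diag l ** (conj_transpose U ** U) ** real_diag m ** conj_transpose U"
    by (simp only: spec_def matrix_mul_assoc)
  also have "\<dots> = U ** (real_diag l ** real_diag m) ** conj_transpose U"
    using \<open>unitary_matrix U\<close> by (simp add: unitary_matrix_def matrix_mul_assoc)
  finally show ?thesis by (simp add: real_diag_mult spec_def)
qed

lemma spec_1:
  fixes U :: "complex^'d^'d"
  assumes "unitary_matrix U"
  shows "spec U (\<lambda>_. 1) = mat 1"
proof -
  have "real_diag (\<lambda>_. 1) = (mat 1 :: complex^'d^'d)"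
    unfolding real_diag_def mat_def by (simp only: of_real_1)
  hence "spec U (\<lambda>_. 1) = U ** conj_transpose U" by (simp only: spec_def matrix_mul_rid)
  thus ?thesis using assms by (simp only: unitary_matrix_def)
qed

lemma spec_tendsto:
  assumes "\<And>i. (\<lambda>n. l n i) \<longlonglongrightarrow> m i"
  shows "(\<lambda>n. spec U (l n)) \<longlonglongrightarrow> spec U m"
  by (intro vec_tendstoI) (unfold spec_nth, intro tendsto_intros assms)

theorem positive_definite_diagonalisation:
  fixes A :: "complex^'d^'d"
  assumes "positive_definite A"
  obtains U l where "unitary_matrix U" "\<And>i. 0 < l i" "A = spec U l"
proof -
  have herm: "conj_transpose A = A" and pos: "\<And>v. v \<noteq> 0 \<Longrightarrow> 0 < inner v (A *v v)"
    using assms by (auto simp: positive_definite_def inner_complex_vec)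
  obtain u :: "'d \<Rightarrow> complex^'d" and l where "\<forall>i\<in>UNIV. A *v u i = complex_of_real (l i) *s u i"
      "\<forall>i\<in>UNIV. \<forall>j\<in>UNIV. cinner (u i) (u j) = (if i = j then 1 else 0)"
    using hermitian_orthonormal_eigenvectors[OF herm, of UNIV] by blast
  hence ul: "A *v u i = complex_of_real (l i) *s u i"
      "cinner (u i) (u j) = (if i = j then 1 else 0)" for i j by blast+
  define U :: "complex^'d^'d" where "U = (\<chi> i j. u j $ i)"
  have "conj_transpose U ** U = mat 1"
    using ul(2) by (simp add: vec_eq_iff conj_transpose_def matrix_matrix_mult_def U_def mat_def cinner_def)
  hence un: "unitary_matrix U" by (simp add: unitary_matrix_def matrix_left_right_inverse)
  have "A ** U = U ** real_diag l"
  proof -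
    have "(A ** U) $ i $ j = (A *v u j) $ i" for i j
      by (simp add: matrix_matrix_mult_def matrix_vector_mult_def U_def)
    moreover have "(U ** real_diag l) $ i $ j = complex_of_real (l j) * u j $ i" for i j
      by (simp add: mult_real_diag_nth U_def)
    ultimately show ?thesis by (simp add: vec_eq_iff ul(1))
  qed
  hence "A ** (U ** conj_transpose U) = spec U l" by (simp add: spec_def matrix_mul_assoc)
  hence A: "A = spec U l" using un by (simp add: unitary_matrix_def)
  have "0 < l i" for i
  proof -
    have "complex_of_real ((norm (u i))\<^sup>2) = 1" using ul(2)[of i i] cinner_self[of "u i"] by simp
    hence n: "(norm (u i))\<^sup>2 = 1" by (simp only: of_real_eq_1_iff)
    hence "0 < inner (u i) (A *v u i)" by (intro pos) auto
    also have "A *v u i = l i *\<^sub>R u i" unfolding ul(1) by (simp add: vec_eq_iff scaleR_conv_of_real[where 'a=complex])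
    finally show ?thesis using n by (simp add: power2_norm_eq_inner)
  qed
  with un A show thesis by (intro that)
qed

primrec matrix_pow :: "complex^'d^'d \<Rightarrow> nat \<Rightarrow> complex^'d^'d" where
  "matrix_pow A 0 = mat 1"
| "matrix_pow A (Suc n) = A ** matrix_pow A n"

definition matrix_poly :: "(nat \<Rightarrow> real) \<Rightarrow> nat \<Rightarrow> complex^'d^'d \<Rightarrow> complex^'d^'d" where
  "matrix_poly a n A = (\<Sum>i\<le>n. a i *\<^sub>R matrix_pow A i)"

lemma continuous_matrix_pow: "continuous_on UNIV (\<lambda>A::complex^'d^'d. matrix_pow A n)"
proof (induction n)
  case (Suc n)
  have "continuous_on UNIV (\<lambda>A. \<chi> i j. \<Sum>k\<in>UNIV. A $ i $ k * matrix_pow A n $ k $ j :: complex^'d^'d)"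
    by (intro continuous_on_vec_lambda continuous_intros Suc)
  thus ?case by (simp add: matrix_matrix_mult_def)
qed simp

lemma continuous_matrix_poly: "continuous_on UNIV (matrix_poly a n)"
  unfolding matrix_poly_def[abs_def] by (intro continuous_intros continuous_matrix_pow)

lemma matrix_pow_spec: "unitary_matrix U \<Longrightarrow> matrix_pow (spec U l) n = spec U (\<lambda>i. l i ^ n)"
  by (induction n) (simp_all add: spec_1 spec_mult)

lemma matrix_poly_spec:
  assumes "unitary_matrix U"
  shows "matrix_poly a n (spec U l) = spec U (\<lambda>k. \<Sum>i\<le>n. a i * l k ^ i)"
proof -
  have "(\<Sum>i\<le>n. a i *\<^sub>R spec U (\<lambda>k. l k ^ i)) $ r $ s = spec U (\<lambda>k. \<Sum>i\<le>n. a i * l k ^ i) $ r $ s" for r s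
  proof -
    have "(\<Sum>i\<le>n. a i *\<^sub>R spec U (\<lambda>k. l k ^ i)) $ r $ s =
        (\<Sum>i\<le>n. \<Sum>k\<in>UNIV. complex_of_real (a i * l k ^ i) * (U $ r $ k * cnj (U $ s $ k)))"
      by (simp add: spec_nth scaleR_conv_of_real[where 'a=complex] sum_distrib_left mult.assoc)
    also have "\<dots> = (\<Sum>k\<in>UNIV. \<Sum>i\<le>n. complex_of_real (a i * l k ^ i) * (U $ r $ k * cnj (U $ s $ k)))"
      by (rule sum.swap)
    also have "\<dots> = spec U (\<lambda>k. \<Sum>i\<le>n. a i * l k ^ i) $ r $ s"
      by (simp add: spec_nth sum_distrib_right)
    finally show ?thesis .
  qed
  thus ?thesis using assms by (simp add: matrix_poly_def matrix_pow_spec vec_eq_iff)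
qed

text \<open>By the Weierstrass theorem on \<open>{1/(n+1)..n+1}\<close>, a power function is a
  pointwise limit of one sequence of polynomials on the whole open half-line. Applied to matrices,
  that sequence serves all positive definite arguments at once.\<close>
lemma powr_polynomial_approximation:
  "\<exists>(a :: nat \<Rightarrow> nat \<Rightarrow> real) N. \<forall>t>0. (\<lambda>n. \<Sum>i\<le>N n. a n i * t ^ i) \<longlonglongrightarrow> t powr s"
proof -
  have "\<exists>a N. \<forall>t\<in>{1 / real (Suc n)..real (Suc n)}. \<bar>t powr s - (\<Sum>i\<le>N. a i * t ^ i)\<bar> < 1 / real (Suc n)" for n
  proof -
    have "continuous_on {1 / real (Suc n)..real (Suc n)} (\<lambda>t. t powr s)"
    proof (intro continuous_intros ballI)
      fix t assume "t \<in> {1 / real (Suc n)..real (Suc n)}"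
      hence "0 < t" by (meson atLeastAtMost_iff less_le_trans of_nat_0_less_iff zero_less_Suc zero_less_divide_1_iff)
      thus "t \<noteq> 0" by simp
    qed
    then obtain g where g: "real_polynomial_function g"
      "\<And>t. t \<in> {1 / real (Suc n)..real (Suc n)} \<Longrightarrow> \<bar>t powr s - g t\<bar> < 1 / real (Suc n)"
      using Stone_Weierstrass_real_polynomial_function[of "{1 / real (Suc n)..real (Suc n)}" "\<lambda>t. t powr s" "1 / real (Suc n)"]
      by auto
    obtain a N where "g = (\<lambda>x. \<Sum>i\<le>N. a i * x ^ i)"
      using real_polynomial_function_imp_sum[OF g(1)] by blast
    with g(2) show ?thesis by blast
  qed
  then obtain a N where aN: "\<And>n t. t \<in> {1 / real (Suc n)..real (Suc n)} \<Longrightarrow> \<bar>t powr s - (\<Sum>i\<le>N n. a n i * t ^ i)\<bar> < 1 / real (Suc n)"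
    by metis
  show ?thesis
  proof (intro exI allI impI)
    fix t :: real assume t: "0 < t"
    obtain n1 :: nat where n1: "t \<le> real n1" using real_arch_simple by blast
    obtain n2 :: nat where n2: "1 / t \<le> real n2" using real_arch_simple by blast
    have "eventually (\<lambda>n. norm ((\<Sum>i\<le>N n. a n i * t ^ i) - t powr s) \<le> 1 / real (Suc n)) sequentially"
      unfolding eventually_sequentially
    proof (intro exI allI impI)
      fix n assume n: "max n1 n2 \<le> n"
      have "t \<le> real (Suc n)" using n1 n by simp
      moreover have "1 / t \<le> real (Suc n)" using n2 n by simp
      hence "1 / real (Suc n) \<le> t" using t by (simp add: field_simps)
      ultimately have "\<bar>t powr s - (\<Sum>i\<le>N n. a n i * t ^ i)\<bar> < 1 / real (Suc n)" by (intro aN) auto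
      thus "norm ((\<Sum>i\<le>N n. a n i * t ^ i) - t powr s) \<le> 1 / real (Suc n)" by simp
    qed
    moreover have "(\<lambda>n. 1 / real (Suc n)) \<longlonglongrightarrow> 0" by (rule LIMSEQ_Suc[OF lim_1_over_n])
    ultimately show "(\<lambda>n. \<Sum>i\<le>N n. a n i * t ^ i) \<longlonglongrightarrow> t powr s"
      by (rule LIM_zero_cancel[OF Lim_null_comparison])
  qed
qed

text \<open>The functional calculus does not depend on the diagonalisation, because both candidates
  are the limit of the same polynomials in the matrix.\<close>
lemma matrix_powr_spec:
  assumes U: "unitary_matrix U" and l: "\<And>i. 0 < l i"
  shows "matrix_powr (spec U l) s = spec U (\<lambda>i. l i powr s)"
proof -
  obtain a N where aN: "\<And>t. 0 < t \<Longrightarrow> (\<lambda>n. \<Sum>i\<le>N n. a n i * t ^ i) \<longlonglongrightarrow> t powr s"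
    using powr_polynomial_approximation[of s] by blast
  have lim: "(\<lambda>n. matrix_poly (a n) (N n) (spec V m)) \<longlonglongrightarrow> spec V (\<lambda>i. m i powr s)"
    if "unitary_matrix V" "\<And>i. 0 < m i" for V :: "complex^'d^'d" and m
    unfolding matrix_poly_spec[OF that(1)] by (intro spec_tendsto aN that)
  show ?thesis
    unfolding matrix_powr_def
  proof (rule the_equality)
    show "\<exists>V m. unitary_matrix V \<and> (\<forall>i. 0 < m i) \<and> spec U l = V ** real_diag m ** conj_transpose V \<and>
        spec U (\<lambda>i. l i powr s) = V ** real_diag (\<lambda>i. m i powr s) ** conj_transpose V"
      using U l by (intro exI[of _ U] exI[of _ l]) (auto simp: spec_def)
  next
    fix B assume "\<exists>V m. unitary_matrix V \<and> (\<forall>i. 0 < m i) \<and> spec U l = V ** real_diag m ** conj_transpose V \<and>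
        B = V ** real_diag (\<lambda>i. m i powr s) ** conj_transpose V"
    then obtain V m where V: "unitary_matrix V" "\<And>i. 0 < m i" "spec U l = spec V m" "B = spec V (\<lambda>i. m i powr s)"
      by (auto simp: spec_def)
    show "B = spec U (\<lambda>i. l i powr s)"
      using LIMSEQ_unique[OF _ lim[OF U l]] lim[OF V(1,2)] V(3,4) by simp
  qed
qed

lemma matrix_powr_hermitian:
  "positive_definite A \<Longrightarrow> conj_transpose (matrix_powr A s) = matrix_powr A s"
  by (erule positive_definite_diagonalisation) (simp add: matrix_powr_spec conj_transpose_spec)

lemma matrix_powr_inverse:
  assumes "positive_definite A"
  shows "matrix_powr A s ** matrix_powr A (- s) = mat 1" "matrix_powr A (- s) ** matrix_powr A s = mat 1"
proof -
  obtain U l where U: "unitary_matrix U" "\<And>i. 0 < l i" "A = spec U l"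
    using positive_definite_diagonalisation[OF assms] by metis
  have "l i powr s * l i powr (- s) = 1" "l i powr (- s) * l i powr s = 1" for i
    using U(2)[of i] by (simp_all flip: powr_add)
  thus "matrix_powr A s ** matrix_powr A (- s) = mat 1" "matrix_powr A (- s) ** matrix_powr A s = mat 1"
    using U by (simp_all add: matrix_powr_spec spec_mult spec_1)
qed

text \<open>The approximating polynomials in \<open>W\<close> are measurable, and they converge
  wherever \<open>W\<close> is positive definite.\<close>
lemma matrix_powr_measurable_version:
  fixes W :: "'a \<Rightarrow> complex^'d^'d"
  assumes W: "W \<in> borel_measurable M" and pd: "AE x in M. positive_definite (W x)"
  obtains P where "P \<in> borel_measurable M" "AE x in M. P x = matrix_powr (W x) s"
proof -
  obtain a N where aN: "\<And>t. 0 < t \<Longrightarrow> (\<lambda>n. \<Sum>i\<le>N n. a n i * t ^ i) \<longlonglongrightarrow> t powr s"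
    using powr_polynomial_approximation[of s] by blast
  define P where "P x = lim (\<lambda>n. matrix_poly (a n) (N n) (W x))" for x
  have "P \<in> borel_measurable M"
    unfolding P_def
    by (intro borel_measurable_lim_metric measurable_compose[OF W] borel_measurable_continuous_onI continuous_matrix_poly)
  moreover have "AE x in M. P x = matrix_powr (W x) s"
    using pd
  proof eventually_elim
    case (elim x)
    then obtain U l where U: "unitary_matrix U" "\<And>i. 0 < l i" "W x = spec U l"
      using positive_definite_diagonalisation by metis
    have "(\<lambda>n. matrix_poly (a n) (N n) (spec U l)) \<longlonglongrightarrow> spec U (\<lambda>i. l i powr s)"
      unfolding matrix_poly_spec[OF U(1)] by (intro spec_tendsto aN U)
    thus ?case using U by (simp add: P_def matrix_powr_spec limI)
  qed
  ultimately show thesis by (rule that)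
qed

section \<open>A matrix weight on one cell\<close>

lemma conj_exponent:
  assumes "1 < p"
  shows "1 < conj_exponent p" "1 / p + 1 / conj_exponent p = 1" "p / conj_exponent p = p - 1"
    "conj_exponent p / p = 1 / (p - 1)"
  using assms by (auto simp: conj_exponent_def field_simps)

lemma powr_convex_nonneg:
  fixes x y t q :: real
  assumes "1 \<le> q" "0 \<le> x" "0 \<le> y" "0 \<le> t" "t \<le> 1"
  shows "((1 - t) * x + t * y) powr q \<le> (1 - t) * x powr q + t * y powr q"
proof -
  have small: "(s * a) powr q \<le> s * a powr q" if "0 \<le> s" "s \<le> 1" for s a :: real
  proof (cases "s = 0")
    case False
    hence "s powr q \<le> s powr 1" using that assms by (intro powr_mono') auto
    thus ?thesis using that False by (simp add: powr_mult mult_right_mono)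
  qed simp
  consider "x = 0" | "y = 0" | "0 < x" "0 < y" using assms by linarith
  thus ?thesis
  proof cases
    case 3
    show ?thesis
      using convex_onD[OF powr_convex[OF assms(1)], of t x y] assms 3 by simp
  qed (use small[of t y] small[of "1 - t" x] assms in auto)
qed

lemma Bernoulli_powr:
  fixes t c :: real
  assumes "0 < t" "0 < c"
  shows "1 + c \<le> t powr (- c) + c * t"
proof -
  have "(t powr (- c)) powr (1 / (1 + c)) * t powr (c / (1 + c)) \<le> 1 / (1 + c) * t powr (- c) + c / (1 + c) * t"
    using assms by (intro Youngs_inequality_0) (auto simp: field_simps)
  moreover have "(t powr (- c)) powr (1 / (1 + c)) * t powr (c / (1 + c)) = 1"
    using assms by (simp add: powr_powr flip: powr_add)
  ultimately have "(1 + c) * 1 \<le> (1 + c) * (1 / (1 + c) * t powr (- c) + c / (1 + c) * t)"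
    using assms by (intro mult_left_mono) auto
  also have "\<dots> = t powr (- c) + c * t" using assms by (simp add: distrib_left)
  finally show ?thesis by simp
qed

lemma ennreal_add_cancel_real:
  fixes X :: ennreal
  assumes "ennreal (1 + c) \<le> X + ennreal c" "0 \<le> c"
  shows "1 \<le> X"
proof (cases X)
  case (real x)
  hence "ennreal (1 + c) \<le> ennreal (x + c)" using assms by (simp add: ennreal_plus)
  thus ?thesis using real assms by (simp add: ennreal_le_iff)
qed simp

lemma borel_measurable_matrix_vector:
  assumes "A \<in> borel_measurable M" "f \<in> borel_measurable M"
  shows "(\<lambda>x. (A x :: complex^'d^'d) *v f x) \<in> borel_measurable M"
proof -
  have "continuous_on UNIV (\<lambda>z. \<chi> i. \<Sum>j\<in>UNIV. (fst z :: complex^'d^'d) $ i $ j * snd z $ j)"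
    by (intro continuous_on_vec_lambda continuous_intros)
  hence "continuous_on UNIV (\<lambda>z. (fst z :: complex^'d^'d) *v snd z)"
    by (simp add: matrix_vector_mult_def)
  thus ?thesis by (rule borel_measurable_continuous_Pair[OF assms, of "(*v)"])
qed

text \<open>The expression of which the \<open>A\<^sub>p\<close> characteristic is the supremum, for
  \<open>P\<close> and \<open>Q\<close> the powers of the weight with exponents \<open>1/p\<close>
  and \<open>-1/p\<close>.\<close>
definition cross_average ::
  "real \<Rightarrow> ('a::euclidean_space \<Rightarrow> complex^'d^'d) \<Rightarrow> ('a \<Rightarrow> complex^'d^'d) \<Rightarrow> 'a set \<Rightarrow> ennreal" where
  "cross_average p P Q E = nn_average E (\<lambda>x. ennreal_powr
     (nn_average E (\<lambda>y. ennreal (matrix_opnorm (P x ** Q y) powr conj_exponent p)))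
     (p / conj_exponent p))"

locale matrix_cell = finite_cell E for E :: "'a::euclidean_space set" +
  fixes P Q :: "'a \<Rightarrow> complex^'d^'d" and p \<alpha> :: real
  assumes measurable_P: "P \<in> borel_measurable borel" and measurable_Q: "Q \<in> borel_measurable borel"
    and p: "1 < p" and alpha: "0 \<le> \<alpha>"
    and herm: "AE x in lborel. conj_transpose (P x) = P x \<and> conj_transpose (Q x) = Q x"
    and inv: "AE x in lborel. P x ** Q x = mat 1 \<and> Q x ** P x = mat 1"
    and Ap: "cross_average p P Q E \<le> ennreal \<alpha>"
begin

abbreviation "p' \<equiv> conj_exponent p"

lemma p': "1 < p'" using conj_exponent[OF p] by simp

lemma measurable_Pv [measurable]: "(\<lambda>x. P x *v v) \<in> borel_measurable borel"
  by (intro borel_measurable_matrix_vector measurable_P) simp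

lemma measurable_Qv [measurable]: "(\<lambda>x. Q x *v v) \<in> borel_measurable borel"
  by (intro borel_measurable_matrix_vector measurable_Q) simp

definition w :: "complex^'d \<Rightarrow> 'a \<Rightarrow> ennreal" where
  "w e y = ennreal (norm (Q y *v e) powr p')"

text \<open>The \<open>p'\<close>-th power of a norm on vectors, which plays the role of a reducing
  matrix of the dual weight. Its unit ball is convex because the \<open>p'\<close>-th power is a
  convex function.\<close>
definition N :: "complex^'d \<Rightarrow> ennreal" where
  "N e = nn_average E (w e)"

definition Phi :: "'a \<Rightarrow> ennreal" where
  "Phi x = nn_average E (\<lambda>y. ennreal (matrix_opnorm (P x ** Q y) powr p'))"

lemma measurable_w [measurable]: "w e \<in> borel_measurable borel"
  unfolding w_def[abs_def] by measurable

lemma w_scale: "w (c *\<^sub>R e) y = ennreal (\<bar>c\<bar> powr p') * w e y"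
  by (simp add: w_def linear_scale[OF linear_matrix_vector] powr_mult ennreal_mult)

lemma N_scale: "N (c *\<^sub>R e) = ennreal (\<bar>c\<bar> powr p') * N e"
proof -
  have "w (c *\<^sub>R e) = (\<lambda>y. ennreal (\<bar>c\<bar> powr p') * w e y)" by (rule ext) (rule w_scale)
  thus ?thesis unfolding N_def by (simp add: average_cmult)
qed

lemma N_zero [simp]: "N 0 = 0"
  using N_scale[of 0 0] p' by simp

lemma N_Px_le:
  assumes "conj_transpose (P x) = P x" "norm u \<le> 1"
  shows "N (P x *v u) \<le> Phi x"
  unfolding N_def Phi_def
proof (rule average_mono_AE)
  show "AE y in lborel. y \<in> E \<longrightarrow> w (P x *v u) y \<le> ennreal (matrix_opnorm (P x ** Q y) powr p')"
    using herm
  proof eventually_elim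
    case (elim y)
    have "Q y *v (P x *v u) = conj_transpose (P x ** Q y) *v u"
      using elim assms by (simp add: conj_transpose_mult matrix_vector_mul_assoc)
    also have "norm \<dots> \<le> matrix_opnorm (P x ** Q y) * norm u" by (rule norm_conj_transpose_vector_le)
    also have "\<dots> \<le> matrix_opnorm (P x ** Q y) * 1" using assms by (intro mult_left_mono matrix_opnorm_nonneg)
    finally show ?case unfolding w_def using p' by (intro impI ennreal_leI powr_mono2) auto
  qed
qed

text \<open>The \<open>A\<^sub>p\<close> bound yields a point \<open>x\<close> of the cell with
  \<open>Phi x\<close> finite, and \<open>e\<close> is the image under \<open>P x\<close> of a
  vector.\<close>
lemma N_finite: "N e < top"
proof -
  have "\<exists>x\<in>E. conj_transpose (P x) = P x \<and> P x ** Q x = mat 1 \<and> Phi x < top"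
  proof (rule ccontr)
    assume *: "\<not> ?thesis"
    have "nn_average E (\<lambda>_. top) \<le> nn_average E (\<lambda>x. ennreal_powr (Phi x) (p / p'))"
    proof (rule average_mono_AE)
      show "AE x in lborel. x \<in> E \<longrightarrow> top \<le> ennreal_powr (Phi x) (p / p')"
        using herm inv
      proof eventually_elim
        case (elim x)
        thus ?case using * by (auto simp: less_top[symmetric])
      qed
    qed
    thus False using Ap by (simp add: Phi_def cross_average_def top_unique)
  qed
  then obtain x where x: "conj_transpose (P x) = P x" "P x ** Q x = mat 1" "Phi x < top" by blast
  define k where "k = norm (Q x *v e)"
  have e: "P x *v (Q x *v e) = e" using x by (simp add: matrix_vector_mul_assoc)
  show ?thesis
  proof (cases "k = 0")
    case True
    hence "e = 0" using e by (simp add: k_def matrix_vector_mult_0_right)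
    thus ?thesis by simp
  next
    case False
    have "e = k *\<^sub>R (P x *v ((1 / k) *\<^sub>R (Q x *v e)))"
      using False e by (simp add: linear_scale[OF linear_matrix_vector])
    hence "N e = ennreal (\<bar>k\<bar> powr p') * N (P x *v ((1 / k) *\<^sub>R (Q x *v e)))" by (metis N_scale)
    also have "\<dots> \<le> ennreal (\<bar>k\<bar> powr p') * Phi x"
      by (intro mult_left_mono N_Px_le x) (auto simp: k_def)
    also have "\<dots> < top" using x by (simp add: ennreal_mult_less_top)
    finally show ?thesis .
  qed
qed

lemma N_convex:
  assumes "0 \<le> t" "t \<le> 1"
  shows "N ((1 - t) *\<^sub>R x + t *\<^sub>R y) \<le> ennreal (1 - t) * N x + ennreal t * N y"
proof -
  have "w ((1 - t) *\<^sub>R x + t *\<^sub>R y) z \<le> ennreal (1 - t) * w x z + ennreal t * w y z" for z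
  proof -
    have "norm (Q z *v ((1 - t) *\<^sub>R x + t *\<^sub>R y)) \<le> (1 - t) * norm (Q z *v x) + t * norm (Q z *v y)"
      using norm_triangle_ineq[of "(1 - t) *\<^sub>R (Q z *v x)" "t *\<^sub>R (Q z *v y)"] assms
      by (simp add: linear_add[OF linear_matrix_vector] linear_scale[OF linear_matrix_vector])
    hence "norm (Q z *v ((1 - t) *\<^sub>R x + t *\<^sub>R y)) powr p' \<le> ((1 - t) * norm (Q z *v x) + t * norm (Q z *v y)) powr p'"
      using p' by (intro powr_mono2) auto
    also have "\<dots> \<le> (1 - t) * norm (Q z *v x) powr p' + t * norm (Q z *v y) powr p'"
      using p' assms by (intro powr_convex_nonneg) auto
    finally show ?thesis using assms
      by (simp add: w_def ennreal_leI flip: ennreal_mult ennreal_plus)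
  qed
  hence "N ((1 - t) *\<^sub>R x + t *\<^sub>R y) \<le> nn_average E (\<lambda>z. ennreal (1 - t) * w x z + ennreal t * w y z)"
    unfolding N_def by (intro average_mono)
  also have "\<dots> = ennreal (1 - t) * N x + ennreal t * N y"
    unfolding N_def by (simp add: average_add average_cmult)
  finally show ?thesis .
qed

lemma convex_N_ball: "convex {z. N z < 1}"
proof (rule convexI)
  fix x y :: "complex^'d" and u v :: real
  assume xy: "x \<in> {z. N z < 1}" "y \<in> {z. N z < 1}" and uv: "0 \<le> u" "0 \<le> v" "u + v = 1"
  hence u: "u = 1 - v" by simp
  obtain a where a: "N x = ennreal a" "0 \<le> a" using N_finite[of x] by (cases "N x") auto
  obtain b where b: "N y = ennreal b" "0 \<le> b" using N_finite[of y] by (cases "N y") auto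
  have ab: "a < 1" "b < 1" using a b xy by auto
  have "N (u *\<^sub>R x + v *\<^sub>R y) \<le> ennreal u * N x + ennreal v * N y"
    unfolding u using uv by (intro N_convex) auto
  also have "\<dots> = ennreal (u * a + v * b)"
    using a b uv by (simp add: ennreal_mult ennreal_plus)
  also have "\<dots> < 1"
  proof -
    have "u * a + v * b < 1"
      using convex_bound_lt[of a 1 b u v] ab uv by simp
    hence "ennreal (u * a + v * b) < ennreal 1" by (intro ennreal_lessI) auto
    thus ?thesis by (simp only: ennreal_1)
  qed
  finally show "u *\<^sub>R x + v *\<^sub>R y \<in> {z. N z < 1}" by simp
qed

text \<open>Finite-dimensional duality. A hyperplane separating the normalised vector
  \<open>e\<close> from the open unit ball of the dual norm gives \<open>v\<close> whose product
  with \<open>e\<close> is at least the norm of \<open>e\<close> and whose product with any other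
  vector is at most the norm of that vector. In particular \<open>|P x v|\<close>, the supremum of
  the products of \<open>v\<close> with \<open>P x u\<close> over unit vectors \<open>u\<close>, is
  at most \<open>Phi x\<close> to the power \<open>1/p'\<close>; the \<open>A\<^sub>p\<close> bound
  then controls the average of its \<open>p\<close>-th power.\<close>
lemma norming_vector:
  assumes "0 < N e"
  obtains v where "0 < inner e v" "N e \<le> ennreal (inner e v powr p')"
    "nn_average E (\<lambda>x. ennreal (norm (P x *v v) powr p)) \<le> ennreal \<alpha>"
proof -
  obtain n where n: "N e = ennreal n" "0 < n"
    using N_finite[of e] assms by (cases "N e") auto
  define \<nu> where "\<nu> = n powr (1 / p')"
  have nu: "0 < \<nu>" "\<nu> powr p' = n" using n p' by (auto simp: \<nu>_def powr_powr)
  define S where "S = {z. N z < 1}"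
  have "N ((1 / \<nu>) *\<^sub>R e) = ennreal ((1 / \<nu>) powr p' * n)"
    using nu n by (simp add: N_scale ennreal_mult)
  also have "(1 / \<nu>) powr p' * n = 1" using nu n by (simp add: powr_divide)
  finally have "(1 / \<nu>) *\<^sub>R e \<notin> S" by (simp add: S_def)
  moreover have S0: "0 \<in> S" by (simp add: S_def)
  ultimately obtain a b where ab: "a \<noteq> 0" "\<And>x. x \<in> S \<Longrightarrow> inner a x \<le> b" "b \<le> inner a ((1 / \<nu>) *\<^sub>R e)"
    using separating_hyperplane_sets[of S "{(1 / \<nu>) *\<^sub>R e}"] convex_N_ball by (auto simp: S_def)
  have b: "0 < b"
  proof -
    obtain m where m: "N a = ennreal m" "0 \<le> m" using N_finite[of a] by (cases "N a") auto
    \<comment> \<open>A positive multiple of the normal vector \<open>a\<close> lies in the open unit ball.\<close>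
    define t where "t = (1 / (m + 1)) powr (1 / p')"
    have t: "0 < t" "t powr p' = 1 / (m + 1)" using m p' by (auto simp: t_def powr_powr)
    have "N (t *\<^sub>R a) = ennreal (m / (m + 1))"
      using t m by (simp add: N_scale flip: ennreal_mult)
    also have "\<dots> < ennreal 1" using m by (intro ennreal_lessI) auto
    finally have "inner a (t *\<^sub>R a) \<le> b" by (intro ab) (simp add: S_def del: inner_scaleR_right)
    moreover have "0 < inner a (t *\<^sub>R a)" using ab t by simp
    ultimately show ?thesis by linarith
  qed
  define v where "v = (1 / b) *\<^sub>R a"
  have v: "inner x v \<le> 1" if "x \<in> S" for x
    using ab(2)[OF that] b by (simp add: v_def inner_commute)
  have ev: "\<nu> \<le> inner e v"
    using ab(3) b nu by (simp add: v_def inner_commute field_simps)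
  have bound: "ennreal (norm (P x *v v) powr p) \<le> ennreal_powr (Phi x) (p / p')" if "conj_transpose (P x) = P x" for x
  proof (cases "Phi x = top \<or> P x *v v = 0")
    case True thus ?thesis using p by auto
  next
    case False
    then obtain f where f: "Phi x = ennreal f" "0 \<le> f" by (cases "Phi x") auto
    let ?r = "norm (P x *v v)"
    define u where "u = (1 / ?r) *\<^sub>R (P x *v v)"
    have u: "norm u = 1" using False by (simp add: u_def)
    have r: "?r = inner (P x *v u) v"
      using False that by (simp add: inner_matrix_vector u_def power2_norm_eq_inner[symmetric] power2_eq_square)
    have "?r \<le> c" if c: "f powr (1 / p') < c" for c
    proof -
      have "0 \<le> f powr (1 / p')" by simp
      hence c0: "0 < c" using c by linarith
      have "(f powr (1 / p')) powr p' < c powr p'" using c p' by (intro powr_less_mono2) auto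
      hence fc: "f < c powr p'" using f p' by (simp add: powr_powr)
      have "N ((1 / c) *\<^sub>R (P x *v u)) \<le> ennreal ((1 / c) powr p') * Phi x"
        using c0 u \<open>conj_transpose (P x) = P x\<close> by (simp add: N_scale mult_left_mono N_Px_le)
      also have "\<dots> = ennreal (f / c powr p')" using c0 f by (simp add: powr_divide flip: ennreal_mult)
      also have "\<dots> < ennreal 1" using fc c0 f by (intro ennreal_lessI) auto
      finally have "inner ((1 / c) *\<^sub>R (P x *v u)) v \<le> 1" by (intro v) (simp add: S_def)
      thus ?thesis using c0 r by simp
    qed
    hence "?r \<le> f powr (1 / p')" by (rule dense_ge)
    hence "?r powr p \<le> (f powr (1 / p')) powr p" using p by (intro powr_mono2) auto
    thus ?thesis using f by (simp add: powr_powr ennreal_leI)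
  qed
  show thesis
  proof (rule that)
    show "0 < inner e v" using ev nu by linarith
    show "N e \<le> ennreal (inner e v powr p')"
      unfolding n nu(2)[symmetric] using ev nu p' by (intro ennreal_leI powr_mono2) auto
    have "nn_average E (\<lambda>x. ennreal (norm (P x *v v) powr p)) \<le> nn_average E (\<lambda>x. ennreal_powr (Phi x) (p / p'))"
    proof (rule average_mono_AE)
      show "AE x in lborel. x \<in> E \<longrightarrow> ennreal (norm (P x *v v) powr p) \<le> ennreal_powr (Phi x) (p / p')"
        using herm by eventually_elim (use bound in auto)
    qed
    also have "\<dots> \<le> ennreal \<alpha>" unfolding Phi_def using Ap by (simp only: cross_average_def)
    finally show "nn_average E (\<lambda>x. ennreal (norm (P x *v v) powr p)) \<le> ennreal \<alpha>" .
  qed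
qed

text \<open>With the norming vector \<open>v\<close> of \<open>e\<close>, the product of \<open>|Q
  e|\<close> and \<open>\<psi> = |P v|\<close> is almost everywhere at least the constant
  \<open>s\<close>, the inner product of \<open>e\<close> and \<open>v\<close>. So
  \<open>\<surd>w\<close> is bounded below by a negative power of \<open>\<psi>\<^sup>p\<close>,
  whose average is at most \<open>\<alpha>\<close>. Bernoulli's inequality linearises that negative
  power at \<open>\<alpha>\<close> and thus yields a lower bound for the average of
  \<open>\<surd>w\<close> in terms of \<open>s\<close>.\<close>
lemma N_sqrt_bound: "N e \<le> ennreal (\<alpha> powr (1 / (p - 1))) * (nn_average E (\<lambda>x. ennreal_powr (w e x) (1/2)))\<^sup>2"
proof (cases "N e = 0")
  case False
  hence "0 < N e" by (simp add: zero_less_iff_neq_zero)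
  then obtain v where v: "0 < inner e v" "N e \<le> ennreal (inner e v powr p')"
    "nn_average E (\<lambda>x. ennreal (norm (P x *v v) powr p)) \<le> ennreal \<alpha>"
    by (rule norming_vector)
  define s where "s = inner e v"
  let ?\<psi> = "\<lambda>x. norm (P x *v v)"
  have key: "AE x in lborel. s \<le> norm (Q x *v e) * ?\<psi> x"
    using herm inv
  proof eventually_elim
    case (elim x)
    have "s = inner (P x *v (Q x *v e)) v" using elim by (simp add: s_def matrix_vector_mul_assoc)
    also have "\<dots> = inner (Q x *v e) (P x *v v)" using elim by (simp add: inner_matrix_vector)
    also have "\<dots> \<le> norm (Q x *v e) * ?\<psi> x" by (rule norm_cauchy_schwarz)
    finally show ?case .
  qed
  have s: "0 < s" using v by (simp add: s_def)
  have a0: "0 < \<alpha>"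
  proof (rule ccontr)
    assume "\<not> 0 < \<alpha>"
    hence "nn_average E (\<lambda>x. ennreal (?\<psi> x powr p)) = 0" using v(3) alpha by simp
    hence "(\<integral>\<^sup>+x. ennreal (?\<psi> x powr p) * indicator E x \<partial>lborel) = 0"
      unfolding average_times[symmetric] by simp
    hence "AE x in lborel. ennreal (?\<psi> x powr p) * indicator E x = 0"
      by (subst (asm) nn_integral_0_iff_AE) auto
    hence "AE x in lborel. x \<notin> E"
      using key
    proof eventually_elim
      case (elim x)
      show ?case
      proof
        assume "x \<in> E"
        hence "?\<psi> x = 0" using elim p by simp
        thus False using elim s by simp
      qed
    qed
    hence "(\<integral>\<^sup>+x. indicator E x \<partial>lborel) = (\<integral>\<^sup>+x. 0 \<partial>(lborel :: 'a measure))"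
      by (intro nn_integral_cong_AE) auto
    thus False using pos by simp
  qed
  define c where "c = p' / (2 * p)"
  have c: "0 < c" "2 * c = 1 / (p - 1)" "p * c = p' / 2"
    using p p' conj_exponent(4)[OF p] by (auto simp: c_def field_simps)
  define k where "k = \<alpha> powr c / s powr (p' / 2)"
  have k: "0 \<le> k" by (simp add: k_def)
  let ?S = "nn_average E (\<lambda>x. ennreal_powr (w e x) (1/2))"
  have "ennreal (1 + c) = nn_average E (\<lambda>_. ennreal (1 + c))" by simp
  also have "\<dots> \<le> nn_average E (\<lambda>x. ennreal k * ennreal_powr (w e x) (1/2) + ennreal (c / \<alpha>) * ennreal (?\<psi> x powr p))"
  proof (rule average_mono_AE)
    show "AE x in lborel. x \<in> E \<longrightarrow> ennreal (1 + c) \<le> ennreal k * ennreal_powr (w e x) (1/2) + ennreal (c / \<alpha>) * ennreal (?\<psi> x powr p)"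
      using key
    proof eventually_elim
      case (elim x)
      have ps: "0 < ?\<psi> x" using elim s by (metis less_le_trans mult_zero_right norm_ge_zero order_le_less)
      have "1 + c \<le> (?\<psi> x powr p / \<alpha>) powr (- c) + c * (?\<psi> x powr p / \<alpha>)"
        using ps a0 c by (intro Bernoulli_powr) auto
      also have "(?\<psi> x powr p / \<alpha>) powr (- c) = \<alpha> powr c / ?\<psi> x powr (p' / 2)"
        using ps a0 by (simp add: powr_divide powr_powr powr_minus_divide c(3))
      also have "\<dots> \<le> k * norm (Q x *v e) powr (p' / 2)"
      proof -
        have "s powr (p' / 2) \<le> norm (Q x *v e) powr (p' / 2) * ?\<psi> x powr (p' / 2)"
          unfolding powr_mult[symmetric] using elim s p' by (intro powr_mono2) auto
        hence "1 / ?\<psi> x powr (p' / 2) \<le> norm (Q x *v e) powr (p' / 2) / s powr (p' / 2)"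
          using ps s by (simp add: field_simps)
        from mult_left_mono[OF this, of "\<alpha> powr c"] show ?thesis by (simp add: k_def)
      qed
      finally have "ennreal (1 + c) \<le> ennreal (k * norm (Q x *v e) powr (p' / 2) + c / \<alpha> * ?\<psi> x powr p)"
        by (intro ennreal_leI) simp
      also have "\<dots> = ennreal k * ennreal (norm (Q x *v e) powr (p' / 2)) + ennreal (c / \<alpha>) * ennreal (?\<psi> x powr p)"
      proof -
        have "ennreal (c / \<alpha> * ?\<psi> x powr p) = ennreal (c / \<alpha>) * ennreal (?\<psi> x powr p)"
          using c a0 by (intro ennreal_mult') auto
        moreover have "ennreal (k * norm (Q x *v e) powr (p' / 2)) = ennreal k * ennreal (norm (Q x *v e) powr (p' / 2))"
          using k by (intro ennreal_mult') auto
        ultimately show ?thesis using c a0 k by (simp add: ennreal_plus)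
      qed
      also have "ennreal (norm (Q x *v e) powr (p' / 2)) = ennreal_powr (w e x) (1/2)"
        by (simp add: w_def powr_powr)
      finally show ?case by simp
    qed
  qed
  also have "\<dots> = ennreal k * ?S + ennreal (c / \<alpha>) * nn_average E (\<lambda>x. ennreal (?\<psi> x powr p))"
    by (subst average_add) (simp_all add: average_cmult)
  also have "\<dots> \<le> ennreal k * ?S + ennreal (c / \<alpha>) * ennreal \<alpha>"
    by (intro add_left_mono mult_left_mono v) auto
  also have "ennreal (c / \<alpha>) * ennreal \<alpha> = ennreal c"
    using c a0 by (simp flip: ennreal_mult)
  finally have 1: "1 \<le> ennreal k * ?S" using c by (intro ennreal_add_cancel_real) auto
  have "ennreal (s powr (p' / 2)) * 1 \<le> ennreal (s powr (p' / 2)) * (ennreal k * ?S)"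
    by (intro mult_left_mono 1) auto
  also have "\<dots> = ennreal (\<alpha> powr c) * ?S"
    using s k by (simp add: k_def mult.assoc[symmetric] flip: ennreal_mult)
  finally have "(ennreal (s powr (p' / 2)))\<^sup>2 \<le> (ennreal (\<alpha> powr c) * ?S)\<^sup>2"
    by (intro power_mono) auto
  moreover have "(ennreal (s powr (p' / 2)))\<^sup>2 = ennreal (s powr p')"
    by (simp add: power2_eq_square flip: ennreal_mult powr_add)
  moreover have "(ennreal (\<alpha> powr c) * ?S)\<^sup>2 = ennreal (\<alpha> powr (1 / (p - 1))) * ?S\<^sup>2"
    by (simp add: power_mult_distrib c(2)[symmetric] ennreal_power powr_powr mult.commute flip: powr_numeral)
  ultimately show ?thesis using v(2) by (simp add: s_def)
qed simp

text \<open>Jensen's inequality bounds the square of the average of \<open>\<surd>w\<close> by the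
  average of \<open>w\<close>, which is positive and finite; so the constant of the square-root
  condition is at least \<open>1\<close>.\<close>
lemma alpha_ge_1: "1 \<le> \<alpha>"
proof -
  define e :: "complex^'d" where "e = axis undefined 1"
  have e: "e \<noteq> 0" by (simp add: e_def axis_eq_0_iff)
  have "N e \<noteq> 0"
  proof
    assume "N e = 0"
    hence "(\<integral>\<^sup>+x. w e x * indicator E x \<partial>lborel) = 0"
      unfolding average_times[symmetric] N_def by simp
    hence "AE x in lborel. w e x * indicator E x = 0"
      by (subst (asm) nn_integral_0_iff_AE) auto
    hence "AE x in lborel. x \<notin> E"
      using inv
    proof eventually_elim
      case (elim x)
      show ?case
      proof
        assume "x \<in> E"
        hence "Q x *v e = 0" using elim p' by (simp add: w_def)
        hence "P x *v (Q x *v e) = 0" by (simp add: matrix_vector_mult_0_right)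
        thus False using elim e by (simp add: matrix_vector_mul_assoc)
      qed
    qed
    hence "(\<integral>\<^sup>+x. indicator E x \<partial>lborel) = (\<integral>\<^sup>+x. 0 \<partial>(lborel :: 'a measure))"
      by (intro nn_integral_cong_AE) auto
    thus False using pos by simp
  qed
  then obtain n where n: "N e = ennreal n" "0 < n" using N_finite[of e] by (cases "N e") auto
  have "(nn_average E (\<lambda>x. ennreal_powr (w e x) (1/2)))\<^sup>2 \<le> (ennreal_powr (N e) (1/2))\<^sup>2"
    unfolding N_def by (intro power_mono average_Jensen_concave) auto
  also have "\<dots> = N e" using n by (simp add: power2_eq_square flip: ennreal_mult powr_add)
  finally have "ennreal (\<alpha> powr (1 / (p - 1))) * (nn_average E (\<lambda>x. ennreal_powr (w e x) (1/2)))\<^sup>2 \<le> ennreal (\<alpha> powr (1 / (p - 1))) * N e"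
    by (intro mult_left_mono) auto
  hence "ennreal n \<le> ennreal (\<alpha> powr (1 / (p - 1)) * n)"
    using N_sqrt_bound[of e] n by (simp add: ennreal_mult)
  hence 1: "1 \<le> \<alpha> powr (1 / (p - 1))" using n by (simp add: ennreal_le_iff)
  show ?thesis
  proof (rule ccontr)
    assume "\<not> 1 \<le> \<alpha>"
    hence "\<alpha> powr (1 / (p - 1)) < 1 powr (1 / (p - 1))"
      using p alpha by (intro powr_less_mono2) auto
    thus False using 1 by simp
  qed
qed

text \<open>If \<open>v\<close> norms \<open>B e\<close>, then the inner product of \<open>B
  e\<close> and \<open>v\<close> is that of \<open>e\<close> and \<open>B v\<close>, and the
  reducing property bounds \<open>|B v|\<close> by the average of \<open>|P v|\<close>.\<close>
lemma N_reducing: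
  assumes B: "conj_transpose B = B"
    and red: "\<And>v. ennreal (norm (B *v v)) \<le> ennreal c * ennreal_powr (nn_average E (\<lambda>x. ennreal (norm (P x *v v) powr p))) (1 / p)"
    and c: "0 \<le> c"
  shows "N (B *v e) \<le> ennreal ((c * \<alpha> powr (1 / p) * norm e) powr p')"
proof (cases "N (B *v e) = 0")
  case False
  hence "0 < N (B *v e)" by (simp add: zero_less_iff_neq_zero)
  then obtain v where v: "0 < inner (B *v e) v" "N (B *v e) \<le> ennreal (inner (B *v e) v powr p')"
    "nn_average E (\<lambda>x. ennreal (norm (P x *v v) powr p)) \<le> ennreal \<alpha>"
    by (rule norming_vector)
  have "ennreal (norm (B *v v)) \<le> ennreal c * ennreal_powr (ennreal \<alpha>) (1 / p)"
    by (rule order_trans[OF red], intro mult_left_mono ennreal_powr_mono v) (use p in auto)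
  hence Bv: "norm (B *v v) \<le> c * \<alpha> powr (1 / p)"
    using c alpha by (simp add: ennreal_le_iff flip: ennreal_mult)
  have "inner (B *v e) v = inner e (B *v v)" by (simp add: inner_matrix_vector B)
  also have "\<dots> \<le> norm e * norm (B *v v)" by (rule norm_cauchy_schwarz)
  also have "\<dots> \<le> norm e * (c * \<alpha> powr (1 / p))" by (intro mult_left_mono Bv) auto
  finally have "inner (B *v e) v powr p' \<le> (c * \<alpha> powr (1 / p) * norm e) powr p'"
    using v(1) p' by (intro powr_mono2) (auto simp: mult.commute)
  thus ?thesis using v(2) by (meson ennreal_leI order_trans)
qed simp

end

section \<open>Dyadic grids of cubes\<close>

definition line_cell :: "(int \<Rightarrow> real set set) \<Rightarrow> int \<Rightarrow> real \<Rightarrow> real set" where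
  "line_cell G k x = (THE I. I \<in> G k \<and> x \<in> I)"

context
  fixes G assumes G: "dyadic_grid_line G"
begin

lemma line_cell_unique: "I \<in> G k \<Longrightarrow> x \<in> I \<Longrightarrow> line_cell G k x = I"
proof -
  assume I: "I \<in> G k" "x \<in> I"
  have "partition_on UNIV (G k)" using G by (simp add: dyadic_grid_line_def)
  hence disj: "A \<inter> B = {}" if "A \<in> G k" "B \<in> G k" "A \<noteq> B" for A B
    using that by (simp add: partition_on_def disjoint_def)
  show ?thesis
    unfolding line_cell_def
  proof (rule the_equality)
    fix J assume "J \<in> G k \<and> x \<in> J"
    thus "J = I" using disj[of J I] I by blast
  qed (use I in simp)
qed

lemma line_cell: "line_cell G k x \<in> G k" "x \<in> line_cell G k x"
proof -
  have "partition_on UNIV (G k)" using G by (simp add: dyadic_grid_line_def)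
  hence "x \<in> \<Union> (G k)" by (simp add: partition_on_def)
  then obtain I where I: "I \<in> G k" "x \<in> I" by blast
  with line_cell_unique[OF I] show "line_cell G k x \<in> G k" "x \<in> line_cell G k x" by simp_all
qed

lemma line_cell_eq: "y \<in> line_cell G k x \<Longrightarrow> line_cell G k y = line_cell G k x"
  by (rule line_cell_unique[OF line_cell(1)])

lemma line_cell_interval: "\<exists>a. line_cell G k x = {a..<a + 2 powi (- k)}"
proof -
  have "\<forall>k. \<forall>I\<in>G k. \<exists>a. I = {a..<a + 2 powi (- k)}"
    using G unfolding dyadic_grid_line_def by (elim conjE)
  thus ?thesis using line_cell(1)[of k x] by (elim allE ballE) auto
qed

lemma line_cell_step: "line_cell G (k + 1) x \<subseteq> line_cell G k x"
proof -
  have "\<forall>k. \<forall>I\<in>G k. \<exists>J\<in>G (k + 1). \<exists>J'\<in>G (k + 1). J \<noteq> J' \<and> I = J \<union> J'"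
    using G unfolding dyadic_grid_line_def by (elim conjE)
  from this[rule_format, OF line_cell(1)[of k x]] obtain J J'
    where J: "J \<in> G (k + 1)" "J' \<in> G (k + 1)" "line_cell G k x = J \<union> J'" by blast
  have "x \<in> J \<or> x \<in> J'" using line_cell(2)[of x k] J(3) by simp
  hence "line_cell G (k + 1) x = J \<or> line_cell G (k + 1) x = J'"
    using line_cell_unique[OF J(1)] line_cell_unique[OF J(2)] by blast
  thus ?thesis using J by blast
qed

end

definition cube :: "('n \<Rightarrow> int \<Rightarrow> real set set) \<Rightarrow> int \<Rightarrow> real^'n \<Rightarrow> (real^'n) set" where
  "cube G k x = {y. \<forall>i. y $ i \<in> line_cell (G i) k (x $ i)}"

lemma half_open_cube:
  fixes a :: "real^'n" and h :: real
  assumes "0 < h"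
  defines "S \<equiv> {y. \<forall>i. y $ i \<in> {a $ i..<a $ i + h}}"
  shows "S \<in> sets borel" "emeasure lborel S = ennreal (h ^ CARD('n))"
    "\<exists>U. open U \<and> U \<noteq> {} \<and> U \<subseteq> S"
proof -
  define b where "b = (\<chi> i. a $ i + h)"
  have S: "S = (\<Inter>i. {y. a $ i \<le> y $ i}) \<inter> (\<Inter>i. {y. y $ i < a $ i + h})" by (auto simp: S_def)
  have "closed (\<Inter>i. {y :: real^'n. a $ i \<le> y $ i})"
    by (intro closed_INT ballI closed_Collect_le continuous_intros)
  moreover have "open (\<Inter>i. {y :: real^'n. y $ i < a $ i + h})"
    by (intro open_INT ballI open_Collect_less continuous_intros) auto
  ultimately show Sm: "S \<in> sets borel" unfolding S by (intro sets.Int) auto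
  have sub: "box a b \<subseteq> S" "S \<subseteq> cbox a b"
    by (auto simp: S_def b_def mem_box_cart less_imp_le)
  have ba: "(b - a) \<bullet> e = h" if "e \<in> Basis" for e
  proof -
    have "b - a = (\<chi> i. h)" by (simp add: b_def vec_eq_iff)
    thus ?thesis using that by (auto simp: Basis_vec_def inner_axis)
  qed
  have le: "a \<bullet> e \<le> b \<bullet> e" "a \<bullet> e < b \<bullet> e" if "e \<in> Basis" for e
    using ba[OF that] assms(1) by (simp_all add: inner_diff_left)
  have prod: "(\<Prod>e\<in>Basis. (b - a) \<bullet> e) = h ^ CARD('n)" using ba by simp
  have "emeasure lborel (box a b) = ennreal (h ^ CARD('n))"
    using emeasure_lborel_box[of a b, OF le(1)] prod by simp
  moreover have "emeasure lborel (cbox a b) = ennreal (h ^ CARD('n))"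
    using emeasure_lborel_cbox[of a b, OF le(1)] prod by simp
  ultimately show "emeasure lborel S = ennreal (h ^ CARD('n))"
    using emeasure_mono[OF sub(1), of lborel] emeasure_mono[OF sub(2), of lborel] Sm by simp
  have "box a b \<noteq> {}" using le(2) by (simp add: box_ne_empty)
  thus "\<exists>U. open U \<and> U \<noteq> {} \<and> U \<subseteq> S" using sub(1) open_box by blast
qed

context
  fixes G :: "'n::finite \<Rightarrow> int \<Rightarrow> real set set"
  assumes G: "\<And>i. dyadic_grid_line (G i)"
begin

lemma cube_half_open: "\<exists>a. cube G k x = {y. \<forall>i. y $ i \<in> {a $ i..<a $ i + 2 powi (- k)}}"
proof -
  have "\<exists>a. \<forall>i. line_cell (G i) k (x $ i) = {a i..<a i + 2 powi (- k)}"
    using line_cell_interval[OF G] by (intro choice) blast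
  then obtain a where "\<And>i. line_cell (G i) k (x $ i) = {a i..<a i + 2 powi (- k)}" by blast
  thus ?thesis by (intro exI[of _ "\<chi> i. a i"]) (simp add: cube_def)
qed

lemma cube_measure: "emeasure lborel (cube G k x) = ennreal ((2 powi (- k)) ^ CARD('n))"
  using cube_half_open[of k x] half_open_cube(2)[of "2 powi (- k)"] by auto

lemma cube_self: "x \<in> cube G k x"
  by (simp add: cube_def line_cell(2)[OF G])

lemma cube_eq: "y \<in> cube G k x \<Longrightarrow> cube G k y = cube G k x"
proof -
  assume y: "y \<in> cube G k x"
  have "line_cell (G i) k (y $ i) = line_cell (G i) k (x $ i)" for i
    by (rule line_cell_eq[OF G]) (use y in \<open>simp add: cube_def\<close>)
  thus ?thesis by (simp add: cube_def)
qed

lemma cube_countable: "countable (range (cube G k))"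
proof -
  obtain X :: "(real^'n) set" where X: "countable X" "\<And>U. open U \<Longrightarrow> U \<noteq> {} \<Longrightarrow> \<exists>d\<in>X. d \<in> U"
    using countable_dense_exists by blast
  have "cube G k x \<in> cube G k ` X" for x
  proof -
    obtain a where a: "cube G k x = {y. \<forall>i. y $ i \<in> {a $ i..<a $ i + 2 powi (- k)}}"
      using cube_half_open by blast
    have "\<exists>U. open U \<and> U \<noteq> {} \<and> U \<subseteq> cube G k x"
      unfolding a by (rule half_open_cube(3)) simp
    then obtain U where "open U" "U \<noteq> {}" "U \<subseteq> cube G k x" by blast
    then obtain d where "d \<in> X" "d \<in> cube G k x" using X(2) by blast
    thus ?thesis using cube_eq[of d k x] by blast
  qed
  thus ?thesis by (intro countable_subset[OF _ countable_image[OF X(1)]]) blast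
qed

lemma cube_doubling_grid:
  assumes "2 ^ CARD('n) \<le> D"
  shows "doubling_grid (cube G) D"
proof
  fix k :: int and x y :: "real^'n"
  show "countable (range (cube G k))" by (rule cube_countable)
  show "cube G k x \<in> sets borel"
    using cube_half_open[of k x] half_open_cube(1)[of "2 powi (- k)"] by auto
  show "0 < emeasure lborel (cube G k x)" "emeasure lborel (cube G k x) < top"
    by (simp_all add: cube_measure)
  show "x \<in> cube G k x" by (rule cube_self)
  show "y \<in> cube G k x \<Longrightarrow> cube G k y = cube G k x" by (rule cube_eq)
  show "cube G (k + 1) x \<subseteq> cube G k x"
    using line_cell_step[OF G] unfolding cube_def by blast
  have "1 \<le> (2::real) ^ CARD('n)" by (rule one_le_power) simp
  thus "1 \<le> D" using assms by (rule order_trans)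
  have "(2 powi (- k)) ^ CARD('n) \<le> D * (2 powi (- (k + 1))) ^ CARD('n)"
  proof -
    have "(2::real) powi (- k) = 2 powi (1 + - (k + 1))" by simp
    also have "\<dots> = 2 powi 1 * 2 powi (- (k + 1))" by (rule power_int_add) simp
    finally have "(2::real) powi (- k) = 2 * 2 powi (- (k + 1))" by simp
    hence "(2 powi (- k)) ^ CARD('n) = 2 ^ CARD('n) * (2 powi (- (k + 1) :: int) :: real) ^ CARD('n)"
      by (simp only: power_mult_distrib)
    also have "\<dots> \<le> D * (2 powi (- (k + 1))) ^ CARD('n)"
      using assms by (intro mult_right_mono) auto
    finally show ?thesis .
  qed
  thus "emeasure lborel (cube G k x) \<le> ennreal D * emeasure lborel (cube G (k + 1) x)"
    using \<open>1 \<le> D\<close> unfolding cube_measure by (simp add: ennreal_leI flip: ennreal_mult)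
qed

lemma cube_shrink:
  fixes x :: "real^'n"
  assumes "0 < e"
  shows "\<exists>N0. \<forall>N\<ge>N0. cube G N x \<subseteq> ball x e"
proof -
  have lim: "(\<lambda>m. real CARD('n) * (1 / 2) ^ m) \<longlonglongrightarrow> real CARD('n) * 0"
    by (intro tendsto_intros LIMSEQ_power_zero) simp
  hence "eventually (\<lambda>m. real CARD('n) * (1 / 2) ^ m < e) sequentially"
    using order_tendstoD(2)[OF lim, of e] assms by simp
  then obtain m0 where m0: "\<And>m. m \<ge> m0 \<Longrightarrow> real CARD('n) * (1 / 2) ^ m < e"
    by (auto simp: eventually_sequentially)
  show ?thesis
  proof (intro exI allI impI subsetI)
    fix N y assume N: "int m0 \<le> N" and y: "y \<in> cube G N x"
    obtain a where a: "cube G N x = {y. \<forall>i. y $ i \<in> {a $ i..<a $ i + 2 powi (- N)}}"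
      using cube_half_open by blast
    have "\<bar>(x - y) $ i\<bar> \<le> 2 powi (- N)" for i
      using y cube_self[of x N] unfolding a by (auto simp: abs_le_iff) (smt (verit))+
    hence "norm (x - y) \<le> (\<Sum>i\<in>(UNIV::'n set). 2 powi (- N))"
      by (intro order_trans[OF norm_le_l1_cart] sum_mono)
    also have "\<dots> = real CARD('n) * (1 / 2) ^ nat N"
      using N by (simp add: power_int_def power_one_over inverse_eq_divide)
    also have "\<dots> < e" using N by (intro m0) auto
    finally show "y \<in> ball x e" by (simp add: dist_norm)
  qed
qed

lemma cube_grid: "{Q. \<exists>k I. (\<forall>i. I i \<in> G i k) \<and> Q = {x. \<forall>i. x $ i \<in> I i}} = {cube G k x |k x. True}"
proof (intro equalityI subsetI)
  fix Q assume "Q \<in> {Q. \<exists>k I. (\<forall>i. I i \<in> G i k) \<and> Q = {x. \<forall>i. x $ i \<in> I i}}"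
  then obtain k I where I: "\<And>i. I i \<in> G i k" "Q = {x. \<forall>i. x $ i \<in> I i}" by blast
  have ne: "I i \<noteq> {}" for i
  proof -
    have "partition_on UNIV (G i k)" using G by (simp add: dyadic_grid_line_def)
    thus ?thesis using I(1)[of i] by (auto simp: partition_on_def)
  qed
  define t where "t i = (SOME u. u \<in> I i)" for i
  have t: "t i \<in> I i" for i using ne[of i] by (simp add: t_def some_in_eq)
  have "Q = cube G k (\<chi> i. t i)"
    unfolding I(2) cube_def using line_cell_unique[OF G I(1) t] by simp
  thus "Q \<in> {cube G k x |k x. True}" by blast
next
  fix Q assume "Q \<in> {cube G k x |k x. True}"
  then obtain k x where "Q = cube G k x" by blast
  hence "\<exists>k I. (\<forall>i. I i \<in> G i k) \<and> Q = {x. \<forall>i. x $ i \<in> I i}"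
    by (intro exI[of _ k] exI[of _ "\<lambda>i. line_cell (G i) k (x $ i)"]) (simp add: cube_def line_cell(1)[OF G])
  thus "Q \<in> {Q. \<exists>k I. (\<forall>i. I i \<in> G i k) \<and> Q = {x. \<forall>i. x $ i \<in> I i}}" by simp
qed

end

section \<open>Borel representatives\<close>

lemma lebesgue_borel_version:
  fixes f :: "'a::euclidean_space \<Rightarrow> 'b::euclidean_space"
  assumes f: "f \<in> borel_measurable lebesgue"
  obtains g where "g \<in> borel_measurable borel" "AE x in lborel. f x = g x"
proof -
  have "\<exists>g. g \<in> borel_measurable lborel \<and> (AE x in lborel. f x \<bullet> b = g x)" for b
    using completion_ex_borel_measurable_real[of "\<lambda>x. f x \<bullet> b" lborel] f by auto
  then obtain g where g: "\<And>b. g b \<in> borel_measurable lborel" "\<And>b. AE x in lborel. f x \<bullet> b = g b x"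
    by metis
  have "AE x in lborel. \<forall>b\<in>Basis. f x \<bullet> b = g b x"
    by (intro AE_finite_allI g) auto
  hence "AE x in lborel. f x = (\<Sum>b\<in>Basis. g b x *\<^sub>R b)"
  proof eventually_elim
    case (elim x)
    have "f x = (\<Sum>b\<in>Basis. (f x \<bullet> b) *\<^sub>R b)" by (rule euclidean_representation[symmetric])
    also have "\<dots> = (\<Sum>b\<in>Basis. g b x *\<^sub>R b)" using elim by (intro sum.cong) auto
    finally show ?case .
  qed
  moreover have "(\<lambda>x. \<Sum>b\<in>Basis. g b x *\<^sub>R b) \<in> borel_measurable borel"
    using g(1) by (intro borel_measurable_sum borel_measurable_scaleR) auto
  ultimately show thesis by (intro that)
qed

lemma locally_integrable_measurable:
  fixes W :: "'a::euclidean_space \<Rightarrow> 'b::euclidean_space"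
  assumes "locally_integrable W"
  shows "W \<in> borel_measurable lebesgue"
proof (rule borel_measurable_LIMSEQ_metric)
  fix n :: nat
  have "W absolutely_integrable_on cball 0 (real n)"
    using assms by (simp add: locally_integrable_def)
  thus "(\<lambda>x. indicator (cball 0 (real n)) x *\<^sub>R W x) \<in> borel_measurable lebesgue"
    unfolding set_integrable_def by (rule borel_measurable_integrable)
next
  fix x :: 'a
  obtain m :: nat where m: "norm x \<le> real m" using real_arch_simple by blast
  have "eventually (\<lambda>n. indicator (cball 0 (real n)) x *\<^sub>R W x = W x) sequentially"
    using eventually_ge_at_top[of m]
  proof eventually_elim
    case (elim n)
    thus ?case using m by simp
  qed
  thus "(\<lambda>n. indicator (cball 0 (real n)) x *\<^sub>R W x) \<longlonglongrightarrow> W x"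
    by (rule tendsto_eventually)
qed

text \<open>The exponent \<open>s\<close> is conjugate to \<open>s'\<close>. As \<open>\<epsilon>
  \<rightarrow> 0\<close>, \<open>s\<close> increases to \<open>p\<close>, and \<open>p/s - 1 = (p -
  1) \<epsilon> / (1 + \<epsilon>)\<close>.\<close>
lemma exponent_bounds:
  fixes p \<epsilon> :: real
  assumes p: "1 < p" and eps: "0 < \<epsilon>" "\<epsilon> \<le> 1"
  defines "s' \<equiv> conj_exponent p * (1 + \<epsilon>)"
  defines "s \<equiv> s' / (s' - 1)"
  shows "1 < s'" "1 < s" "1 / s + 1 / s' = 1" "(p - 1) * \<epsilon> / 2 \<le> p / s - 1" "1 < p / s" "p / s \<le> p"
proof -
  have q: "1 < conj_exponent p" using conj_exponent[OF p] by simp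
  hence "1 * 1 < conj_exponent p * (1 + \<epsilon>)" using eps by (intro mult_strict_mono) auto
  thus s': "1 < s'" by (simp add: s'_def)
  thus s: "1 < s" by (simp add: s_def field_simps)
  show "1 / s + 1 / s' = 1" using s' by (simp add: s_def field_simps)
  have "p / s' = (p - 1) / (1 + \<epsilon>)"
    unfolding s'_def using conj_exponent(3)[OF p] by (simp flip: divide_divide_eq_left)
  hence "p / s - 1 = p - 1 - (p - 1) / (1 + \<epsilon>)"
    using s' by (simp add: s_def diff_divide_distrib right_diff_distrib)
  also have "\<dots> = (p - 1) * (\<epsilon> / (1 + \<epsilon>))" using eps by (simp add: field_simps)
  finally have *: "p / s - 1 = (p - 1) * (\<epsilon> / (1 + \<epsilon>))" .
  have "\<epsilon> / 2 \<le> \<epsilon> / (1 + \<epsilon>)" using eps by (intro divide_left_mono) auto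
  hence "(p - 1) * (\<epsilon> / 2) \<le> (p - 1) * (\<epsilon> / (1 + \<epsilon>))" using p by (intro mult_left_mono) auto
  thus le: "(p - 1) * \<epsilon> / 2 \<le> p / s - 1" unfolding * by simp
  have "0 < (p - 1) * \<epsilon> / 2" using p eps by simp
  thus "1 < p / s" using le by linarith
  show "p / s \<le> p" using s p by (simp add: divide_le_eq)
qed

section \<open>The maximal function\<close>

lemma (in finite_cell) average_cong_AE:
  "AE x in lborel. x \<in> E \<longrightarrow> f x = g x \<Longrightarrow> nn_average E f = nn_average E g"
  by (intro antisym average_mono_AE; erule eventually_mono; simp)

lemma (in finite_cell) cross_average_cong_AE:
  fixes P P' Q Q' :: "'a \<Rightarrow> complex^'d^'d"
  assumes P: "AE x in lborel. P x = P' x" and Q: "AE x in lborel. Q x = Q' x"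
  shows "cross_average p P Q E = cross_average p P' Q' E"
  unfolding cross_average_def
proof (rule average_cong_AE)
  have "nn_average E (\<lambda>y. ennreal (matrix_opnorm (A ** Q y) powr r)) =
      nn_average E (\<lambda>y. ennreal (matrix_opnorm (A ** Q' y) powr r))" for A r
    by (rule average_cong_AE) (use Q in eventually_elim, simp)
  thus "AE x in lborel. x \<in> E \<longrightarrow>
      ennreal_powr (nn_average E (\<lambda>y. ennreal (matrix_opnorm (P x ** Q y) powr conj_exponent p))) (p / conj_exponent p) =
      ennreal_powr (nn_average E (\<lambda>y. ennreal (matrix_opnorm (P' x ** Q' y) powr conj_exponent p))) (p / conj_exponent p)"
    using P by (auto elim: eventually_mono)
qed

context two_grids
begin

lemma measurable_strong_maximal [measurable]: "strong_maximal f \<in> borel_measurable borel"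
  unfolding strong_maximal_def[abs_def] by measurable

text \<open>Each of the \<open>2 d\<close> vectors of the real orthonormal basis contributes, by
  Hoelder's inequality, the \<open>s'\<close>-mean of \<open>|Q B b|\<close>. The reverse Hoelder
  inequality lowers that exponent to \<open>p'\<close> at the cost of the factor \<open>4\<close>,
  and \<open>N_reducing\<close> bounds the result.\<close>
lemma weighted_average_bound:
  fixes P Q :: "'a \<times> 'b \<Rightarrow> complex^'d^'d" and B :: "complex^'d^'d" and p \<alpha> \<epsilon> c :: real
  assumes cells: "\<And>k l z. matrix_cell (rect k l z) P Q p \<alpha>"
    and B: "conj_transpose B = B"
    and red: "\<And>v. ennreal (norm (B *v v)) \<le>
      ennreal c * ennreal_powr (nn_average (rect k l z) (\<lambda>x. ennreal (norm (P x *v v) powr p))) (1 / p)"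
    and c: "0 \<le> c" and eps: "0 < \<epsilon>" "\<epsilon> * (96 * D * \<alpha> powr (1 / (p - 1))) \<le> 1"
    and f: "f \<in> borel_measurable borel"
  defines "s' \<equiv> conj_exponent p * (1 + \<epsilon>)"
  defines "s \<equiv> s' / (s' - 1)"
  shows "nn_average (rect k l z) (\<lambda>y. ennreal (norm (B *v f y))) \<le>
    ennreal (8 * real CARD('d) * c * \<alpha> powr (1 / p)) *
    ennreal_powr (nn_average (rect k l z) (\<lambda>y. ennreal_powr (ennreal (norm (P y *v f y))) s)) (1 / s)"
proof -
  interpret M: matrix_cell "rect k l z" P Q p \<alpha> by (rule cells)
  let ?R = "rect k l z"
  define K where "K = \<alpha> powr (1 / (p - 1))"
  have K: "1 \<le> K" unfolding K_def using M.alpha_ge_1 M.p by (intro ge_one_powr_ge_zero) auto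
  have eps1: "\<epsilon> \<le> 1"
  proof -
    have "1 * 1 \<le> D * K" using A.D_ge_1 K by (intro mult_mono) auto
    hence "\<epsilon> * 1 \<le> \<epsilon> * (96 * D * K)" using eps by (intro mult_left_mono) auto
    thus ?thesis using eps(2) by (simp add: K_def)
  qed
  note s = exponent_bounds[OF M.p eps(1) eps1, folded s'_def, folded s_def]
  define h where "h y = ennreal (norm (P y *v f y))" for y
  have [measurable]: "h \<in> borel_measurable borel"
    unfolding h_def using borel_measurable_matrix_vector[OF M.measurable_P f] by measurable
  define g where "g b y = ennreal (norm (Q y *v (B *v b)))" for b y
  have [measurable]: "g b \<in> borel_measurable borel" for b
    unfolding g_def using M.measurable_Qv by measurable
  define H where "H = ennreal_powr (nn_average ?R (\<lambda>y. ennreal_powr (h y) s)) (1 / s)"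
  define c0 where "c0 = c * \<alpha> powr (1 / p)"
  have c0: "0 \<le> c0" using c by (simp add: c0_def)
  have pointwise: "AE y in lborel. y \<in> ?R \<longrightarrow> ennreal (norm (B *v f y)) \<le> (\<Sum>b\<in>Basis. g b y * h y)"
    using M.herm M.inv
  proof eventually_elim
    case (elim y)
    have "\<bar>(B *v f y) \<bullet> b\<bar> \<le> norm (Q y *v (B *v b)) * norm (P y *v f y)" for b
    proof -
      have "(B *v f y) \<bullet> b = (Q y *v (P y *v f y)) \<bullet> (B *v b)"
        using elim by (simp add: inner_matrix_vector B matrix_vector_mul_assoc)
      also have "\<dots> = (P y *v f y) \<bullet> (Q y *v (B *v b))"
        using elim by (simp add: inner_matrix_vector[of "Q y"])
      finally show ?thesis
        using Cauchy_Schwarz_ineq2[of "P y *v f y" "Q y *v (B *v b)"] by (simp add: mult.commute)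
    qed
    hence "norm (B *v f y) \<le> (\<Sum>b\<in>Basis. norm (Q y *v (B *v b)) * norm (P y *v f y))"
      by (intro order_trans[OF norm_le_l1] sum_mono)
    hence "ennreal (norm (B *v f y)) \<le> ennreal (\<Sum>b\<in>Basis. norm (Q y *v (B *v b)) * norm (P y *v f y))"
      by (rule ennreal_leI)
    also have "\<dots> = (\<Sum>b\<in>Basis. g b y * h y)"
      unfolding g_def h_def by (simp add: ennreal_mult flip: sum_ennreal)
    finally show ?case by simp
  qed
  have gb: "nn_average ?R (\<lambda>y. g b y * h y) \<le> ennreal (4 * c0) * H" if b: "b \<in> Basis" for b
  proof -
    let ?w = "M.w (B *v b)"
    have cond: "sqrt_condition2 K ?w"
      unfolding sqrt_condition2_def
    proof (intro allI)
      fix i j x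
      interpret C: matrix_cell "rect i j x" P Q p \<alpha> by (rule cells)
      have "?w = C.w (B *v b)" by (simp add: fun_eq_iff M.w_def C.w_def)
      thus "nn_average (rect i j x) ?w < top \<and> nn_average (rect i j x) ?w \<le>
          ennreal K * (nn_average (rect i j x) (\<lambda>y. ennreal_powr (?w y) (1/2)))\<^sup>2"
        using C.N_finite[of "B *v b"] C.N_sqrt_bound[of "B *v b"] by (simp add: C.N_def K_def)
    qed
    have "nn_average ?R (\<lambda>y. ennreal_powr (g b y) s') = nn_average ?R (\<lambda>y. ennreal_powr (?w y) (1 + \<epsilon>))"
      by (simp add: g_def M.w_def s'_def powr_powr)
    also have "\<dots> \<le> 4 * ennreal_powr (M.N (B *v b)) (1 + \<epsilon>)"
      unfolding M.N_def by (rule reverse_Holder_rect[OF M.measurable_w K cond]) (use eps in \<open>simp_all add: K_def\<close>)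
    also have "\<dots> \<le> 4 * ennreal_powr (ennreal (c0 powr conj_exponent p)) (1 + \<epsilon>)"
      using M.N_reducing[OF B red c, of b] b eps
      by (intro mult_left_mono ennreal_powr_mono) (auto simp: c0_def)
    also have "\<dots> = 4 * ennreal (c0 powr s')" by (simp add: powr_powr s'_def)
    finally have "ennreal_powr (nn_average ?R (\<lambda>y. ennreal_powr (g b y) s')) (1 / s') \<le> ennreal_powr (4 * ennreal (c0 powr s')) (1 / s')"
      using s by (intro ennreal_powr_mono) auto
    also have "4 * ennreal (c0 powr s') = ennreal (4 * c0 powr s')"
      by (simp add: ennreal_mult)
    also have "ennreal_powr (ennreal (4 * c0 powr s')) (1 / s') = ennreal (4 powr (1 / s') * c0)"
      using s c0 by (simp add: powr_mult powr_powr)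
    also have "\<dots> \<le> ennreal (4 * c0)"
    proof (intro ennreal_leI mult_right_mono c0)
      have "4 powr (1 / s') \<le> (4::real) powr 1" using s by (intro powr_mono) auto
      thus "4 powr (1 / s') \<le> (4::real)" by simp
    qed
    finally have 1: "ennreal_powr (nn_average ?R (\<lambda>y. ennreal_powr (g b y) s')) (1 / s') \<le> ennreal (4 * c0)" .
    have "nn_average ?R (\<lambda>y. g b y * h y) \<le> ennreal_powr (nn_average ?R (\<lambda>y. ennreal_powr (g b y) s')) (1 / s') * H"
      unfolding H_def by (rule R.average_Holder) (use s in simp_all)
    also have "\<dots> \<le> ennreal (4 * c0) * H" by (intro mult_right_mono 1) auto
    finally show ?thesis .
  qed
  have "nn_average ?R (\<lambda>y. ennreal (norm (B *v f y))) \<le> nn_average ?R (\<lambda>y. \<Sum>b\<in>Basis. g b y * h y)"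
    by (rule R.average_mono_AE[OF pointwise])
  also have "\<dots> = (\<Sum>b\<in>Basis. nn_average ?R (\<lambda>y. g b y * h y))"
    by (rule R.average_sum) simp_all
  also have "\<dots> \<le> (\<Sum>b\<in>(Basis :: (complex^'d) set). ennreal (4 * c0) * H)"
    by (intro sum_mono gb)
  also have "\<dots> = ennreal (8 * real CARD('d) * c0) * H"
  proof -
    have "ennreal (8 * real CARD('d) * c0) = ennreal (real (CARD('d) * 2)) * ennreal (4 * c0)"
      using c0 by (simp flip: ennreal_mult)
    moreover have "ennreal (real (CARD('d) * 2)) = of_nat (CARD('d) * 2)"
      by (rule ennreal_of_nat_eq_real_of_nat[symmetric])
    ultimately show ?thesis by (simp add: mult.assoc)
  qed
  finally show ?thesis by (simp add: H_def h_def c0_def mult.assoc)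
qed

text \<open>The choice \<open>\<epsilon> = 1/(96 D K)\<close> is the largest one that the reverse
  Hoelder inequality permits. The pointwise bound of \<open>weighted_average_bound\<close>
  contributes \<open>\<alpha> powr (1/p)\<close>, and the strong maximal function contributes
  \<open>K powr (2/p) = \<alpha> powr (2/(p (p-1)))\<close>.\<close>
theorem rect_maximal_bound:
  fixes W :: "'a \<times> 'b \<Rightarrow> complex^'d^'d" and f :: "'a \<times> 'b \<Rightarrow> complex^'d"
  assumes p: "1 < p" and W: "matrix_weight W"
    and red: "\<And>k l z. reducing_operator p W (rect k l z) (WR (rect k l z))"
    and Ap: "\<And>k l z. cross_average p (\<lambda>x. matrix_powr (W x) (1 / p)) (\<lambda>y. matrix_powr (W y) (- 1 / p)) (rect k l z) \<le> ennreal \<alpha>"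
    and alpha: "0 \<le> \<alpha>" and f: "f \<in> borel_measurable lebesgue"
  shows "Lp_norm p (\<lambda>z. SUP k. SUP l. nn_average (rect k l z) (\<lambda>y. ennreal (norm (WR (rect k l z) *v f y)))) \<le>
    ennreal (8 * real CARD('d) * sqrt (real CARD('d)) * (2 powr (p + 1) * 96 * D / (p - 1)) powr (2 / p)
      * \<alpha> powr ((p + 1) / (p * (p - 1)))) * weighted_Lp_norm p W f"
proof -
  have "W \<in> borel_measurable lebesgue"
    using W by (intro locally_integrable_measurable) (simp add: matrix_weight_def)
  then obtain W0 where W0: "W0 \<in> borel_measurable borel" "AE x in lborel. W x = W0 x"
    by (rule lebesgue_borel_version)
  obtain f0 where f0: "f0 \<in> borel_measurable borel" "AE x in lborel. f x = f0 x"
    using lebesgue_borel_version[OF f] .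
  have pd: "AE x in lborel. positive_definite (W x)"
    using W by (simp add: matrix_weight_def AE_completion_iff)
  have "AE x in lborel. positive_definite (W0 x)"
    using pd W0(2) by eventually_elim simp
  note pd0 = this
  have W0m: "W0 \<in> borel_measurable lborel" using W0(1) by simp
  obtain P where P: "P \<in> borel_measurable lborel" "AE x in lborel. P x = matrix_powr (W0 x) (1 / p)"
    using matrix_powr_measurable_version[OF W0m pd0] .
  obtain Q where Q: "Q \<in> borel_measurable lborel" "AE x in lborel. Q x = matrix_powr (W0 x) (- 1 / p)"
    using matrix_powr_measurable_version[OF W0m pd0] .
  have PW: "AE x in lborel. P x = matrix_powr (W x) (1 / p)"
    using P(2) W0(2) by eventually_elim simp
  have QW: "AE x in lborel. Q x = matrix_powr (W x) (- 1 / p)"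
    using Q(2) W0(2) by eventually_elim simp
  have cells: "matrix_cell (rect k l z) P Q p \<alpha>" for k l z
  proof
    show "P \<in> borel_measurable borel" "Q \<in> borel_measurable borel" using P(1) Q(1) by simp_all
    show "1 < p" "0 \<le> \<alpha>" by fact+
    show "AE x in lborel. conj_transpose (P x) = P x \<and> conj_transpose (Q x) = Q x"
      using PW QW pd by eventually_elim (simp add: matrix_powr_hermitian)
    show "AE x in lborel. P x ** Q x = mat 1 \<and> Q x ** P x = mat 1"
      using PW QW pd by eventually_elim (simp add: matrix_powr_inverse flip: minus_divide_left)
    show "cross_average p P Q (rect k l z) \<le> ennreal \<alpha>"
      using Ap[of k l z] R.cross_average_cong_AE[OF PW QW] by simp
  qed
  interpret M: matrix_cell "rect 0 0 undefined" P Q p \<alpha> by (rule cells)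
  define K where "K = \<alpha> powr (1 / (p - 1))"
  have K: "1 \<le> K" unfolding K_def using M.alpha_ge_1 p by (intro ge_one_powr_ge_zero) auto
  define \<epsilon> where "\<epsilon> = 1 / (96 * D * K)"
  have DK: "1 * 1 \<le> D * K" using A.D_ge_1 K by (intro mult_mono) auto
  hence eps: "0 < \<epsilon>" "\<epsilon> * (96 * D * K) \<le> 1" "\<epsilon> \<le> 1"
    by (auto simp: \<epsilon>_def)
  define s' where "s' = conj_exponent p * (1 + \<epsilon>)"
  define s where "s = s' / (s' - 1)"
  note s = exponent_bounds[OF p eps(1,3), folded s'_def, folded s_def]
  define q where "q = p / s"
  define c0 where "c0 = 8 * real CARD('d) * sqrt (real CARD('d)) * \<alpha> powr (1 / p)"
  have c0: "0 \<le> c0" by (simp add: c0_def)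
  define h where "h y = ennreal (norm (P y *v f0 y))" for y
  have [measurable]: "h \<in> borel_measurable borel"
    unfolding h_def using borel_measurable_matrix_vector[OF M.measurable_P f0(1)] by measurable
  define S where "S = strong_maximal (\<lambda>y. ennreal_powr (h y) s)"
  have [measurable]: "S \<in> borel_measurable borel" unfolding S_def by measurable
  have avg: "nn_average (rect k l z) (\<lambda>y. ennreal (norm (WR (rect k l z) *v f y))) \<le> ennreal c0 * ennreal_powr (S z) (1 / s)" for k l z
  proof -
    let ?B = "WR (rect k l z)"
    have rB: "conj_transpose ?B = ?B"
      using red[of k l z] by (simp add: reducing_operator_def positive_definite_def)
    have rn: "ennreal (norm (?B *v v)) \<le> ennreal (sqrt (real CARD('d))) *
        ennreal_powr (nn_average (rect k l z) (\<lambda>x. ennreal (norm (P x *v v) powr p))) (1 / p)" for v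
    proof -
      have "nn_average (rect k l z) (\<lambda>x. ennreal (norm (P x *v v) powr p)) =
          nn_average (rect k l z) (\<lambda>x. ennreal (norm (matrix_powr (W x) (1 / p) *v v) powr p))"
        by (rule R.average_cong_AE) (use PW in eventually_elim, simp)
      thus ?thesis using red[of k l z] by (simp add: reducing_operator_def Let_def)
    qed
    have "nn_average (rect k l z) (\<lambda>y. ennreal (norm (?B *v f y))) = nn_average (rect k l z) (\<lambda>y. ennreal (norm (?B *v f0 y)))"
      by (rule R.average_cong_AE) (use f0(2) in eventually_elim, simp)
    also have "\<dots> \<le> ennreal c0 * ennreal_powr (nn_average (rect k l z) (\<lambda>y. ennreal_powr (h y) s)) (1 / s)"
      using weighted_average_bound[OF cells rB rn _ eps(1) eps(2)[unfolded K_def] f0(1)]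
      by (simp add: h_def c0_def s_def s'_def)
    also have "\<dots> \<le> ennreal c0 * ennreal_powr (S z) (1 / s)"
      using s unfolding S_def strong_maximal_def
      by (intro mult_left_mono ennreal_powr_mono SUP_upper2[of k] SUP_upper2[of l]) auto
    finally show ?thesis .
  qed
  let ?M = "\<lambda>z. SUP k. SUP l. nn_average (rect k l z) (\<lambda>y. ennreal (norm (WR (rect k l z) *v f y)))"
  let ?C = "2 powr q / (q - 1)"
  have "(\<integral>\<^sup>+z. ennreal_powr (?M z) p \<partial>lborel) \<le> (\<integral>\<^sup>+z. ennreal (c0 powr p) * ennreal_powr (S z) q \<partial>lborel)"
  proof (rule nn_integral_mono)
    fix z
    have "ennreal_powr (?M z) p \<le> ennreal_powr (ennreal c0 * ennreal_powr (S z) (1 / s)) p"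
      using p by (intro ennreal_powr_mono SUP_least avg) auto
    also have "\<dots> = ennreal (c0 powr p) * ennreal_powr (S z) q"
      using p c0 by (simp add: ennreal_powr_mult ennreal_powr_powr q_def)
    finally show "ennreal_powr (?M z) p \<le> ennreal (c0 powr p) * ennreal_powr (S z) q" .
  qed
  also have "\<dots> = ennreal (c0 powr p) * (\<integral>\<^sup>+z. ennreal_powr (S z) q \<partial>lborel)"
    by (rule nn_integral_cmult) measurable
  also have "\<dots> \<le> ennreal (c0 powr p) * (ennreal (?C\<^sup>2) * (\<integral>\<^sup>+z. ennreal_powr (ennreal_powr (h z) s) q \<partial>lborel))"
    unfolding S_def by (intro mult_left_mono strong_maximal_bound) (use s in \<open>simp_all add: q_def\<close>)
  also have "\<dots> = ennreal (c0 powr p * ?C\<^sup>2) * (\<integral>\<^sup>+z. ennreal_powr (h z) p \<partial>lborel)"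
    using s by (simp add: ennreal_powr_powr q_def ennreal_mult mult.assoc)
  finally have main: "(\<integral>\<^sup>+z. ennreal_powr (?M z) p \<partial>lborel) \<le> ennreal (c0 powr p * ?C\<^sup>2) * (\<integral>\<^sup>+z. ennreal_powr (h z) p \<partial>lborel)" .
  have norm_f: "weighted_Lp_norm p W f = ennreal_powr (\<integral>\<^sup>+z. ennreal_powr (h z) p \<partial>lborel) (1 / p)"
  proof -
    have "(\<integral>\<^sup>+z. ennreal_powr (ennreal (norm (matrix_powr (W z) (1 / p) *v f z))) p \<partial>lborel) = (\<integral>\<^sup>+z. ennreal_powr (h z) p \<partial>lborel)"
    proof (rule nn_integral_cong_AE)
      show "AE z in lborel. ennreal_powr (ennreal (norm (matrix_powr (W z) (1 / p) *v f z))) p = ennreal_powr (h z) p"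
        using PW f0(2) by eventually_elim (simp add: h_def)
    qed
    thus ?thesis by (simp add: weighted_Lp_norm_def Lp_norm_def nn_integral_completion)
  qed
  define c2 where "c2 = 2 powr (p + 1) * 96 * D / (p - 1)"
  have c2: "0 \<le> c2" using p A.D_ge_1 by (simp add: c2_def)
  have C: "0 \<le> ?C" "?C \<le> c2 * K"
  proof -
    have q: "1 < q" "q \<le> p" "(p - 1) * \<epsilon> / 2 \<le> q - 1" using s by (simp_all add: q_def)
    show "0 \<le> ?C" using q by simp
    have pe: "0 < (p - 1) * \<epsilon> / 2" using p eps by simp
    have "?C \<le> 2 powr p / ((p - 1) * \<epsilon> / 2)"
      using q pe by (intro frac_le powr_mono) auto
    also have "\<dots> = c2 * K"
      using p DK A.D_ge_1 K by (simp add: \<epsilon>_def c2_def powr_add field_simps)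
    finally show "?C \<le> c2 * K" .
  qed
  have "Lp_norm p ?M = ennreal_powr (\<integral>\<^sup>+z. ennreal_powr (?M z) p \<partial>lborel) (1 / p)"
    by (simp add: Lp_norm_def nn_integral_completion)
  also have "\<dots> \<le> ennreal_powr (ennreal (c0 powr p * ?C\<^sup>2) * (\<integral>\<^sup>+z. ennreal_powr (h z) p \<partial>lborel)) (1 / p)"
    using p by (intro ennreal_powr_mono main) auto
  also have "\<dots> = ennreal ((c0 powr p * ?C\<^sup>2) powr (1 / p)) * weighted_Lp_norm p W f"
    using p by (simp add: ennreal_powr_mult norm_f)
  also have "\<dots> \<le> ennreal (c0 * (c2 * K) powr (2 / p)) * weighted_Lp_norm p W f"
  proof (intro mult_right_mono ennreal_leI)
    have "?C\<^sup>2 = ?C powr 2" using C(1) by simp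
    hence "(c0 powr p * ?C\<^sup>2) powr (1 / p) = c0 * ?C powr (2 / p)"
      using p c0 by (simp only: powr_mult powr_powr) simp
    also have "\<dots> \<le> c0 * (c2 * K) powr (2 / p)"
      using c0 C p by (intro mult_left_mono powr_mono2) auto
    finally show "(c0 powr p * ?C\<^sup>2) powr (1 / p) \<le> c0 * (c2 * K) powr (2 / p)" .
  qed simp
  also have "c0 * (c2 * K) powr (2 / p) = 8 * real CARD('d) * sqrt (real CARD('d)) * c2 powr (2 / p) * \<alpha> powr ((p + 1) / (p * (p - 1)))"
  proof -
    have "1 / p + 1 / (p - 1) * (2 / p) = (p + 1) / (p * (p - 1))" using p by (simp add: field_simps)
    hence "\<alpha> powr (1 / p) * K powr (2 / p) = \<alpha> powr ((p + 1) / (p * (p - 1)))"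
      unfolding K_def powr_powr powr_add[symmetric] by simp
    thus ?thesis by (simp add: c0_def powr_mult mult_ac)
  qed
  finally show ?thesis by (simp add: c2_def)
qed

end

theorem proposition4p1:
  fixes p :: real
  assumes "1 < p"
  shows "\<exists>C>0. \<forall>(\<D>1 :: (real^'n) set set) (\<D>2 :: (real^'m) set set)
           (W :: (real^'n) \<times> (real^'m) \<Rightarrow> complex^'d^'d)
           (WR :: ((real^'n) \<times> (real^'m)) set \<Rightarrow> complex^'d^'d).
           dyadic_grid \<D>1 \<longrightarrow> dyadic_grid \<D>2 \<longrightarrow> matrix_weight W \<longrightarrow>
           (\<forall>R\<in>product_grid \<D>1 \<D>2. reducing_operator p W R (WR R)) \<longrightarrow>
           weighted_op_norm p W (modified_CG_maximal (product_grid \<D>1 \<D>2) WR)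
             \<le> ennreal C * ennreal_powr (Ap_char p (product_grid \<D>1 \<D>2) W)
                             ((p + 1) / (p * (p - 1)))"
proof -
  define D :: real where "D = 2 ^ (CARD('n) + CARD('m))"
  define C where "C = 8 * real CARD('d) * sqrt (real CARD('d)) * (2 powr (p + 1) * 96 * D / (p - 1)) powr (2 / p)"
  have D: "0 < D" "2 ^ CARD('n) \<le> D" "2 ^ CARD('m) \<le> D"
    unfolding D_def by (auto intro!: power_increasing)
  have C: "0 < C" using assms D by (auto simp: C_def)
  show ?thesis
  proof (intro exI[of _ C] conjI C allI impI)
    fix \<D>1 :: "(real^'n) set set" and \<D>2 :: "(real^'m) set set"
      and W :: "(real^'n) \<times> (real^'m) \<Rightarrow> complex^'d^'d"
      and WR :: "((real^'n) \<times> (real^'m)) set \<Rightarrow> complex^'d^'d"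
    assume g1: "dyadic_grid \<D>1" and g2: "dyadic_grid \<D>2" and W: "matrix_weight W"
      and red: "\<forall>R\<in>product_grid \<D>1 \<D>2. reducing_operator p W R (WR R)"
    obtain G1 where "\<forall>i. dyadic_grid_line (G1 i)"
      and e1: "\<D>1 = {Q. \<exists>k I. (\<forall>i. I i \<in> G1 i k) \<and> Q = {x. \<forall>i. x $ i \<in> I i}}"
      using g1 unfolding dyadic_grid_def by (elim exE conjE)
    hence G1: "dyadic_grid_line (G1 i)" for i by simp
    have G1': "\<D>1 = {cube G1 k x |k x. True}" unfolding e1 by (rule cube_grid[OF G1])
    obtain G2 where "\<forall>i. dyadic_grid_line (G2 i)"
      and e2: "\<D>2 = {Q. \<exists>k I. (\<forall>i. I i \<in> G2 i k) \<and> Q = {x. \<forall>i. x $ i \<in> I i}}"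
      using g2 unfolding dyadic_grid_def by (elim exE conjE)
    hence G2: "dyadic_grid_line (G2 i)" for i by simp
    have G2': "\<D>2 = {cube G2 k x |k x. True}" unfolding e2 by (rule cube_grid[OF G2])
    interpret two_grids "cube G1" "cube G2" D
      by (intro two_grids.intro two_grids_axioms.intro cube_doubling_grid cube_shrink G1 G2 D)
    have grid: "product_grid \<D>1 \<D>2 = {rect k l z |k l z. True}"
      unfolding product_grid_def G1' G2' rect_def by force
    have rect_in: "rect k l z \<in> product_grid \<D>1 \<D>2" for k l z unfolding grid by blast
    let ?A = "Ap_char p (product_grid \<D>1 \<D>2) W"
    show "weighted_op_norm p W (modified_CG_maximal (product_grid \<D>1 \<D>2) WR)
        \<le> ennreal C * ennreal_powr ?A ((p + 1) / (p * (p - 1)))"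
    proof (cases ?A)
      case top
      thus ?thesis using C by (simp add: ennreal_mult_top)
    next
      case (real \<alpha>)
      have Ap: "cross_average p (\<lambda>x. matrix_powr (W x) (1 / p)) (\<lambda>y. matrix_powr (W y) (- 1 / p)) (rect k l z) \<le> ennreal \<alpha>" for k l z
        unfolding real(2)[symmetric] Ap_char_def cross_average_def
        by (rule SUP_upper2[of "rect k l z"]) (auto simp: rect_in)
      have red': "reducing_operator p W (rect k l z) (WR (rect k l z))" for k l z
        using red rect_in by blast
      have "Lp_norm p (modified_CG_maximal (product_grid \<D>1 \<D>2) WR f) \<le>
          ennreal (C * \<alpha> powr ((p + 1) / (p * (p - 1)))) * weighted_Lp_norm p W f"
        if f: "f \<in> weighted_Lp_space p W" for f
      proof -
        have "modified_CG_maximal (product_grid \<D>1 \<D>2) WR f z \<le>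
            (SUP k. SUP l. nn_average (rect k l z) (\<lambda>y. ennreal (norm (WR (rect k l z) *v f y))))" for z
          unfolding modified_CG_maximal_def
        proof (rule SUP_least)
          fix R assume "R \<in> product_grid \<D>1 \<D>2"
          then obtain k l y where R: "R = rect k l y" unfolding grid by blast
          show "nn_average R (\<lambda>y. ennreal (norm (WR R *v f y))) * indicator R z \<le>
              (SUP k. SUP l. nn_average (rect k l z) (\<lambda>y. ennreal (norm (WR (rect k l z) *v f y))))"
          proof (cases "z \<in> R")
            case True
            hence "R = rect k l z"
              using A.cell_eq[of "fst z" k "fst y"] B.cell_eq[of "snd z" l "snd y"]
              unfolding R rect_def by (simp add: mem_Times_iff)
            thus ?thesis using True by (intro SUP_upper2[of k] SUP_upper2[of l]) auto
          qed simp
        qed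
        hence "Lp_norm p (modified_CG_maximal (product_grid \<D>1 \<D>2) WR f) \<le>
            Lp_norm p (\<lambda>z. SUP k. SUP l. nn_average (rect k l z) (\<lambda>y. ennreal (norm (WR (rect k l z) *v f y))))"
          unfolding Lp_norm_def using assms by (intro ennreal_powr_mono nn_integral_mono) auto
        also have "\<dots> \<le> ennreal (C * \<alpha> powr ((p + 1) / (p * (p - 1)))) * weighted_Lp_norm p W f"
          unfolding C_def
          by (rule rect_maximal_bound[OF assms W red' Ap real(1)]) (use f in \<open>simp add: weighted_Lp_space_def\<close>)
        finally show ?thesis .
      qed
      hence "weighted_op_norm p W (modified_CG_maximal (product_grid \<D>1 \<D>2) WR) \<le> ennreal (C * \<alpha> powr ((p + 1) / (p * (p - 1))))"
        unfolding weighted_op_norm_def by (intro Inf_lower) blast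
      thus ?thesis using C real by (simp add: ennreal_mult)
    qed
  qed
qed

end
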